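(* Let $\mathfrak g$ be a complex simple Lie algebra of classical type $X$ and rank $l$, and let $I\subset\Pi$ be of cardinality $r$. If $X=A_l$, then $\sharp\mathcal F_I=\mathcal C_{l-r+1}$. If $X=B_l$, then $$\sharp\mathcal F_I=(l-r+1)\,\mathcal C_{l-r}+\sum_{j=1}^{n}\mathcal T'_{2(l-r)-l_j,\;l_j-1},$$ where $n=s-1$ if $\alpha_l\in I$, and $n=s$ otherwise. If $X=C_l$, then $\sharp\mathcal F_I=(l-r+1)\,\mathcal C_{l-r}$ if $\alpha_l\notin I$, and $\sharp\mathcal F_I=\frac{l-r+2}{2}\,\mathcal C_{l-r+1}$ if $\alpha_l\in I$. If $X=D_l$, then: - if $\sharp(\{\alpha_{l-1},\alpha_l\}\cap I)=1$, $\displaystyle\sharp\mathcal F_I=\frac{l-r+1}{2}\,\mathcal C_{l-r}+\sum_{j=1}^{s}\mathcal T'_{2(l-r)-l_j-1,\;l_j-1}$; - if $\{\alpha_{l-1},\alpha_l\}\subset I$, $\displaystyle\sharp\mathcal F_I=(l-r+1)\,\mathcal C_{l-r}+\sum_{j=1}^{s-1}\mathcal T'_{2(l-r)-l_j,\;l_j-1}$; - otherwise (that is, if $\{\alpha_{l-1},\alpha_l\}\cap I=\emptyset$), $\displaystyle\sharp\mathcal F_I=(3(l-r)-2)\,\mathcal C_{l-r-1}+\sum_{j=1}^{s}\Big(\mathcal T'_{2(l-r)-l_j-1,\;l_j-2}+\mathcal T'_{2(l-r)-l_j-1,\;l_j-1}\Big)$.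
   Context: $\Delta$ is the root system of $\mathfrak g$ (with respect to a Cartan subalgebra $\mathfrak h$), $\mathfrak g_\alpha$ ($\alpha\in\Delta$) the root spaces, $\Delta^+$ the positive roots, $\Pi=\{\alpha_1,\dots,\alpha_l\}$ the simple roots, numbered in the standard way: $\alpha_1,\dots,\alpha_l$ along the diagram in types $A_l$, $B_l$ ($\alpha_l$ short), $C_l$ ($\alpha_l$ long); in type $D_l$ ($l\ge4$), $\alpha_1,\dots,\alpha_{l-2}$ form a chain and $\alpha_{l-1},\alpha_l$ are both joined to $\alpha_{l-2}$. For $I\subset\Pi$, $\Delta_I=\mathbb ZI\cap\Delta$, $\mathfrak p_I=\mathfrak h\oplus\bigoplus_{\alpha\in\Delta_I\cup\Delta^+}\mathfrak g_\alpha$, and $$\mathcal F_I=\{\Phi\subset\Delta^+\setminus\Delta_I:\ \alpha\in\Phi,\ \beta\in\Delta^+\cup\Delta_I,\ \alpha+\beta\in\Delta^+\Rightarrow\alpha+\beta\in\Phi\}.$$ The map $\Phi\mapsto\bigoplus_{\alpha\in\Phi}\mathfrak g_\alpha$ is a bijection from $\mathcal F_I$ to the set of ad-nilpotent ideals of $\mathfrak p_I$ (ideals $\mathfrak i$ with $\mathrm{ad}_{\mathfrak p_I}x$ nilpotent for all $x\in\mathfrak i$), so $\sharp\mathcal F_I$ is the number of such ideals. $\mathcal C_m=\frac1{m+1}\binom{2m}{m}$ is the $m$-th Catalan number. For integers $p,q$, $\mathcal T'_{p,q}=\frac{(p+q+1)!\,(p-q+2)}{q!\,(p+2)!}$ for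 $q\ge0$, and $\mathcal T'_{p,-1}=0$. $I_1,\dots,I_s$ are the connected components of $I$ (in the Dynkin diagram), $r_j=\sharp I_j$, $m_j=\min\{i:\alpha_i\in I_j\}$, ordered so that $m_1<\dots<m_s$ ($s=0$ if $I=\emptyset$). In type $B_l$, $l_j=m_j-\sum_{k=1}^{j-1}r_k$. In type $D_l$, $l_j=m_j-\sum_{k=1}^{j-1}r_k$, except that if $I_s=\{\alpha_l\}$ then $l_s=m_s-\sum_{k=1}^{s-1}r_k-1$.
   Formalization: In type D_l with α_{l-1}, α_l both in I, the sum runs to s-1 only if α_{l-2} is in I; otherwise it runs to s-2, since the printed limit s-1 adds a spurious term C_{l-r} (for D_4, I={α_3,α_4} it gives 8 instead of 6). *)

theory Defs
  imports Complex_Main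
begin

section \<open>Complex simple Lie algebras and their roots\<close>

locale lie_algebra = vector_space scale
  for scale :: "complex \<Rightarrow> 'g::ab_group_add \<Rightarrow> 'g" +
  fixes brk :: "'g \<Rightarrow> 'g \<Rightarrow> 'g"
  assumes brk_add_left: "brk (x + y) z = brk x z + brk y z"
    and brk_add_right: "brk x (y + z) = brk x y + brk x z"
    and brk_scale_left: "brk (scale c x) y = scale c (brk x y)"
    and brk_scale_right: "brk x (scale c y) = scale c (brk x y)"
    and brk_self: "brk x x = 0"
    and jacobi: "brk x (brk y z) + brk y (brk z x) + brk z (brk x y) = 0"
    and finite_dim: "\<exists>B. finite B \<and> span B = UNIV"
begin

definition lie_ideal :: "'g set \<Rightarrow> bool" where
  "lie_ideal J \<longleftrightarrow> subspace J \<and> (\<forall>x. \<forall>y\<in>J. brk x y \<in> J)"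

definition ad_diagonalizable :: "'g \<Rightarrow> bool" where
  "ad_diagonalizable x \<longleftrightarrow> span {y. \<exists>c. brk x y = scale c y} = UNIV"

text \<open>The usual definition for semisimple complex Lie algebras: a self-centralizing
  commutative subalgebra acting diagonalizably.\<close>

definition cartan_subalgebra :: "'g set \<Rightarrow> bool" where
  "cartan_subalgebra H \<longleftrightarrow>
     subspace H \<and> (\<forall>x\<in>H. \<forall>y\<in>H. brk x y = 0) \<and>
     (\<forall>x. (\<forall>h\<in>H. brk h x = 0) \<longrightarrow> x \<in> H) \<and>
     (\<forall>h\<in>H. ad_diagonalizable h)"

text \<open>A linear form on \<open>H\<close> is represented by its extension by zero outside \<open>H\<close>, so that
  equality of forms is equality of functions.\<close>

definition dual_space :: "'g set \<Rightarrow> ('g \<Rightarrow> complex) set" where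
  "dual_space H = {f. (\<forall>x\<in>H. \<forall>y\<in>H. f (x + y) = f x + f y) \<and>
     (\<forall>c. \<forall>x\<in>H. f (scale c x) = c * f x) \<and> (\<forall>x. x \<notin> H \<longrightarrow> f x = 0)}"

definition root_space :: "'g set \<Rightarrow> ('g \<Rightarrow> complex) \<Rightarrow> 'g set" where
  "root_space H \<alpha> = {x. \<forall>h\<in>H. brk h x = scale (\<alpha> h) x}"

definition roots :: "'g set \<Rightarrow> ('g \<Rightarrow> complex) set" where
  "roots H = {\<alpha> \<in> dual_space H. \<alpha> \<noteq> (\<lambda>_. 0) \<and> root_space H \<alpha> \<noteq> {0}}"

text \<open>The coroot of \<open>\<alpha>\<close>: the element of \<open>[g\<^sub>\<alpha>, g\<^sub>-\<^sub>\<alpha>]\<close> on which \<open>\<alpha>\<close> takes the value 2.\<close>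

definition coroot :: "'g set \<Rightarrow> ('g \<Rightarrow> complex) \<Rightarrow> 'g" where
  "coroot H \<alpha> = (THE h. h \<in> span {brk x y |x y.
       x \<in> root_space H \<alpha> \<and> y \<in> root_space H (\<lambda>z. - \<alpha> z)} \<and> \<alpha> h = 2)"

end

locale simple_lie_algebra = lie_algebra +
  assumes nonabelian: "\<exists>x y. brk x y \<noteq> 0"
    and only_trivial_ideals: "lie_ideal J \<Longrightarrow> J = {0} \<or> J = UNIV"


section \<open>Bases and the sets \<open>F\<^sub>I\<close>\<close>

text \<open>A numbered family of simple roots \<open>\<alpha>\<^sub>1, \<dots>, \<alpha>\<^sub>l\<close> is a function on \<open>nat\<close> of which only the
  values on \<open>{1..l}\<close> matter; subsets of the set of simple roots are given by their sets of
  indices.\<close>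

definition int_comb :: "(nat \<Rightarrow> 'g \<Rightarrow> complex) \<Rightarrow> nat set \<Rightarrow> (nat \<Rightarrow> int) \<Rightarrow> 'g \<Rightarrow> complex" where
  "int_comb a I c = (\<lambda>x. \<Sum>i\<in>I. of_int (c i) * a i x)"

context lie_algebra
begin

definition simple_roots :: "'g set \<Rightarrow> nat \<Rightarrow> (nat \<Rightarrow> 'g \<Rightarrow> complex) \<Rightarrow> bool" where
  "simple_roots H l a \<longleftrightarrow>
     (\<forall>i\<in>{1..l}. a i \<in> roots H) \<and>
     (\<forall>c :: nat \<Rightarrow> complex. (\<forall>x. (\<Sum>i\<in>{1..l}. c i * a i x) = 0) \<longrightarrow> (\<forall>i\<in>{1..l}. c i = 0)) \<and>
     (\<forall>\<beta>\<in>roots H. \<exists>c. \<beta> = int_comb a {1..l} c \<and>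
        ((\<forall>i\<in>{1..l}. c i \<ge> 0) \<or> (\<forall>i\<in>{1..l}. c i \<le> 0)))"

definition positive_roots :: "'g set \<Rightarrow> nat \<Rightarrow> (nat \<Rightarrow> 'g \<Rightarrow> complex) \<Rightarrow> ('g \<Rightarrow> complex) set" where
  "positive_roots H l a =
     {\<beta> \<in> roots H. \<exists>c. \<beta> = int_comb a {1..l} c \<and> (\<forall>i\<in>{1..l}. c i \<ge> 0)}"

definition roots_of_subset ::
    "'g set \<Rightarrow> (nat \<Rightarrow> 'g \<Rightarrow> complex) \<Rightarrow> nat set \<Rightarrow> ('g \<Rightarrow> complex) set" where
  "roots_of_subset H a I = {\<beta> \<in> roots H. \<exists>c. \<beta> = int_comb a I c}"

definition ideal_root_sets ::
    "'g set \<Rightarrow> nat \<Rightarrow> (nat \<Rightarrow> 'g \<Rightarrow> complex) \<Rightarrow> nat set \<Rightarrow> ('g \<Rightarrow> complex) set set" where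
  "ideal_root_sets H l a I =
     {\<Phi>. \<Phi> \<subseteq> positive_roots H l a - roots_of_subset H a I \<and>
        (\<forall>\<alpha>\<in>\<Phi>. \<forall>\<beta> \<in> positive_roots H l a \<union> roots_of_subset H a I.
           (\<lambda>x. \<alpha> x + \<beta> x) \<in> positive_roots H l a \<longrightarrow> (\<lambda>x. \<alpha> x + \<beta> x) \<in> \<Phi>)}"

end


section \<open>Classical types\<close>

datatype classical_type = TypeA | TypeB | TypeC | TypeD

fun admissible_rank :: "classical_type \<Rightarrow> nat \<Rightarrow> bool" where
  "admissible_rank TypeA l \<longleftrightarrow> l \<ge> 1"
| "admissible_rank TypeB l \<longleftrightarrow> l \<ge> 2"
| "admissible_rank TypeC l \<longleftrightarrow> l \<ge> 2"
| "admissible_rank TypeD l \<longleftrightarrow> l \<ge> 4"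

text \<open>The entry at \<open>(i, j)\<close> is the value of \<open>\<alpha>\<^sub>j\<close> on the coroot of \<open>\<alpha>\<^sub>i\<close>, that is
  \<open>2 (\<alpha>\<^sub>i, \<alpha>\<^sub>j) / (\<alpha>\<^sub>i, \<alpha>\<^sub>i)\<close>; the entry \<open>-2\<close> therefore sits in the row of the shorter root.\<close>

fun cartan_matrix :: "classical_type \<Rightarrow> nat \<Rightarrow> nat \<Rightarrow> nat \<Rightarrow> int" where
  "cartan_matrix TypeA l i j =
     (if i = j then 2 else if i = j + 1 \<or> j = i + 1 then -1 else 0)"
| "cartan_matrix TypeB l i j =
     (if i = j then 2 else if i = l \<and> j + 1 = l then -2
      else if i = j + 1 \<or> j = i + 1 then -1 else 0)"
| "cartan_matrix TypeC l i j =
     (if i = j then 2 else if i + 1 = l \<and> j = l then -2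
      else if i = j + 1 \<or> j = i + 1 then -1 else 0)"
| "cartan_matrix TypeD l i j =
     (if i = j then 2
      else if i < l \<and> j < l \<and> (i = j + 1 \<or> j = i + 1) then -1
      else if (i = l \<and> j + 2 = l) \<or> (j = l \<and> i + 2 = l) then -1 else 0)"

definition (in lie_algebra) simple_roots_of_type ::
    "'g set \<Rightarrow> classical_type \<Rightarrow> nat \<Rightarrow> (nat \<Rightarrow> 'g \<Rightarrow> complex) \<Rightarrow> bool" where
  "simple_roots_of_type H X l a \<longleftrightarrow> admissible_rank X l \<and> simple_roots H l a \<and>
     (\<forall>i\<in>{1..l}. \<forall>j\<in>{1..l}. a j (coroot H (a i)) = of_int (cartan_matrix X l i j))"

definition dynkin_components :: "classical_type \<Rightarrow> nat \<Rightarrow> nat set \<Rightarrow> nat set set" where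
  "dynkin_components X l I =
     I // {(i, j). i \<in> I \<and> j \<in> I \<and>
            (i, j) \<in> {(i, j). i \<in> I \<and> j \<in> I \<and> i \<noteq> j \<and> cartan_matrix X l i j \<noteq> 0}\<^sup>*}"

definition enumerates_components ::
    "classical_type \<Rightarrow> nat \<Rightarrow> nat set \<Rightarrow> nat \<Rightarrow> (nat \<Rightarrow> nat set) \<Rightarrow> bool" where
  "enumerates_components X l I s K \<longleftrightarrow>
     bij_betw K {1..s} (dynkin_components X l I) \<and>
     (\<forall>i\<in>{1..s}. \<forall>j\<in>{1..s}. i < j \<longrightarrow> Min (K i) < Min (K j))"

text \<open>The integers \<open>l\<^sub>j\<close>, used in types B and D only. In type D, if \<open>\<alpha>\<^sub>l\<^sub>-\<^sub>1\<close> and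
  \<open>\<alpha>\<^sub>l\<close> lie in \<open>I\<close> but \<open>\<alpha>\<^sub>l\<^sub>-\<^sub>2\<close> does not, they form two singleton components, numbered
  \<open>s - 1\<close> and \<open>s\<close>; the components avoiding both are then \<open>1, \<dots>, s - 2\<close>. If \<open>\<alpha>\<^sub>l\<^sub>-\<^sub>2\<close> lies in \<open>I\<close>
  as well, they are \<open>1, \<dots>, s - 1\<close>. The formula for this case sums over these components;
  including \<open>s - 1\<close> when \<open>\<alpha>\<^sub>l\<^sub>-\<^sub>2\<close> is not in \<open>I\<close> would be wrong (for \<open>l = 4\<close>, \<open>I = {3, 4}\<close> it would
  give 8 instead of 6).\<close>

definition comp_offset :: "classical_type \<Rightarrow> nat \<Rightarrow> nat \<Rightarrow> (nat \<Rightarrow> nat set) \<Rightarrow> nat \<Rightarrow> int" where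
  "comp_offset X l s K j =
     int (Min (K j)) - (\<Sum>k\<in>{1..<j}. int (card (K k)))
       - (if X = TypeD \<and> j = s \<and> K s = {l} then 1 else 0)"


section \<open>Catalan and \<open>T'\<close> numbers\<close>

definition catalan :: "nat \<Rightarrow> real" where
  "catalan m = 1 / (real m + 1) * real ((2 * m) choose m)"

text \<open>Meant for \<open>q \<ge> -1\<close> and \<open>p \<ge> -2\<close> with \<open>p + q + 1 \<ge> 0\<close>; elsewhere the value is irrelevant.\<close>

definition T' :: "int \<Rightarrow> int \<Rightarrow> real" where
  "T' p q = (if q = -1 then 0
     else fact (nat (p + q + 1)) * of_int (p - q + 2) / (fact (nat q) * fact (nat (p + 2))))"

end

theory Submission
  imports Defs
begin

text \<open>
  The proof has two halves: the structure of a simple Lie algebra reduces the count to integer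
  vectors, and these are then counted.

  \<^bold>\<open>From the Lie algebra to integer vectors.\<close> A Cartan subalgebra is simultaneously
  diagonalisable, so there is a basis of weight vectors. The trace form \<open>kappa\<close> is invariant, and
  it does not vanish on an element of \<open>H\<close> on which all simple roots take the value 1, because
  there every root has a nonzero integer value. By simplicity it is nondegenerate. This yields opposite
  root vectors, then sl2-triples, and along strings of root vectors the classical facts: root
  strings are reflected into themselves, no proper multiple of a root is a root, root spaces are
  lines, and the coroot is the bracket \<open>[e, f]\<close> of a triple. Hence the coefficient vectors of the
  positive roots contain the unit vectors, and the \<open>i\<close>-th simple reflection, computed from the
  Cartan matrix, permutes those other than the \<open>i\<close>-th unit vector. Only one set of nonnegative
  vectors has these properties (\<open>positive_system_unique\<close>): every vector has a simple coroot on which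
  it is positive, so that it can be reflected down to a unit vector. It therefore suffices to
  exhibit one such set.

  \<^bold>\<open>An explicit model.\<close> Let the weights of the natural representation stand at positions
  \<open>1, \<dots>, M\<close>, in decreasing order; apart from type A the position \<open>M + 1 - x\<close>, the mirror of \<open>x\<close>,
  carries the opposite weight. The positive roots are the differences of the weights at \<open>x < y\<close>, where
  in types B and D mirror pairs are excluded, since \<open>2 \<epsilon>\<^sub>p\<close> is not a root there.
  Simple reflections only interchange neighbouring or nearly neighbouring positions.

  \<^bold>\<open>From ideals to up-closed sets of cells.\<close> The simple roots outside \<open>I\<close> are cuts between
  positions and divide them into blocks. Adding an element of \<open>\<Delta>\<^sup>+ \<union> \<Delta>\<^sub>I\<close> moves the ends of a pair
  outwards or within their blocks, so an ideal is an up-closed set of pairs of blocks, ordered by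
  inclusion. In type A the cells form a staircase. In the other types each root has a pair with
  \<open>x + y \<le> M + 1\<close>, and with \<open>n\<close> cuts the cells are a triangle, \<open>p + r \<le> n + 1\<close>, with some additional
  cells \<open>(p, n + 2 - p)\<close> on the next antidiagonal: all of them in type C, where \<open>2 \<epsilon>\<^sub>p\<close> is a root, and
  in types B and D those for which the block \<open>p\<close> has at least two positions, that is, those coming from
  the components of \<open>I\<close>.

  \<^bold>\<open>Counting.\<close> The up-closed subsets of the triangle that contain exactly the first \<open>v\<close> cells of the
  last antidiagonal satisfy Pascal's recursion and are counted by the ballot numbers
  \<open>C(n, v) - C(n, v - 1)\<close>. An additional cell \<open>p\<close> is free for \<open>v = p - 1\<close> and determined otherwise.
  Hence the number of up-closed sets is the central binomial coefficient plus the sum of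
  the ballot numbers for \<open>v = p - 1\<close> (\<open>card_up_sets_ballot\<close>). The ballot numbers are the numbers
  \<open>T'\<close>, and \<open>p - 1\<close> is \<open>l\<^sub>j - 1\<close> for the component of \<open>I\<close> in the block \<open>p\<close>.

  One obstacle remains: moving \<open>y\<close> to its mirror would add \<open>2 \<epsilon>\<close>, which in types B and D is not a
  root. In type B, and in type D when \<open>\<alpha>\<^sub>l\<^sub>-\<^sub>1 \<in> I\<close>, the move can be made in two steps through a third
  position. If only \<open>\<alpha>\<^sub>l\<close> is in \<open>I\<close>, the diagram automorphism exchanges it with \<open>\<alpha>\<^sub>l\<^sub>-\<^sub>1\<close>. If neither
  is in \<open>I\<close>, the moves from \<open>\<epsilon>\<^sub>p - \<epsilon>\<^sub>l\<close> to \<open>\<epsilon>\<^sub>p + \<epsilon>\<^sub>l\<close> and back may fail, but never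
  both of them for the same ideal; the automorphism exchanges the two kinds of ideals, and
  inclusion-exclusion reduces the count to two counts of the kind above.
\<close>

section \<open>Simultaneous diagonalisation of a Cartan subalgebra\<close>

context lie_algebra
begin

lemma brk_zero_left [simp]: "brk 0 y = 0"
  using brk_add_left[of 0 0 y] by simp

lemma brk_zero_right [simp]: "brk x 0 = 0"
  using brk_add_right[of x 0 0] by simp

lemma brk_minus_left: "brk (- x) y = - brk x y"
  using brk_add_left[of x "- x" y] by (simp add: eq_neg_iff_add_eq_0 add.commute)

lemma brk_minus_right: "brk x (- y) = - brk x y"
  using brk_add_right[of x y "- y"] by (simp add: eq_neg_iff_add_eq_0 add.commute)

lemma brk_diff_right: "brk x (y - z) = brk x y - brk x z"
  using brk_add_right[of x y "- z"] by (simp add: brk_minus_right)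

lemma brk_antisym: "brk x y = - brk y x"
proof -
  have "0 = brk (x + y) (x + y)" by (rule brk_self[symmetric])
  also have "\<dots> = brk x y + brk y x"
    unfolding brk_add_left brk_add_right by (simp add: brk_self)
  finally show ?thesis by (simp add: eq_neg_iff_add_eq_0)
qed

lemma brk_sum_right: "brk x (sum f A) = (\<Sum>a\<in>A. brk x (f a))"
  by (induction A rule: infinite_finite_induct) (auto simp: brk_add_right)

lemma brk_derivation: "brk x (brk y z) = brk (brk x y) z + brk y (brk x z)"
proof -
  have "brk y (brk z x) = - brk y (brk x z)"
    by (metis brk_antisym brk_minus_right)
  moreover have "brk z (brk x y) = - brk (brk x y) z"
    by (rule brk_antisym)
  ultimately show ?thesis
    using jacobi[of x y z] by (simp add: algebra_simps)
qed

text \<open>If a sum of eigenvectors for distinct eigenvalues lies in an invariant subspace, so does every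
  summand: applying \<open>ad h - \<mu>\<close> removes the summand of one eigenvalue \<open>\<mu>\<close> and multiplies each of the
  others by a nonzero number.\<close>

lemma eigencomponents_in_invariant_subspace:
  fixes v :: "complex \<Rightarrow> 'g"
  assumes "finite F" and V: "subspace V" "\<And>x. x \<in> V \<Longrightarrow> brk h x \<in> V"
    and "\<And>\<mu>. \<mu> \<in> F \<Longrightarrow> brk h (v \<mu>) = scale \<mu> (v \<mu>)"
    and "(\<Sum>\<mu>\<in>F. v \<mu>) \<in> V" and "\<nu> \<in> F"
  shows "v \<nu> \<in> V"
  using assms(1,4-6)
proof (induction F arbitrary: v \<nu> rule: finite_induct)
  case empty
  then show ?case by simp
next
  case (insert \<mu>0 F)
  let ?w = "\<Sum>\<mu>\<in>insert \<mu>0 F. v \<mu>"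
  have w: "?w = v \<mu>0 + (\<Sum>\<mu>\<in>F. v \<mu>)"
    using insert.hyps by simp
  have "brk h ?w - scale \<mu>0 ?w = (\<Sum>\<mu>\<in>F. scale (\<mu> - \<mu>0) (v \<mu>))"
    using insert.hyps insert.prems(1)
    by (simp add: w brk_add_right brk_sum_right scale_right_distrib scale_sum_right
        scale_left_diff_distrib sum_subtractf)
  moreover have "brk h ?w - scale \<mu>0 ?w \<in> V"
    using V insert.prems(2) by (intro subspace_diff subspace_scale) auto
  ultimately have "(\<Sum>\<mu>\<in>F. scale (\<mu> - \<mu>0) (v \<mu>)) \<in> V"
    by simp
  then have IH: "scale (\<mu> - \<mu>0) (v \<mu>) \<in> V" if "\<mu> \<in> F" for \<mu>
    using insert.IH[of "\<lambda>\<mu>. scale (\<mu> - \<mu>0) (v \<mu>)" \<mu>] insert.prems(1) that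
    by (simp add: brk_scale_right mult.commute)
  have F: "v \<mu> \<in> V" if "\<mu> \<in> F" for \<mu>
  proof -
    have "\<mu> \<noteq> \<mu>0" using that insert.hyps by auto
    then have "v \<mu> = scale (inverse (\<mu> - \<mu>0)) (scale (\<mu> - \<mu>0) (v \<mu>))"
      by simp
    then show ?thesis using IH[OF that] V(1) subspace_scale by metis
  qed
  have "v \<mu>0 = ?w - (\<Sum>\<mu>\<in>F. v \<mu>)" using w by simp
  also have "\<dots> \<in> V"
    by (rule subspace_diff[OF V(1) insert.prems(2) subspace_sum[OF V(1) F]])
  finally show ?case using F insert.prems(3) by auto
qed

text \<open>Commuting diagonalisable operators are simultaneously diagonalisable: the joint eigenspaces of the
  operators treated so far are invariant under the next one, hence contain the components of their
  elements with respect to its eigenvalues.\<close>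

lemma joint_eigenvectors_span:
  assumes H: "cartan_subalgebra H" and "finite S" "S \<subseteq> H"
  shows "span {v. \<forall>h\<in>S. \<exists>c. brk h v = scale c v} = UNIV"
  using assms(2,3)
proof (induction S rule: finite_induct)
  case empty
  then show ?case by simp
next
  case (insert h S)
  let ?E = "{v. \<forall>h\<in>S. \<exists>c. brk h v = scale c v}"
  let ?E' = "{v. \<forall>k\<in>insert h S. \<exists>c. brk k v = scale c v}"
  have hH: "h \<in> H" and SH: "S \<subseteq> H" using insert.prems by auto
  have "v \<in> span ?E'" if v: "v \<in> ?E" for v
  proof -
    obtain c where c: "\<And>k. k \<in> S \<Longrightarrow> brk k v = scale (c k) v"
      using v by (auto; metis)
    define V where "V = {w. \<forall>k\<in>S. brk k w = scale (c k) w}"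
    have subV: "subspace V"
      by (auto simp: V_def subspace_def brk_add_right scale_right_distrib brk_scale_right
          mult.commute)
    have invV: "brk h w \<in> V" if "w \<in> V" for w
    proof -
      have "brk k (brk h w) = scale (c k) (brk h w)" if "k \<in> S" for k
      proof -
        have "brk k h = 0" using H SH hH that by (auto simp: cartan_subalgebra_def)
        then have "brk k (brk h w) = brk h (brk k w)"
          using brk_derivation[of k h w] by simp
        also have "brk k w = scale (c k) w" using \<open>w \<in> V\<close> that by (auto simp: V_def)
        finally show ?thesis by (simp add: brk_scale_right)
      qed
      then show ?thesis by (auto simp: V_def)
    qed
    have "ad_diagonalizable h" using H hH by (auto simp: cartan_subalgebra_def)
    then have "v \<in> span {y. \<exists>c. brk h y = scale c y}"
      by (auto simp: ad_diagonalizable_def)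
    then obtain t r where t: "finite t" "t \<subseteq> {y. \<exists>c. brk h y = scale c y}"
      and v_eq: "v = (\<Sum>b\<in>t. scale (r b) b)"
      unfolding span_explicit by auto
    obtain m where m: "\<And>b. b \<in> t \<Longrightarrow> brk h b = scale (m b) b"
      using t(2) by (auto simp: subset_iff; metis)
    define vv where "vv \<mu> = (\<Sum>b\<in>{b\<in>t. m b = \<mu>}. scale (r b) b)" for \<mu>
    have eig: "brk h (vv \<mu>) = scale \<mu> (vv \<mu>)" for \<mu>
      by (auto simp: vv_def brk_sum_right brk_scale_right scale_sum_right m mult.commute
          intro!: sum.cong)
    have v_sum: "(\<Sum>\<mu>\<in>m ` t. vv \<mu>) = v"
      unfolding vv_def v_eq by (rule sum.image_gen[OF t(1), symmetric])
    have "vv \<mu> \<in> V" if "\<mu> \<in> m ` t" for \<mu>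
      using eigencomponents_in_invariant_subspace[of "m ` t" V h vv \<mu>]
        t(1) subV invV eig that v_sum c by (auto simp: V_def)
    then have "vv \<mu> \<in> ?E'" if "\<mu> \<in> m ` t" for \<mu>
      using that eig by (auto simp: V_def)
    then have "(\<Sum>\<mu>\<in>m ` t. vv \<mu>) \<in> span ?E'"
      by (intro span_sum span_base) auto
    then show ?thesis using v_sum by simp
  qed
  then have "span ?E \<subseteq> span ?E'"
    by (intro span_minimal subspace_span) auto
  then show ?case using insert.IH SH by auto
qed

text \<open>A joint eigenvector for a basis of \<open>H\<close> is one for all of \<open>H\<close>, and its eigenvalues depend linearly
  on \<open>h\<close>; set to zero outside \<open>H\<close>, they form an element of the dual space.\<close>

lemma weight_vectors_span:
  assumes H: "cartan_subalgebra H"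
  shows "span (\<Union>\<alpha>\<in>dual_space H. root_space H \<alpha>) = UNIV"
proof -
  have subH: "subspace H" using H by (auto simp: cartan_subalgebra_def)
  obtain S where S: "S \<subseteq> H" "independent S" "H \<subseteq> span S"
    using maximal_independent_subset[of H] by blast
  obtain B0 where "finite B0" "span B0 = UNIV" using finite_dim by blast
  then have "finite S" using independent_span_bound[of B0 S] S(2) by auto
  have "v \<in> span (\<Union>\<alpha>\<in>dual_space H. root_space H \<alpha>)"
    if v: "\<forall>h\<in>S. \<exists>c. brk h v = scale c v" for v
  proof (cases "v = 0")
    case True
    then show ?thesis by (simp add: span_zero)
  next
    case False
    let ?K = "{h. \<exists>c. brk h v = scale c v}"
    have "subspace ?K"
      unfolding subspace_def
    proof (intro conjI ballI allI)
      show "0 \<in> ?K" by (auto intro: exI[of _ 0])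
    next
      fix x y assume "x \<in> ?K" "y \<in> ?K"
      then obtain c d where "brk x v = scale c v" "brk y v = scale d v" by auto
      then have "brk (x + y) v = scale (c + d) v"
        by (simp add: brk_add_left scale_left_distrib)
      then show "x + y \<in> ?K" by auto
    next
      fix k x assume "x \<in> ?K"
      then obtain c where "brk x v = scale c v" by auto
      then have "brk (scale k x) v = scale (k * c) v"
        by (simp add: brk_scale_left)
      then show "scale k x \<in> ?K" by auto
    qed
    then have "span S \<subseteq> ?K"
      using v by (intro span_minimal) auto
    then have ex: "\<exists>c. brk h v = scale c v" if "h \<in> H" for h
      using S(3) that by auto
    define \<alpha> where "\<alpha> h = (if h \<in> H then SOME c. brk h v = scale c v else 0)" for h
    have \<alpha>: "brk h v = scale (\<alpha> h) v" if "h \<in> H" for h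
      using someI_ex[OF ex[OF that]] that by (simp add: \<alpha>_def)
    have "\<alpha> (x + y) = \<alpha> x + \<alpha> y" if "x \<in> H" "y \<in> H" for x y
    proof -
      have "scale (\<alpha> (x + y)) v = scale (\<alpha> x + \<alpha> y) v"
        using \<alpha>[of "x + y"] \<alpha>[of x] \<alpha>[of y] that subH
        by (simp add: subspace_add brk_add_left scale_left_distrib)
      then show ?thesis using False by simp
    qed
    moreover have "\<alpha> (scale c x) = c * \<alpha> x" if "x \<in> H" for c x
    proof -
      have "scale (\<alpha> (scale c x)) v = scale (c * \<alpha> x) v"
        using \<alpha>[of "scale c x"] \<alpha>[of x] that subH
        by (auto simp: subspace_scale brk_scale_left)
      then show ?thesis using False by auto
    qed
    ultimately have "\<alpha> \<in> dual_space H"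
      by (auto simp: dual_space_def \<alpha>_def)
    moreover have "v \<in> root_space H \<alpha>" using \<alpha> by (auto simp: root_space_def)
    ultimately show ?thesis by (intro span_base) auto
  qed
  then have "span {v. \<forall>h\<in>S. \<exists>c. brk h v = scale c v} \<subseteq> span (\<Union>\<alpha>\<in>dual_space H. root_space H \<alpha>)"
    by (intro span_minimal subspace_span) auto
  then show ?thesis
    using joint_eigenvectors_span[OF H \<open>finite S\<close> S(1)] by auto
qed

end

locale weight_basis = lie_algebra scale brk
  for scale :: "complex \<Rightarrow> 'g::ab_group_add \<Rightarrow> 'g" and brk +
  fixes H :: "'g set" and B :: "'g set" and wt :: "'g \<Rightarrow> 'g \<Rightarrow> complex"
  assumes cartan: "cartan_subalgebra H"
    and finite_B: "finite B" and indep_B: "independent B" and span_B: "span B = UNIV"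
    and wt_dual: "b \<in> B \<Longrightarrow> wt b \<in> dual_space H"
    and wt_root_space: "b \<in> B \<Longrightarrow> b \<in> root_space H (wt b)"

lemma (in lie_algebra) ex_weight_basis:
  assumes H: "cartan_subalgebra H"
  shows "\<exists>B wt. weight_basis scale brk H B wt"
proof -
  let ?W = "\<Union>\<alpha>\<in>dual_space H. root_space H \<alpha>"
  obtain B where B: "B \<subseteq> ?W" "independent B" "?W \<subseteq> span B"
    using maximal_independent_subset[of ?W] by blast
  have "span B = UNIV"
    using weight_vectors_span[OF H] B(3) by (metis span_minimal subspace_span top.extremum_unique)
  moreover obtain B0 where "finite B0" "span B0 = UNIV" using finite_dim by blast
  then have "finite B" using independent_span_bound[of B0 B] B(2) by auto
  moreover have "\<forall>b\<in>B. \<exists>\<alpha>. \<alpha> \<in> dual_space H \<and> b \<in> root_space H \<alpha>" using B(1) by auto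
  then obtain wt where "\<forall>b\<in>B. wt b \<in> dual_space H \<and> b \<in> root_space H (wt b)"
    by metis
  ultimately have "weight_basis scale brk H B wt"
    using H B(2) by unfold_locales auto
  then show ?thesis by blast
qed

context weight_basis
begin

abbreviation rep :: "'g \<Rightarrow> 'g \<Rightarrow> complex" where "rep \<equiv> representation B"

lemma subspace_H: "subspace H"
  using cartan by (auto simp: cartan_subalgebra_def)

lemma rep_expand: "(\<Sum>b\<in>B. scale (rep x b) b) = x"
  by (rule sum_representation_eq) (auto simp: finite_B indep_B span_B)

lemma rep_add: "rep (x + y) b = rep x b + rep y b"
  by (subst representation_add) (auto simp: indep_B span_B)

lemma rep_scale: "rep (scale c x) b = c * rep x b"
  by (subst representation_scale) (auto simp: indep_B span_B)

lemma rep_sum: "rep (sum f A) b = (\<Sum>a\<in>A. rep (f a) b)"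
  by (induction A rule: infinite_finite_induct) (auto simp: rep_add representation_zero)

lemma rep_basis: "c \<in> B \<Longrightarrow> rep c b = (if b = c then 1 else 0)"
  by (simp add: representation_basis indep_B)

lemma rep_linear_image:
  assumes "\<And>x y. f (x + y) = f x + f y" "\<And>c x. f (scale c x) = scale c (f x)"
  shows "rep (f x) b = (\<Sum>c\<in>B. rep x c * rep (f c) b)"
proof -
  have f0: "f 0 = 0" using assms(1)[of 0 0] by simp
  have fsum: "f (sum g A) = (\<Sum>a\<in>A. f (g a))" for g and A :: "'g set"
    by (induction A rule: infinite_finite_induct) (auto simp: assms(1) f0)
  have "f x = (\<Sum>c\<in>B. scale (rep x c) (f c))"
    by (subst rep_expand[of x, symmetric]) (simp add: fsum assms(2))
  then show ?thesis by (simp add: rep_sum rep_scale)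
qed

lemma rep_brk_cartan:
  assumes "h \<in> H" "b \<in> B"
  shows "rep (brk h x) b = wt b h * rep x b"
proof -
  have "rep (brk h x) b = (\<Sum>c\<in>B. rep x c * rep (brk h c) b)"
    by (rule rep_linear_image) (auto simp: brk_add_right brk_scale_right)
  also have "\<dots> = (\<Sum>c\<in>B. if c = b then wt b h * rep x b else 0)"
  proof (rule sum.cong)
    fix c assume "c \<in> B"
    then have "brk h c = scale (wt c h) c" using wt_root_space assms(1) by (auto simp: root_space_def)
    then show "rep x c * rep (brk h c) b = (if c = b then wt b h * rep x b else 0)"
      using \<open>c \<in> B\<close> by (auto simp: rep_scale rep_basis)
  qed simp
  also have "\<dots> = wt b h * rep x b" using assms(2) finite_B by simp
  finally show ?thesis .
qed

lemma dual_space_eqI: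
  "\<alpha> \<in> dual_space H \<Longrightarrow> \<beta> \<in> dual_space H \<Longrightarrow> (\<And>h. h \<in> H \<Longrightarrow> \<alpha> h = \<beta> h) \<Longrightarrow> \<alpha> = \<beta>"
  by (rule ext) (auto simp: dual_space_def, metis)

lemma rep_root_space:
  assumes "\<gamma> \<in> dual_space H" "x \<in> root_space H \<gamma>" "b \<in> B" "rep x b \<noteq> 0"
  shows "wt b = \<gamma>"
proof (rule dual_space_eqI)
  fix h assume h: "h \<in> H"
  have "wt b h * rep x b = rep (brk h x) b" using rep_brk_cartan[OF h assms(3)] by simp
  also have "\<dots> = \<gamma> h * rep x b" using assms(2) h by (simp add: root_space_def rep_scale)
  finally show "wt b h = \<gamma> h" using assms(4) by simp
qed (use assms wt_dual in auto)

lemma ex_basis_of_weight: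
  assumes "\<gamma> \<in> dual_space H" "x \<in> root_space H \<gamma>" "x \<noteq> 0"
  shows "\<exists>b\<in>B. wt b = \<gamma>"
proof -
  have "\<exists>b\<in>B. rep x b \<noteq> 0"
  proof (rule ccontr)
    assume "\<not> ?thesis"
    then have "x = 0" using rep_expand[of x] by simp
    then show False using assms by simp
  qed
  then show ?thesis using rep_root_space assms by blast
qed

lemma root_space_zero: "root_space H (\<lambda>_. 0) = H"
  using cartan by (auto simp: root_space_def cartan_subalgebra_def)

lemma finite_roots: "finite (roots H)"
proof (rule finite_subset)
  have "0 \<in> root_space H \<alpha>" for \<alpha> by (simp add: root_space_def)
  then show "roots H \<subseteq> wt ` B"
    using ex_basis_of_weight by (fastforce simp: roots_def)
qed (simp add: finite_B)

lemma subspace_root_space: "subspace (root_space H \<alpha>)"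
  by (auto simp: subspace_def root_space_def brk_add_right scale_right_distrib brk_scale_right
      mult.commute)

lemma brk_root_space:
  assumes "x \<in> root_space H \<alpha>" "y \<in> root_space H \<beta>"
  shows "brk x y \<in> root_space H (\<lambda>h. \<alpha> h + \<beta> h)"
  using assms
  by (auto simp: root_space_def brk_derivation[of _ x y] brk_scale_left brk_scale_right
      scale_left_distrib)

lemma dual_space_add: "\<alpha> \<in> dual_space H \<Longrightarrow> \<beta> \<in> dual_space H \<Longrightarrow> (\<lambda>h. \<alpha> h + \<beta> h) \<in> dual_space H"
  by (auto simp: dual_space_def algebra_simps)

lemma dual_space_mult: "\<alpha> \<in> dual_space H \<Longrightarrow> (\<lambda>h. c * \<alpha> h) \<in> dual_space H"
  by (auto simp: dual_space_def algebra_simps)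

lemma dual_space_minus: "\<alpha> \<in> dual_space H \<Longrightarrow> (\<lambda>h. - \<alpha> h) \<in> dual_space H"
  by (auto simp: dual_space_def algebra_simps)

lemma dual_space_zero: "(\<lambda>_. 0) \<in> dual_space H"
  by (auto simp: dual_space_def)

lemma roots_dual: "\<alpha> \<in> roots H \<Longrightarrow> \<alpha> \<in> dual_space H"
  by (simp add: roots_def)

lemma rootI: "\<alpha> \<in> dual_space H \<Longrightarrow> \<alpha> \<noteq> (\<lambda>_. 0) \<Longrightarrow> x \<in> root_space H \<alpha> \<Longrightarrow> x \<noteq> 0 \<Longrightarrow> \<alpha> \<in> roots H"
  by (auto simp: roots_def)

lemma root_obtain:
  assumes "\<alpha> \<in> roots H" obtains x where "x \<in> root_space H \<alpha>" "x \<noteq> 0"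
  using assms subspace_0[OF subspace_root_space[of \<alpha>]] by (auto simp: roots_def)

section \<open>The trace form\<close>

text \<open>The trace of a linear endomorphism, computed in the basis of weight vectors, in which the elements
  of \<open>H\<close> act diagonally.\<close>

definition trace :: "('g \<Rightarrow> 'g) \<Rightarrow> complex" where
  "trace f = (\<Sum>b\<in>B. rep (f b) b)"

text \<open>The Killing form.\<close>

definition kappa :: "'g \<Rightarrow> 'g \<Rightarrow> complex" where
  "kappa x y = trace (\<lambda>z. brk x (brk y z))"

lemma trace_add: "trace (\<lambda>z. f z + g z) = trace f + trace g"
  by (simp add: trace_def rep_add sum.distrib)

lemma trace_diff: "trace (\<lambda>z. f z - g z) = trace f - trace g"
  using trace_add[of "\<lambda>z. f z - g z" g] by simp

lemma trace_scale: "trace (\<lambda>z. scale c (f z)) = c * trace f"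
  by (simp add: trace_def rep_scale sum_distrib_left)

lemma trace_commute:
  assumes "\<And>x y. f (x + y) = f x + f y" "\<And>c x. f (scale c x) = scale c (f x)"
    and "\<And>x y. g (x + y) = g x + g y" "\<And>c x. g (scale c x) = scale c (g x)"
  shows "trace (\<lambda>z. f (g z)) = trace (\<lambda>z. g (f z))"
proof -
  have "trace (\<lambda>z. f (g z)) = (\<Sum>b\<in>B. \<Sum>c\<in>B. rep (g b) c * rep (f c) b)"
    unfolding trace_def by (intro sum.cong rep_linear_image assms refl)
  also have "\<dots> = (\<Sum>c\<in>B. \<Sum>b\<in>B. rep (f c) b * rep (g b) c)"
    by (subst sum.swap) (simp add: mult.commute)
  also have "\<dots> = trace (\<lambda>z. g (f z))"
    unfolding trace_def by (intro sum.cong rep_linear_image[symmetric] assms refl)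
  finally show ?thesis .
qed

lemma kappa_add_left: "kappa (x + y) z = kappa x z + kappa y z"
  by (simp add: kappa_def brk_add_left trace_add)

lemma kappa_scale_left: "kappa (scale c x) z = c * kappa x z"
  by (simp add: kappa_def brk_scale_left trace_scale)

lemma kappa_sym: "kappa x y = kappa y x"
  unfolding kappa_def by (rule trace_commute) (simp_all add: brk_add_right brk_scale_right)

lemma kappa_invariant: "kappa (brk x y) z = kappa x (brk y z)"
proof -
  have *: "brk (brk u v) w = brk u (brk v w) - brk v (brk u w)" for u v w
    using brk_derivation[of u v w] by simp
  have "kappa (brk x y) z = trace (\<lambda>w. brk x (brk y (brk z w))) - trace (\<lambda>w. brk y (brk x (brk z w)))"
    by (simp add: kappa_def * trace_diff)
  also have "trace (\<lambda>w. brk y (brk x (brk z w))) = trace (\<lambda>w. brk x (brk z (brk y w)))"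
    by (rule trace_commute) (simp_all add: brk_add_right brk_scale_right)
  finally show ?thesis
    by (simp add: kappa_def * brk_diff_right trace_diff)
qed

lemma kappa_minus_left: "kappa (- x) z = - kappa x z"
  using kappa_scale_left[of "-1" x z] by simp

lemma kappa_sum_right: "kappa x (sum f A) = (\<Sum>a\<in>A. kappa x (f a))"
proof -
  have "kappa 0 x = 0" using kappa_add_left[of 0 0 x] by simp
  then have "kappa x 0 = 0" using kappa_sym by metis
  moreover have "kappa x (y + z) = kappa x y + kappa x z" for y z
    using kappa_add_left kappa_sym by metis
  ultimately show ?thesis
    by (induction A rule: infinite_finite_induct) auto
qed

lemma kappa_cartan:
  assumes "h \<in> H" shows "kappa h h = (\<Sum>b\<in>B. (wt b h)\<^sup>2)"
  using assms by (simp add: kappa_def trace_def rep_brk_cartan rep_basis power2_eq_square)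

text \<open>Invariance moves \<open>ad h\<close> from one argument to the other with a change of sign, so weight vectors whose
  weights do not add up to zero are orthogonal.\<close>

lemma kappa_orthogonal:
  assumes "x \<in> root_space H \<alpha>" "y \<in> root_space H \<beta>" "h \<in> H" "\<alpha> h + \<beta> h \<noteq> 0"
  shows "kappa x y = 0"
proof -
  have "\<alpha> h * kappa x y = kappa (brk h x) y"
    using assms by (simp add: root_space_def kappa_scale_left)
  also have "\<dots> = - kappa (brk x h) y"
    using brk_antisym[of h x] kappa_minus_left by simp
  also have "\<dots> = - kappa (brk h y) x"
    using kappa_invariant[of x h y] kappa_sym[of x "brk h y"] by simp
  also have "\<dots> = - \<beta> h * kappa x y"
    using assms kappa_sym[of y x] by (simp add: root_space_def kappa_scale_left)
  finally have "(\<alpha> h + \<beta> h) * kappa x y = 0" by (simp add: algebra_simps)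
  then show ?thesis using assms by simp
qed

end

section \<open>Nondegeneracy of the trace form\<close>

text \<open>Linearly independent forms on a subspace take arbitrary prescribed values. By induction, vectors
  dual to the first \<open>n\<close> forms exist; if the last form vanished wherever those do, it would be a
  linear combination of them.\<close>

lemma (in lie_algebra) ex_dual_vector:
  fixes f :: "nat \<Rightarrow> 'g \<Rightarrow> complex"
  assumes V: "subspace V"
    and add: "\<And>i x y. i \<in> {1..l} \<Longrightarrow> x \<in> V \<Longrightarrow> y \<in> V \<Longrightarrow> f i (x + y) = f i x + f i y"
    and mult: "\<And>i c x. i \<in> {1..l} \<Longrightarrow> x \<in> V \<Longrightarrow> f i (scale c x) = c * f i x"
    and indep: "\<And>c. (\<forall>x\<in>V. (\<Sum>i\<in>{1..l}. c i * f i x) = 0) \<Longrightarrow> \<forall>i\<in>{1..l}. c i = (0::complex)"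
  shows "\<exists>x\<in>V. \<forall>i\<in>{1..l}. f i x = t i"
  using add mult indep
proof (induction l arbitrary: t)
  case 0
  show ?case using subspace_0[OF V] by auto
next
  case (Suc n)
  have fsum: "f i (\<Sum>j\<in>A. scale (k j) (e j)) = (\<Sum>j\<in>A. k j * f i (e j))"
    if "i \<in> {1..Suc n}" "finite A" "\<And>j. j \<in> A \<Longrightarrow> e j \<in> V" for i and A :: "nat set" and k e
    using that(2,3)
  proof (induction A rule: finite_induct)
    case empty
    show ?case using Suc.prems(2)[of i 0 0] that(1) subspace_0[OF V] by simp
  next
    case (insert j A)
    then show ?case
      using that(1) Suc.prems(1)[of i "scale (k j) (e j)" "\<Sum>j\<in>A. scale (k j) (e j)"] Suc.prems(2)
      by (simp add: V subspace_scale subspace_sum)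
  qed
  have IH: "\<exists>x\<in>V. \<forall>i\<in>{1..n}. f i x = t i" for t
  proof (rule Suc.IH)
    fix c assume c: "\<forall>x\<in>V. (\<Sum>i\<in>{1..n}. c i * f i x) = 0"
    have "\<forall>i\<in>{1..Suc n}. (if i = Suc n then 0 else c i) = 0"
    proof (rule Suc.prems(3), rule ballI)
      fix x assume "x \<in> V"
      have "(\<Sum>i\<in>{1..Suc n}. (if i = Suc n then 0 else c i) * f i x) = (\<Sum>i\<in>{1..n}. c i * f i x)"
        by simp
      then show "(\<Sum>i\<in>{1..Suc n}. (if i = Suc n then 0 else c i) * f i x) = 0"
        using c \<open>x \<in> V\<close> by simp
    qed
    then show "\<forall>i\<in>{1..n}. c i = 0" by (metis Suc_n_not_le_n atLeastAtMost_iff le_Suc_eq)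
  qed (use Suc.prems in auto)
  have "\<forall>j. \<exists>x\<in>V. \<forall>i\<in>{1..n}. f i x = (if i = j then 1 else 0)"
    using IH by auto
  then obtain e where eV: "\<And>j. e j \<in> V"
    and e: "\<And>i j. i \<in> {1..n} \<Longrightarrow> f i (e j) = (if i = j then 1 else 0)"
    by metis
  \<comment> \<open>subtracting the \<open>e\<close>-components kills the first \<open>n\<close> functionals\<close>
  define pr where "pr x = x + (\<Sum>j\<in>{1..n}. scale (- f j x) (e j))" for x
  have prV: "pr x \<in> V" if "x \<in> V" for x
    using that eV V by (simp add: pr_def subspace_add subspace_sum subspace_scale subspace_diff subspace_neg)
  have f_pr: "f i (pr x) = f i x - (\<Sum>j\<in>{1..n}. f j x * f i (e j))" if "x \<in> V" "i \<in> {1..Suc n}" for x i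
  proof -
    have "f i (pr x) = f i x + f i (\<Sum>j\<in>{1..n}. scale (- f j x) (e j))"
      unfolding pr_def using that eV V
      by (intro Suc.prems(1)) (auto intro!: subspace_sum subspace_scale subspace_neg)
    also have "f i (\<Sum>j\<in>{1..n}. scale (- f j x) (e j)) = (\<Sum>j\<in>{1..n}. (- f j x) * f i (e j))"
      by (rule fsum) (use that eV in auto)
    finally show ?thesis by (simp add: sum_negf)
  qed
  have f_pr0: "f i (pr x) = 0" if "x \<in> V" "i \<in> {1..n}" for x i
  proof -
    have "(\<Sum>j\<in>{1..n}. f j x * f i (e j)) = (\<Sum>j\<in>{1..n}. if j = i then f j x else 0)"
      using that e by (intro sum.cong) auto
    then show ?thesis using f_pr[of x i] that by simp
  qed
  have "\<exists>x\<in>V. f (Suc n) (pr x) \<noteq> 0"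
  proof (rule ccontr)
    assume "\<not> ?thesis"
    then have *: "f (Suc n) x = (\<Sum>j\<in>{1..n}. f j x * f (Suc n) (e j))" if "x \<in> V" for x
      using f_pr[of x "Suc n"] that by simp
    have "\<forall>i\<in>{1..Suc n}. (if i = Suc n then - 1 else f (Suc n) (e i)) = 0"
      by (rule Suc.prems(3)) (auto simp: * mult.commute)
    from bspec[OF this, of "Suc n"] show False by simp
  qed
  then obtain x1 where "x1 \<in> V" "f (Suc n) (pr x1) \<noteq> 0" by blast
  then obtain w where w: "w \<in> V" "f (Suc n) w \<noteq> 0" "\<And>i. i \<in> {1..n} \<Longrightarrow> f i w = 0"
    using prV f_pr0 by blast
  obtain x0 where x0: "x0 \<in> V" "\<forall>i\<in>{1..n}. f i x0 = t i" using IH by blast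
  \<comment> \<open>\<open>w\<close> corrects the last value without changing the others\<close>
  let ?k = "(t (Suc n) - f (Suc n) x0) / f (Suc n) w"
  have f_eq: "f i (x0 + scale ?k w) = f i x0 + ?k * f i w" if "i \<in> {1..Suc n}" for i
    using Suc.prems(1)[OF that, of x0 "scale ?k w"] Suc.prems(2)[OF that, of w ?k] x0(1) w(1) V
    by (simp add: subspace_scale)
  have "f i (x0 + scale ?k w) = t i" if "i \<in> {1..Suc n}" for i
    using f_eq[OF that] x0(2) w that by (cases "i = Suc n") auto
  moreover have "x0 + scale ?k w \<in> V" using x0(1) w(1) V by (simp add: subspace_add subspace_scale)
  ultimately show ?case by blast
qed

locale simple_weight_basis = weight_basis + simple_lie_algebra +
  fixes l :: nat and a :: "nat \<Rightarrow> 'a \<Rightarrow> complex"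
  assumes simple_roots: "simple_roots H l a"
begin

lemma central_zero: assumes "\<And>y. brk t y = 0" shows "t = 0"
proof -
  let ?Z = "{x. \<forall>y. brk x y = 0}"
  have "lie_ideal ?Z"
    unfolding lie_ideal_def
  proof
    show "subspace ?Z"
      by (auto simp: subspace_def brk_add_left brk_scale_left)
    show "\<forall>x. \<forall>y\<in>?Z. brk x y \<in> ?Z"
    proof (intro allI ballI)
      fix x y assume "y \<in> ?Z"
      then have "brk x y = 0" using brk_antisym[of x y] by simp
      then show "brk x y \<in> ?Z" by simp
    qed
  qed
  moreover have "?Z \<noteq> UNIV" using nonabelian by auto
  ultimately have "?Z = {0}" using only_trivial_ideals by blast
  then show ?thesis using assms by auto
qed

lemma simple_root: "i \<in> {1..l} \<Longrightarrow> a i \<in> roots H"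
  using simple_roots by (auto simp: simple_roots_def)

lemma simple_indep: "(\<And>x. (\<Sum>i\<in>{1..l}. c i * a i x) = 0) \<Longrightarrow> i \<in> {1..l} \<Longrightarrow> c i = (0::complex)"
  using simple_roots unfolding simple_roots_def by blast

lemma int_comb_inject:
  assumes "int_comb a {1..l} c = int_comb a {1..l} c'" "i \<in> {1..l}"
  shows "c i = c' i"
proof -
  have "of_int (c i) - of_int (c' i) = (0 :: complex)"
  proof (rule simple_indep[OF _ assms(2)])
    fix x
    have "(\<Sum>i\<in>{1..l}. (of_int (c i) - of_int (c' i)) * a i x)
      = int_comb a {1..l} c x - int_comb a {1..l} c' x"
      by (simp add: int_comb_def left_diff_distrib sum_subtractf)
    then show "(\<Sum>i\<in>{1..l}. (of_int (c i) - of_int (c' i)) * a i x) = 0"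
      using assms(1) by simp
  qed
  then show ?thesis by simp
qed

lemma root_coefficients:
  assumes "\<beta> \<in> roots H"
  obtains c where "\<beta> = int_comb a {1..l} c" "(\<forall>i\<in>{1..l}. c i \<ge> 0) \<or> (\<forall>i\<in>{1..l}. c i \<le> 0)"
  using assms simple_roots unfolding simple_roots_def by blast

lemma wt_cases: "b \<in> B \<Longrightarrow> wt b = (\<lambda>_. 0) \<or> wt b \<in> roots H"
  using rootI[OF wt_dual _ wt_root_space] dependent_zero indep_B by blast

text \<open>On an element \<open>h\<close> of \<open>H\<close> where every simple root is 1, the value of a root is the sum of its
  coefficients: a nonzero integer, as they are of one sign. So \<open>kappa h h\<close> is a sum of
  squares of integers, which vanishes only if there are no roots at all.\<close>

lemma kappa_nonzero: "\<exists>x y. kappa x y \<noteq> 0"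
proof -
  have "\<exists>x\<in>H. \<forall>i\<in>{1..l}. a i x = 1"
  proof (rule ex_dual_vector[OF subspace_H])
    fix c assume *: "\<forall>x\<in>H. (\<Sum>i\<in>{1..l}. c i * a i x) = 0"
    have "(\<Sum>i\<in>{1..l}. c i * a i x) = 0" for x
    proof (cases "x \<in> H")
      case False
      then have "a i x = 0" if "i \<in> {1..l}" for i
        using simple_root[OF that] by (auto simp: roots_def dual_space_def)
      then show ?thesis by simp
    qed (use * in auto)
    then show "\<forall>i\<in>{1..l}. c i = 0" using simple_indep by blast
  qed (use simple_root in \<open>auto simp: roots_def dual_space_def\<close>)
  then obtain h where h: "h \<in> H" "\<And>i. i \<in> {1..l} \<Longrightarrow> a i h = 1" by blast
  have root_h: "\<exists>n::int. \<beta> h = of_int n \<and> n \<noteq> 0" if \<beta>: "\<beta> \<in> roots H" for \<beta>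
  proof -
    obtain c where c: "\<beta> = int_comb a {1..l} c" "(\<forall>i\<in>{1..l}. c i \<ge> 0) \<or> (\<forall>i\<in>{1..l}. c i \<le> 0)"
      using root_coefficients[OF \<beta>] .
    have "\<beta> h = of_int (\<Sum>i\<in>{1..l}. c i)"
      using c(1) h(2) by (simp add: int_comb_def)
    moreover have "(\<Sum>i\<in>{1..l}. c i) \<noteq> 0"
    proof
      assume s: "(\<Sum>i\<in>{1..l}. c i) = 0"
      have "\<forall>i\<in>{1..l}. c i = 0"
        using c(2)
      proof
        assume "\<forall>i\<in>{1..l}. c i \<ge> 0"
        then show ?thesis using s sum_nonneg_eq_0_iff[of "{1..l}" c] by blast
      next
        assume "\<forall>i\<in>{1..l}. c i \<le> 0"
        moreover have "(\<Sum>i\<in>{1..l}. - c i) = 0" using s by (simp only: sum_negf)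
        ultimately have "\<forall>i\<in>{1..l}. - c i = 0"
          using sum_nonneg_eq_0_iff[of "{1..l}" "\<lambda>i. - c i"] by simp
        then show ?thesis by simp
      qed
      then have "\<beta> = (\<lambda>_. 0)" using c(1) by (simp add: int_comb_def)
      then show False using \<beta> by (simp add: roots_def)
    qed
    ultimately show ?thesis by blast
  qed
  have wt_h: "\<exists>n::int. wt b h = of_int n \<and> (wt b \<noteq> (\<lambda>_. 0) \<longrightarrow> n \<noteq> 0)" if "b \<in> B" for b
    using wt_cases[OF that] root_h[of "wt b"] by (auto intro: exI[of _ 0])
  have "\<exists>n. \<forall>b\<in>B. wt b h = of_int (n b) \<and> (wt b \<noteq> (\<lambda>_. 0) \<longrightarrow> n b \<noteq> (0::int))"
    by (rule bchoice) (use wt_h in blast)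
  then obtain n :: "'a \<Rightarrow> int" where n: "\<And>b. b \<in> B \<Longrightarrow> wt b h = of_int (n b)"
    "\<And>b. b \<in> B \<Longrightarrow> wt b \<noteq> (\<lambda>_. 0) \<Longrightarrow> n b \<noteq> 0"
    by blast
  have "kappa h h \<noteq> 0"
  proof
    assume "kappa h h = 0"
    then have "(of_int (\<Sum>b\<in>B. (n b)\<^sup>2) :: complex) = 0"
      using n(1) by (simp add: kappa_cartan[OF h(1)])
    then have "(\<Sum>b\<in>B. (n b)\<^sup>2) = 0" using of_int_eq_0_iff by blast
    then have "\<forall>b\<in>B. n b = 0"
      using sum_nonneg_eq_0_iff[of B "\<lambda>b. (n b)\<^sup>2"] finite_B by auto
    then have wt0: "wt b = (\<lambda>_. 0)" if "b \<in> B" for b using n(2) that by blast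
    \<comment> \<open>all weights vanish, so the Cartan subalgebra is everything\<close>
    have "B \<subseteq> H" using wt0 wt_root_space root_space_zero by force
    then have "H = UNIV" using span_minimal[OF _ subspace_H] span_B by auto
    then show False using nonabelian cartan by (auto simp: cartan_subalgebra_def)
  qed
  then show ?thesis by blast
qed

text \<open>By invariance the radical of the form is an ideal.\<close>

lemma kappa_nondegenerate:
  assumes "x \<noteq> 0" shows "\<exists>y. kappa x y \<noteq> 0"
proof -
  let ?R = "{x. \<forall>y. kappa x y = 0}"
  have "lie_ideal ?R"
    unfolding lie_ideal_def
  proof (intro conjI allI ballI)
    show "subspace ?R"
      using kappa_scale_left[of 0 0] by (auto simp: subspace_def kappa_add_left kappa_scale_left)
  next
    fix x y assume "y \<in> ?R"
    then have "kappa (brk x y) z = 0" for z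
      using kappa_invariant[of y x z] brk_antisym[of x y] kappa_minus_left by simp
    then show "brk x y \<in> ?R" by simp
  qed
  moreover have "?R \<noteq> UNIV" using kappa_nonzero by auto
  ultimately have "?R = {0}" using only_trivial_ideals by blast
  then show ?thesis using assms by auto
qed

text \<open>Some basis vector is not orthogonal to \<open>x\<close>; its weight must be \<open>- \<alpha>\<close>. The bracket of the two is
  nonzero because \<open>kappa (brk x b) h = \<alpha> h * kappa x b\<close>.\<close>

lemma opposite_root_vector:
  assumes \<alpha>: "\<alpha> \<in> roots H" and x: "x \<in> root_space H \<alpha>" "x \<noteq> 0"
  obtains y where "y \<in> root_space H (\<lambda>h. - \<alpha> h)" "brk x y \<noteq> 0"
proof -
  obtain z where "kappa x z \<noteq> 0" using kappa_nondegenerate[OF x(2)] by blast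
  then have "(\<Sum>b\<in>B. kappa x (scale (rep z b) b)) \<noteq> 0"
    by (simp only: kappa_sum_right[symmetric] rep_expand) simp
  then obtain b where b: "b \<in> B" "kappa x (scale (rep z b) b) \<noteq> 0"
    by (meson sum.neutral)
  then have kb: "kappa x b \<noteq> 0"
    using kappa_scale_left[of "rep z b" b x] kappa_sym[of x b] kappa_sym[of x "scale (rep z b) b"] by auto
  have "wt b = (\<lambda>h. - \<alpha> h)"
  proof (rule dual_space_eqI)
    fix h assume "h \<in> H"
    then have "\<alpha> h + wt b h = 0"
      using kappa_orthogonal[OF x(1) wt_root_space[OF b(1)]] kb by blast
    then show "wt b h = - \<alpha> h" by (simp add: eq_neg_iff_add_eq_0 add.commute)
  qed (use b wt_dual dual_space_minus roots_dual \<alpha> in auto)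
  moreover have "brk x b \<noteq> 0"
  proof
    assume *: "brk x b = 0"
    obtain h where h: "h \<in> H" "\<alpha> h \<noteq> 0"
      using \<alpha> dual_space_eqI[OF roots_dual[OF \<alpha>] dual_space_zero] unfolding roots_def by blast
    have "\<alpha> h * kappa x b = kappa (brk h x) b"
      using x(1) h(1) by (simp add: root_space_def kappa_scale_left)
    also have "\<dots> = kappa (brk x b) h" using kappa_invariant[of h x b] kappa_sym[of h "brk x b"] by simp
    also have "\<dots> = 0" using * kappa_scale_left[of 0 0 h] by simp
    finally show False using h(2) kb by simp
  qed
  ultimately show ?thesis using that wt_root_space[OF b(1)] by metis
qed

lemma minus_root: assumes "\<alpha> \<in> roots H" shows "(\<lambda>h. - \<alpha> h) \<in> roots H"
proof -
  obtain x where "x \<in> root_space H \<alpha>" "x \<noteq> 0" using root_obtain[OF assms] .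
  then obtain y where y: "y \<in> root_space H (\<lambda>h. - \<alpha> h)" "brk x y \<noteq> 0"
    using opposite_root_vector[OF assms] by blast
  have "(\<lambda>h. - \<alpha> h) \<noteq> (\<lambda>_. 0)"
    using assms by (auto simp: roots_def fun_eq_iff)
  moreover have "y \<noteq> 0" using y(2) by auto
  ultimately show ?thesis using rootI[OF dual_space_minus[OF roots_dual[OF assms]] _ y(1)] by simp
qed

end

section \<open>Strings of root vectors and coroots\<close>

context weight_basis
begin

lemma funpow_brk_root_space:
  assumes "e \<in> root_space H \<alpha>" "v \<in> root_space H \<beta>"
  shows "(brk e ^^ n) v \<in> root_space H (\<lambda>h. \<beta> h + of_nat n * \<alpha> h)"
proof (induction n)
  case (Suc n)
  have "(\<lambda>h. \<alpha> h + (\<beta> h + of_nat n * \<alpha> h)) = (\<lambda>h. \<beta> h + of_nat (Suc n) * \<alpha> h)"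
    by (auto simp: algebra_simps)
  then show ?case using brk_root_space[OF assms(1) Suc] by simp
qed (use assms in simp)

text \<open>The weights \<open>\<beta> + n \<alpha>\<close> are distinct, and only finitely many of them occur.\<close>

lemma raising_nilpotent:
  assumes \<alpha>: "\<alpha> \<in> roots H" and e: "e \<in> root_space H \<alpha>"
    and \<beta>: "\<beta> \<in> dual_space H" and v: "v \<in> root_space H \<beta>"
  shows "\<exists>n. (brk e ^^ n) v = 0"
proof (rule ccontr)
  assume *: "\<not> ?thesis"
  let ?w = "\<lambda>n::nat. \<lambda>h. \<beta> h + of_nat n * \<alpha> h"
  have dual: "?w n \<in> dual_space H" for n
    using dual_space_add[OF \<beta> dual_space_mult[OF roots_dual[OF \<alpha>]]] .
  have "?w n \<in> insert (\<lambda>_. 0) (roots H)" for n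
    using rootI[OF dual _ funpow_brk_root_space[OF e v]] * by blast
  then have "range ?w \<subseteq> insert (\<lambda>_. 0) (roots H)" by blast
  then have "finite (range ?w)" using finite_roots finite_subset by blast
  moreover have "inj ?w"
  proof (rule injI)
    fix m n assume eq: "?w m = ?w n"
    obtain h where "\<alpha> h \<noteq> 0" using \<alpha> by (auto simp: roots_def fun_eq_iff)
    then show "m = n" using fun_cong[OF eq, of h] by simp
  qed
  ultimately show False using finite_imageD[of ?w UNIV] by simp
qed

text \<open>The sl2 commutation relation along a raising string, with \<open>[e, f] = t\<close> not normalised, so that it
  also covers the case \<open>\<alpha> t = 0\<close> that has to be excluded first. The scalar is the negative
  of the sum of the weights of \<open>t\<close> on the vectors \<open>v, e v, \<dots>, e\<^sup>n v\<close>.\<close>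

lemma brk_lower_raise:
  assumes e: "e \<in> root_space H \<alpha>" and f: "f \<in> root_space H (\<lambda>h. - \<alpha> h)"
    and v: "v \<in> root_space H \<beta>" "brk f v = 0" and t: "t = brk e f"
  shows "brk f ((brk e ^^ Suc n) v)
    = scale (- (of_nat (Suc n) * (\<beta> t + of_nat n / 2 * \<alpha> t))) ((brk e ^^ n) v)"
proof (induction n)
  have tH: "t \<in> H" using brk_root_space[OF e f] root_space_zero t by simp
  have step: "brk f ((brk e ^^ Suc n) v)
    = scale (- (\<beta> t + of_nat n * \<alpha> t)) ((brk e ^^ n) v) + brk e (brk f ((brk e ^^ n) v))" for n
  proof -
    have "brk t ((brk e ^^ n) v) = scale (\<beta> t + of_nat n * \<alpha> t) ((brk e ^^ n) v)"
      using funpow_brk_root_space[OF e v(1), of n] tH by (auto simp: root_space_def)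
    moreover have "brk (brk f e) w = - brk t w" for w
      using brk_antisym[of f e] t by (simp add: brk_minus_left)
    ultimately show ?thesis
      using brk_derivation[of f e "(brk e ^^ n) v"] by (simp only: scale_minus_left funpow.simps o_apply)
  qed
  {
    case 0
    show ?case using step[of 0] v(2) by simp
  next
    case (Suc n)
    let ?w = "(brk e ^^ Suc n) v"
    have "brk f ((brk e ^^ Suc (Suc n)) v) = scale (- (\<beta> t + of_nat (Suc n) * \<alpha> t)) ?w
        + scale (- (of_nat (Suc n) * (\<beta> t + of_nat n / 2 * \<alpha> t))) ?w"
      using step[of "Suc n"] Suc by (simp add: brk_scale_right brk_minus_right)
    also have "\<dots> = scale (- (\<beta> t + of_nat (Suc n) * \<alpha> t)
        + - (of_nat (Suc n) * (\<beta> t + of_nat n / 2 * \<alpha> t))) ?w"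
      by (rule scale_left_distrib[symmetric])
    also have "- (\<beta> t + of_nat (Suc n) * \<alpha> t) + - (of_nat (Suc n) * (\<beta> t + of_nat n / 2 * \<alpha> t))
        = - (of_nat (Suc (Suc n)) * (\<beta> t + of_nat (Suc n) / 2 * \<alpha> t))"
      by (simp add: field_simps)
    finally show ?case .
  }
qed

lemma funpow_brk_zero: "(brk e ^^ m) v = 0 \<Longrightarrow> m \<le> n \<Longrightarrow> (brk e ^^ n) v = 0"
proof -
  assume "(brk e ^^ m) v = 0" "m \<le> n"
  moreover have "(brk e ^^ k) 0 = 0" for k by (induction k) auto
  moreover have "(brk e ^^ (n - m + m)) v = (brk e ^^ (n - m)) ((brk e ^^ m) v)"
    unfolding funpow_add by simp
  ultimately show ?thesis by simp
qed

text \<open>If \<open>e\<^sup>n v\<close> is the last nonzero vector of the string that starts at a lowest vector \<open>v\<close>, the scalar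
  in the commutation relation must vanish there. This ties the length of the string to the
  weight of \<open>v\<close>.\<close>

lemma raising_string:
  assumes \<alpha>: "\<alpha> \<in> roots H" and e: "e \<in> root_space H \<alpha>" and f: "f \<in> root_space H (\<lambda>h. - \<alpha> h)"
    and \<beta>: "\<beta> \<in> dual_space H" and v: "v \<in> root_space H \<beta>" "brk f v = 0" "v \<noteq> 0"
    and t: "t = brk e f"
  obtains n where "\<beta> t + of_nat n / 2 * \<alpha> t = 0" "\<And>k. (brk e ^^ k) v \<noteq> 0 \<longleftrightarrow> k \<le> n"
proof -
  obtain N where "(brk e ^^ N) v = 0" using raising_nilpotent[OF \<alpha> e \<beta> v(1)] by blast
  then obtain n where n: "(brk e ^^ n) v \<noteq> 0" "(brk e ^^ Suc n) v = 0"
    using ex_least_nat_less[of "\<lambda>n. (brk e ^^ n) v = 0" N] v(3) by auto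
  have "scale (of_nat (Suc n) * (\<beta> t + of_nat n / 2 * \<alpha> t)) ((brk e ^^ n) v) = 0"
    using brk_lower_raise[OF e f v(1,2) t, of n] n(2) by (simp del: of_nat_Suc)
  then have "\<beta> t + of_nat n / 2 * \<alpha> t = 0"
    using n(1) by (simp del: of_nat_Suc)
  moreover have "(brk e ^^ k) v \<noteq> 0 \<longleftrightarrow> k \<le> n" for k
    using n funpow_brk_zero[of n] funpow_brk_zero[of k e v n] funpow_brk_zero[of "Suc n" e v k] by (meson not_less_eq_eq)
  ultimately show ?thesis using that by blast
qed

end

context simple_weight_basis
begin

text \<open>If \<open>\<alpha>\<close> vanished on \<open>t = [e, f]\<close>, the weight of \<open>t\<close> at the bottom of each string would be zero, hence
  \<open>t\<close> would act by zero on every weight vector and be central.\<close>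

lemma root_nonzero_on_bracket:
  assumes \<alpha>: "\<alpha> \<in> roots H" and e: "e \<in> root_space H \<alpha>" and f: "f \<in> root_space H (\<lambda>h. - \<alpha> h)"
    and nz: "brk e f \<noteq> 0"
  shows "\<alpha> (brk e f) \<noteq> 0"
proof
  let ?t = "brk e f"
  assume \<alpha>t: "\<alpha> ?t = 0"
  have tH: "?t \<in> H" using brk_root_space[OF e f] root_space_zero by simp
  have wt0: "\<beta> ?t = 0" if \<beta>: "\<beta> \<in> dual_space H" and v: "v \<in> root_space H \<beta>" "v \<noteq> 0" for \<beta> v
  proof -
    obtain N where "(brk f ^^ N) v = 0"
      using raising_nilpotent[OF minus_root[OF \<alpha>] f \<beta> v(1)] by blast
    then obtain m where m: "(brk f ^^ m) v \<noteq> 0" "(brk f ^^ Suc m) v = 0"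
      using ex_least_nat_less[of "\<lambda>n. (brk f ^^ n) v = 0" N] v(2) by auto
    let ?\<gamma> = "\<lambda>h. \<beta> h + of_nat m * - \<alpha> h"
    have "?\<gamma> \<in> dual_space H"
      using dual_space_add[OF \<beta> dual_space_mult[OF dual_space_minus[OF roots_dual[OF \<alpha>]]]] .
    from raising_string[OF \<alpha> e f this funpow_brk_root_space[OF f v(1)] _ m(1) refl] m(2)
    obtain n where "?\<gamma> ?t + of_nat n / 2 * \<alpha> ?t = 0" by auto
    then show ?thesis using \<alpha>t by simp
  qed
  have "brk ?t b = 0" if "b \<in> B" for b
  proof -
    have "b \<noteq> 0" using that indep_B dependent_zero by blast
    then have "wt b ?t = 0" using wt0[OF wt_dual wt_root_space] that by blast
    then show ?thesis using wt_root_space[OF that] tH by (auto simp: root_space_def)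
  qed
  then have "brk ?t y = 0" for y
    by (subst rep_expand[of y, symmetric]) (simp add: brk_sum_right brk_scale_right)
  then show False using central_zero nz by blast
qed

definition sl2_triple :: "('a \<Rightarrow> complex) \<Rightarrow> 'a \<Rightarrow> 'a \<Rightarrow> bool" where
  "sl2_triple \<alpha> e f \<longleftrightarrow> \<alpha> \<in> roots H \<and> e \<in> root_space H \<alpha> \<and> f \<in> root_space H (\<lambda>h. - \<alpha> h) \<and>
     \<alpha> (brk e f) = 2"

lemma ex_sl2_triple:
  assumes \<alpha>: "\<alpha> \<in> roots H" shows "\<exists>e f. sl2_triple \<alpha> e f"
proof -
  obtain e where e: "e \<in> root_space H \<alpha>" "e \<noteq> 0" using root_obtain[OF \<alpha>] .
  then obtain f where f: "f \<in> root_space H (\<lambda>h. - \<alpha> h)" "brk e f \<noteq> 0"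
    using opposite_root_vector[OF \<alpha>] by blast
  let ?t = "brk e f"
  have nz: "\<alpha> ?t \<noteq> 0" using root_nonzero_on_bracket[OF \<alpha> e(1) f] .
  have tH: "?t \<in> H" using brk_root_space[OF e(1) f(1)] root_space_zero by simp
  let ?f = "scale (2 / \<alpha> ?t) f"
  have "\<alpha> (brk e ?f) = 2"
    using roots_dual[OF \<alpha>] tH nz by (simp add: brk_scale_right dual_space_def)
  moreover have "?f \<in> root_space H (\<lambda>h. - \<alpha> h)"
    using f(1) subspace_scale[OF subspace_root_space] by blast
  ultimately show ?thesis using \<alpha> e unfolding sl2_triple_def by blast
qed

lemma sl2_triple_bracket: "sl2_triple \<alpha> e f \<Longrightarrow> brk e f \<in> H"
  using brk_root_space[of e \<alpha> f "\<lambda>h. - \<alpha> h"] root_space_zero by (simp add: sl2_triple_def)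

lemma dual_neg: "\<beta> \<in> dual_space H \<Longrightarrow> t \<in> H \<Longrightarrow> \<beta> (- t) = - \<beta> t"
proof -
  assume "\<beta> \<in> dual_space H" "t \<in> H"
  then have "\<beta> (scale (- 1) t) = - 1 * \<beta> t" unfolding dual_space_def by blast
  then show ?thesis by simp
qed

lemma sl2_triple_swap:
  assumes "sl2_triple \<alpha> e f" shows "sl2_triple (\<lambda>h. - \<alpha> h) f e"
  using assms sl2_triple_bracket[OF assms] dual_neg[OF roots_dual, of \<alpha> "brk e f"]
    brk_antisym[of f e] minus_root[of \<alpha>]
  by (simp add: sl2_triple_def)

text \<open>Let the string of \<open>f\<close> reach its bottom after \<open>m\<close> steps down from \<open>v\<close>, and let \<open>e\<close> lead
  \<open>n\<close> steps up from there. Then \<open>\<beta> [e, f] = 2 m - n\<close>, and for \<open>m \<le> n\<close> the vector \<open>n - m\<close> steps above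
  the bottom is nonzero and has the reflected weight.\<close>

lemma reflect_nonpos:
  assumes tr: "sl2_triple \<alpha> e f" and \<beta>: "\<beta> \<in> dual_space H"
    and v: "v \<in> root_space H \<beta>" "v \<noteq> 0"
  shows "\<exists>k::int. \<beta> (brk e f) = of_int k \<and>
    (k \<le> 0 \<longrightarrow> root_space H (\<lambda>h. \<beta> h - of_int k * \<alpha> h) \<noteq> {0})"
proof -
  let ?t = "brk e f"
  have \<alpha>: "\<alpha> \<in> roots H" and e: "e \<in> root_space H \<alpha>" and f: "f \<in> root_space H (\<lambda>h. - \<alpha> h)"
    and \<alpha>t: "\<alpha> ?t = 2" using tr by (auto simp: sl2_triple_def)
  obtain N where "(brk f ^^ N) v = 0"
    using raising_nilpotent[OF minus_root[OF \<alpha>] f \<beta> v(1)] by blast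
  then obtain m where m: "(brk f ^^ m) v \<noteq> 0" "(brk f ^^ Suc m) v = 0"
    using ex_least_nat_less[of "\<lambda>n. (brk f ^^ n) v = 0" N] v(2) by auto
  let ?\<gamma> = "\<lambda>h. \<beta> h + of_nat m * - \<alpha> h"
  let ?u = "(brk f ^^ m) v"
  have \<gamma>: "?\<gamma> \<in> dual_space H"
    using dual_space_add[OF \<beta> dual_space_mult[OF dual_space_minus[OF roots_dual[OF \<alpha>]]]] .
  have u: "?u \<in> root_space H ?\<gamma>" by (rule funpow_brk_root_space[OF f v(1)])
  from raising_string[OF \<alpha> e f \<gamma> u _ m(1) refl] m(2)
  obtain n where n: "?\<gamma> ?t + of_nat n / 2 * \<alpha> ?t = 0" "\<And>k. (brk e ^^ k) ?u \<noteq> 0 \<longleftrightarrow> k \<le> n"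
    by auto
  define k where "k = 2 * int m - int n"
  have \<beta>t: "\<beta> ?t = of_int k" using n(1) \<alpha>t by (simp add: k_def algebra_simps)
  moreover have "root_space H (\<lambda>h. \<beta> h - of_int k * \<alpha> h) \<noteq> {0}" if "k \<le> 0"
  proof -
    have le: "m \<le> n" using that by (simp add: k_def)
    have "(brk e ^^ (n - m)) ?u \<in> root_space H (\<lambda>h. ?\<gamma> h + of_nat (n - m) * \<alpha> h)"
      by (rule funpow_brk_root_space[OF e u])
    moreover have "(\<lambda>h. ?\<gamma> h + of_nat (n - m) * \<alpha> h) = (\<lambda>h. \<beta> h - of_int k * \<alpha> h)"
      using le by (auto simp: k_def of_nat_diff algebra_simps)
    moreover have "(brk e ^^ (n - m)) ?u \<noteq> 0" using n(2) by simp
    ultimately show ?thesis by (metis singletonD)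
  qed
  ultimately show ?thesis by blast
qed

text \<open>Roots with positive value on the coroot are covered by exchanging the roles of \<open>e\<close> and \<open>f\<close>.\<close>

lemma reflect_root:
  assumes tr: "sl2_triple \<alpha> e f" and \<beta>: "\<beta> \<in> roots H"
  shows "(\<lambda>h. \<beta> h - \<beta> (brk e f) * \<alpha> h) \<in> insert (\<lambda>_. 0) (roots H)"
proof -
  let ?t = "brk e f"
  let ?\<sigma> = "\<lambda>h. \<beta> h - \<beta> ?t * \<alpha> h"
  have \<alpha>: "\<alpha> \<in> roots H" using tr by (simp add: sl2_triple_def)
  obtain v where v: "v \<in> root_space H \<beta>" "v \<noteq> 0" using root_obtain[OF \<beta>] .
  obtain k :: int where k: "\<beta> ?t = of_int k"
    "k \<le> 0 \<Longrightarrow> root_space H (\<lambda>h. \<beta> h - of_int k * \<alpha> h) \<noteq> {0}"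
    using reflect_nonpos[OF tr roots_dual[OF \<beta>] v] by blast
  have "root_space H ?\<sigma> \<noteq> {0}"
  proof (cases "k \<le> 0")
    case True
    then show ?thesis using k by simp
  next
    case False
    obtain k' :: int where k': "\<beta> (brk f e) = of_int k'"
      "k' \<le> 0 \<Longrightarrow> root_space H (\<lambda>h. \<beta> h - of_int k' * - \<alpha> h) \<noteq> {0}"
      using reflect_nonpos[OF sl2_triple_swap[OF tr] roots_dual[OF \<beta>] v] by blast
    have "\<beta> (brk f e) = - \<beta> ?t"
      using brk_antisym[of f e] dual_neg[OF roots_dual[OF \<beta>] sl2_triple_bracket[OF tr]] by simp
    then have "of_int k' = (of_int (- k) :: complex)" using k(1) k'(1) by simp
    then have "k' = - k" using of_int_eq_iff by blast
    then show ?thesis using k'(2) False k(1) by simp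
  qed
  moreover have "?\<sigma> \<in> dual_space H"
    using dual_space_add[OF roots_dual[OF \<beta>] dual_space_mult[OF roots_dual[OF \<alpha>], of "- \<beta> ?t"]] by simp
  ultimately show ?thesis by (auto simp: roots_def)
qed

lemma sl2_highest_weight:
  assumes tr: "sl2_triple \<alpha> e f" and \<beta>: "\<beta> \<in> dual_space H"
    and v: "v \<in> root_space H \<beta>" "v \<noteq> 0" "brk e v = 0" and wt: "\<beta> (brk e f) = of_nat n"
  shows "(brk f ^^ n) v \<noteq> 0"
proof -
  let ?\<alpha> = "\<lambda>h. - \<alpha> h"
  have tr': "sl2_triple ?\<alpha> f e" using sl2_triple_swap[OF tr] .
  then have p: "?\<alpha> \<in> roots H" "f \<in> root_space H ?\<alpha>" "e \<in> root_space H (\<lambda>h. - ?\<alpha> h)"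
    "?\<alpha> (brk f e) = 2"
    by (auto simp: sl2_triple_def)
  obtain m where m: "\<beta> (brk f e) + of_nat m / 2 * ?\<alpha> (brk f e) = 0"
    "\<And>k. (brk f ^^ k) v \<noteq> 0 \<longleftrightarrow> k \<le> m"
    using raising_string[OF p(1-3) \<beta> v(1,3,2) refl] by blast
  have "\<beta> (brk f e) = - of_nat n"
    using brk_antisym[of f e] dual_neg[OF \<beta> sl2_triple_bracket[OF tr]] wt by simp
  then have "m = n" using m(1) p(4) by simp
  then show ?thesis using m(2) by blast
qed

text \<open>For the largest \<open>n\<close> with \<open>n \<alpha>\<close> a root, a vector \<open>x\<close> of weight \<open>n \<alpha>\<close> is killed by \<open>e\<close> and has
  weight \<open>2 n\<close> for \<open>[e, f]\<close>, so that \<open>2 n\<close> applications of \<open>f\<close> do not kill it. But \<open>f\<^sup>n x\<close> lies in \<open>H\<close>,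
  hence \<open>n + 1\<close> applications give a multiple of \<open>f\<close>, and \<open>n + 2\<close> give zero.\<close>

lemma multiple_root:
  assumes \<alpha>: "\<alpha> \<in> roots H" and k: "(\<lambda>h. of_nat k * \<alpha> h) \<in> roots H"
  shows "k \<le> 1"
proof (rule ccontr)
  assume "\<not> k \<le> 1"
  define M where "M = {k. (\<lambda>h. of_nat k * \<alpha> h) \<in> roots H}"
  obtain h0 where h0: "\<alpha> h0 \<noteq> 0" using \<alpha> by (auto simp: roots_def fun_eq_iff)
  have "inj (\<lambda>k::nat. \<lambda>h. of_nat k * \<alpha> h)"
    using h0 by (auto intro!: injI dest: fun_cong[of _ _ h0])
  then have "finite M"
    unfolding M_def using finite_vimageI[OF finite_roots, of "\<lambda>k::nat. \<lambda>h. of_nat k * \<alpha> h"]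
    by (simp add: vimage_def)
  define n where "n = Max M"
  have "k \<in> M" using k by (simp add: M_def)
  then have n: "n \<in> M" "k \<le> n" unfolding n_def using \<open>finite M\<close> by (auto intro: Max_in)
  have max: "Suc n \<notin> M"
  proof
    assume "Suc n \<in> M"
    then show False using Max_ge[OF \<open>finite M\<close>, of "Suc n"] by (simp add: n_def)
  qed
  have n2: "n \<ge> 2" using n(2) \<open>\<not> k \<le> 1\<close> by simp
  obtain e f where tr: "sl2_triple \<alpha> e f" using ex_sl2_triple[OF \<alpha>] by blast
  have e: "e \<in> root_space H \<alpha>" and f: "f \<in> root_space H (\<lambda>h. - \<alpha> h)" and \<alpha>t: "\<alpha> (brk e f) = 2"
    using tr by (auto simp: sl2_triple_def)
  have n_root: "(\<lambda>h. of_nat n * \<alpha> h) \<in> roots H" using n(1) by (simp add: M_def)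
  obtain x where x: "x \<in> root_space H (\<lambda>h. of_nat n * \<alpha> h)" "x \<noteq> 0"
    using root_obtain[OF n_root] .
  have "brk e x \<in> root_space H (\<lambda>h. of_nat (Suc n) * \<alpha> h)"
  proof -
    have "(\<lambda>h. \<alpha> h + of_nat n * \<alpha> h) = (\<lambda>h. of_nat (Suc n) * \<alpha> h)" by (auto simp: algebra_simps)
    then show ?thesis using brk_root_space[OF e x(1)] by simp
  qed
  moreover have "(\<lambda>h. of_nat (Suc n) * \<alpha> h) \<noteq> (\<lambda>_. 0)"
    using h0 by (auto simp: fun_eq_iff simp del: of_nat_Suc)
  ultimately have "brk e x = 0"
    using max rootI[OF dual_space_mult[OF roots_dual[OF \<alpha>]]] unfolding M_def by blast
  then have nz: "(brk f ^^ (2 * n)) x \<noteq> 0"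
    using sl2_highest_weight[OF tr roots_dual[OF n_root] x, of "2 * n"] \<alpha>t by simp
  \<comment> \<open>but after \<open>n\<close> steps down one is in the Cartan subalgebra, then on the line through \<open>f\<close>\<close>
  have "(brk f ^^ n) x \<in> root_space H (\<lambda>h. of_nat n * \<alpha> h + of_nat n * - \<alpha> h)"
    by (rule funpow_brk_root_space[OF f x(1)])
  then have "(brk f ^^ n) x \<in> H" using root_space_zero by simp
  then have "brk ((brk f ^^ n) x) f = scale (- \<alpha> ((brk f ^^ n) x)) f"
    using f by (simp add: root_space_def)
  then have "(brk f ^^ Suc n) x = scale (\<alpha> ((brk f ^^ n) x)) f"
    using brk_antisym[of f "(brk f ^^ n) x"] by simp
  then have "(brk f ^^ Suc (Suc n)) x = 0"
    by (simp add: brk_scale_right brk_self)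
  then show False using funpow_brk_zero[of "Suc (Suc n)" f x "2 * n"] n2 nz by simp
qed

text \<open>Subtract the multiple of \<open>e\<close> that makes the difference \<open>y\<close> vanish under \<open>f\<^sup>2\<close>. As \<open>2 \<alpha>\<close> is not a
  root, \<open>e\<close> kills \<open>y\<close>, and a nonzero vector of weight 2 killed by \<open>e\<close> is not killed by \<open>f\<^sup>2\<close>.\<close>

lemma root_space_line:
  assumes tr: "sl2_triple \<alpha> e f" and x: "x \<in> root_space H \<alpha>"
  shows "\<exists>c. x = scale c e"
proof -
  have \<alpha>: "\<alpha> \<in> roots H" and e: "e \<in> root_space H \<alpha>" and f: "f \<in> root_space H (\<lambda>h. - \<alpha> h)"
    and \<alpha>t: "\<alpha> (brk e f) = 2" using tr by (auto simp: sl2_triple_def)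
  have f2: "(brk f ^^ 2) y = scale (\<alpha> (brk f y)) f" if y: "y \<in> root_space H \<alpha>" for y
  proof -
    have "brk f y \<in> H" using brk_root_space[OF f y] root_space_zero by simp
    then have "brk (brk f y) f = scale (- \<alpha> (brk f y)) f" using f by (simp add: root_space_def)
    then show ?thesis using brk_antisym[of f "brk f y"] by (simp add: numeral_2_eq_2)
  qed
  have "\<alpha> (brk f e) = -2"
    using brk_antisym[of f e] dual_neg[OF roots_dual[OF \<alpha>] sl2_triple_bracket[OF tr]] \<alpha>t by simp
  then have f2e: "(brk f ^^ 2) e = scale (- 2) f" using f2[OF e] by simp
  define c where "c = - \<alpha> (brk f x) / 2"
  define y where "y = x - scale c e"
  have y: "y \<in> root_space H \<alpha>"
    unfolding y_def by (intro subspace_diff subspace_scale subspace_root_space x e)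
  have "(brk f ^^ 2) y = (brk f ^^ 2) x - scale c ((brk f ^^ 2) e)"
    by (simp add: y_def numeral_2_eq_2 brk_diff_right brk_scale_right)
  also have "\<dots> = 0" using f2[OF x] f2e by (simp add: c_def)
  finally have f2y: "(brk f ^^ 2) y = 0" .
  have "brk e y = 0"
  proof (rule ccontr)
    assume nz: "brk e y \<noteq> 0"
    have eq: "(\<lambda>h. \<alpha> h + \<alpha> h) = (\<lambda>h. of_nat 2 * \<alpha> h)" by (rule ext) simp
    have "brk e y \<in> root_space H (\<lambda>h. of_nat 2 * \<alpha> h)" using brk_root_space[OF e y] unfolding eq .
    moreover have "(\<lambda>h. of_nat 2 * \<alpha> h) \<noteq> (\<lambda>_. 0)" using \<alpha> by (auto simp: roots_def fun_eq_iff)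
    ultimately have "(\<lambda>h. of_nat 2 * \<alpha> h) \<in> roots H"
      using rootI[OF dual_space_mult[OF roots_dual[OF \<alpha>]] _ _ nz] by blast
    then show False using multiple_root[OF \<alpha>] by fastforce
  qed
  then have "y = 0"
    using sl2_highest_weight[OF tr roots_dual[OF \<alpha>] y, of 2] \<alpha>t f2y by auto
  then show ?thesis by (auto simp: y_def)
qed

text \<open>Root spaces being lines, \<open>[g\<^sub>\<alpha>, g\<^sub>-\<^sub>\<alpha>]\<close> is the line through \<open>[e, f]\<close>.\<close>

lemma coroot_eq:
  assumes tr: "sl2_triple \<alpha> e f"
  shows "coroot H \<alpha> = brk e f"
proof -
  have e: "e \<in> root_space H \<alpha>" and f: "f \<in> root_space H (\<lambda>h. - \<alpha> h)"
    and \<alpha>t: "\<alpha> (brk e f) = 2" and \<alpha>: "\<alpha> \<in> roots H"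
    using tr by (auto simp: sl2_triple_def)
  let ?S = "{brk x y |x y. x \<in> root_space H \<alpha> \<and> y \<in> root_space H (\<lambda>z. - \<alpha> z)}"
  have "?S \<subseteq> span {brk e f}"
  proof safe
    fix x y assume "x \<in> root_space H \<alpha>" "y \<in> root_space H (\<lambda>z. - \<alpha> z)"
    then obtain c d where "x = scale c e" "y = scale d f"
      using root_space_line[OF tr] root_space_line[OF sl2_triple_swap[OF tr]] by blast
    then show "brk x y \<in> span {brk e f}"
      by (simp add: brk_scale_left brk_scale_right span_scale span_base)
  qed
  moreover have "brk e f \<in> ?S" using e f by blast
  ultimately have span: "span ?S = span {brk e f}"
    by (intro antisym span_minimal subspace_span) (auto intro: span_base)
  have "(THE h. h \<in> span ?S \<and> \<alpha> h = 2) = brk e f"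
  proof (rule the_equality)
    show "brk e f \<in> span ?S \<and> \<alpha> (brk e f) = 2" using \<alpha>t span by (simp add: span_base)
  next
    fix h assume h: "h \<in> span ?S \<and> \<alpha> h = 2"
    then obtain c where c: "h = scale c (brk e f)"
      using span by (auto simp: span_singleton)
    have "\<alpha> h = c * 2" using c roots_dual[OF \<alpha>] sl2_triple_bracket[OF tr] \<alpha>t by (simp add: dual_space_def)
    then show "h = brk e f" using h c by simp
  qed
  then show ?thesis by (simp add: coroot_def)
qed

end

section \<open>Coefficient vectors of the positive roots\<close>

definition unit_vec :: "nat \<Rightarrow> nat \<Rightarrow> int" where
  "unit_vec i = (\<lambda>k. if k = i then 1 else 0)"

text \<open>The value on the \<open>i\<close>-th simple coroot of the combination of simple roots with coefficients \<open>c\<close>.\<close>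

definition coroot_value :: "classical_type \<Rightarrow> nat \<Rightarrow> nat \<Rightarrow> (nat \<Rightarrow> int) \<Rightarrow> int" where
  "coroot_value X l i c = (\<Sum>j\<in>{1..l}. cartan_matrix X l i j * c j)"

definition simple_reflection :: "classical_type \<Rightarrow> nat \<Rightarrow> nat \<Rightarrow> (nat \<Rightarrow> int) \<Rightarrow> nat \<Rightarrow> int" where
  "simple_reflection X l i c = c(i := c i - coroot_value X l i c)"

text \<open>The properties of the coefficient vectors of positive roots that determine them.\<close>

definition positive_system :: "classical_type \<Rightarrow> nat \<Rightarrow> (nat \<Rightarrow> int) set \<Rightarrow> bool" where
  "positive_system X l P \<longleftrightarrow>
     (\<forall>c\<in>P. (\<forall>i. 0 \<le> c i) \<and> (\<forall>i. i \<notin> {1..l} \<longrightarrow> c i = 0) \<and> (\<exists>i. c i \<noteq> 0)) \<and>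
     (\<forall>i\<in>{1..l}. unit_vec i \<in> P) \<and>
     (\<forall>i\<in>{1..l}. \<forall>c\<in>P. c \<noteq> unit_vec i \<longrightarrow> simple_reflection X l i c \<in> P)"

text \<open>For \<open>P\<close> the coefficient vectors of \<open>\<Delta>\<^sup>+\<close>, these are the coefficient vectors of \<open>\<Delta>\<^sub>I\<close>, and
  \<open>ideal_family P I\<close> below corresponds to \<open>F\<^sub>I\<close>.\<close>

definition levi_part :: "(nat \<Rightarrow> int) set \<Rightarrow> nat set \<Rightarrow> (nat \<Rightarrow> int) set" where
  "levi_part P I = {c. (c \<in> P \<or> (\<lambda>i. - c i) \<in> P) \<and> (\<forall>i. c i \<noteq> 0 \<longrightarrow> i \<in> I)}"

definition ideal_family :: "(nat \<Rightarrow> int) set \<Rightarrow> nat set \<Rightarrow> (nat \<Rightarrow> int) set set" where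
  "ideal_family P I = {\<Phi>. \<Phi> \<subseteq> P - levi_part P I \<and>
     (\<forall>\<alpha>\<in>\<Phi>. \<forall>\<beta>\<in>P \<union> levi_part P I. (\<lambda>i. \<alpha> i + \<beta> i) \<in> P \<longrightarrow> (\<lambda>i. \<alpha> i + \<beta> i) \<in> \<Phi>)}"

context simple_weight_basis
begin

definition positive_coefficients :: "(nat \<Rightarrow> int) set" where
  "positive_coefficients =
     {c. (\<forall>i. 0 \<le> c i) \<and> (\<forall>i. i \<notin> {1..l} \<longrightarrow> c i = 0) \<and> int_comb a {1..l} c \<in> roots H}"

lemma int_comb_restrict: "int_comb a {1..l} (\<lambda>i. if i \<in> {1..l} then c i else 0) = int_comb a {1..l} c"
  by (auto simp: int_comb_def intro!: sum.cong)

lemma int_comb_add: "int_comb a J (\<lambda>i. c i + d i) = (\<lambda>x. int_comb a J c x + int_comb a J d x)"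
  by (simp add: int_comb_def distrib_right sum.distrib)

lemma int_comb_minus: "int_comb a J (\<lambda>i. - c i) = (\<lambda>x. - int_comb a J c x)"
  by (simp add: int_comb_def sum_negf)

lemma int_comb_unit: "i \<in> {1..l} \<Longrightarrow> int_comb a {1..l} (\<lambda>k. k' * unit_vec i k) = (\<lambda>x. of_int k' * a i x)"
proof (rule ext)
  fix x assume i: "i \<in> {1..l}"
  have "int_comb a {1..l} (\<lambda>k. k' * unit_vec i k) x = (\<Sum>j\<in>{1..l}. if j = i then of_int k' * a i x else 0)"
    unfolding int_comb_def unit_vec_def by (intro sum.cong) auto
  then show "int_comb a {1..l} (\<lambda>k. k' * unit_vec i k) x = of_int k' * a i x" using i by simp
qed

lemma int_comb_inj:
  assumes "int_comb a {1..l} c = int_comb a {1..l} d"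
    and "\<And>i. i \<notin> {1..l} \<Longrightarrow> c i = 0" "\<And>i. i \<notin> {1..l} \<Longrightarrow> d i = 0"
  shows "c = d"
  by (rule ext) (metis int_comb_inject assms)

lemma root_sign:
  assumes "int_comb a {1..l} c \<in> roots H" "\<And>i. i \<notin> {1..l} \<Longrightarrow> c i = 0"
  shows "c \<in> positive_coefficients \<or> (\<lambda>i. - c i) \<in> positive_coefficients"
proof -
  obtain d where d: "int_comb a {1..l} c = int_comb a {1..l} d"
    "(\<forall>i\<in>{1..l}. d i \<ge> 0) \<or> (\<forall>i\<in>{1..l}. d i \<le> 0)"
    using root_coefficients[OF assms(1)] .
  then have "(\<forall>i\<in>{1..l}. c i \<ge> 0) \<or> (\<forall>i\<in>{1..l}. c i \<le> 0)"
    using int_comb_inject[OF d(1)] by auto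
  then have "(\<forall>i. c i \<ge> 0) \<or> (\<forall>i. c i \<le> 0)" using assms(2) by (metis order_refl)
  then show ?thesis
    using assms minus_root[OF assms(1)] by (auto simp: positive_coefficients_def int_comb_minus)
qed

text \<open>A positive root other than \<open>\<alpha>\<^sub>i\<close> is not a multiple of \<open>\<alpha>\<^sub>i\<close>, so it has a positive coefficient at some
  \<open>j \<noteq> i\<close>. The reflection leaves this coefficient unchanged, and it forces the reflected root
  to be positive.\<close>

lemma positive_coefficients_system:
  assumes type: "\<And>i j. i \<in> {1..l} \<Longrightarrow> j \<in> {1..l} \<Longrightarrow>
      a j (coroot H (a i)) = of_int (cartan_matrix X l i j)"
    and diag: "\<And>i. cartan_matrix X l i i = 2"
  shows "positive_system X l positive_coefficients"
  unfolding positive_system_def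
proof (intro conjI ballI impI)
  show "\<exists>i. c i \<noteq> 0" if "c \<in> positive_coefficients" for c
  proof (rule ccontr)
    assume "\<not> ?thesis"
    then have "int_comb a {1..l} c = (\<lambda>_. 0)" by (simp add: int_comb_def)
    then show False using that by (auto simp: positive_coefficients_def roots_def)
  qed
  show "unit_vec i \<in> positive_coefficients" if "i \<in> {1..l}" for i
    using int_comb_unit[OF that, of 1] simple_root[OF that] that
    by (auto simp: positive_coefficients_def unit_vec_def)
  show "simple_reflection X l i c \<in> positive_coefficients"
    if i: "i \<in> {1..l}" and c: "c \<in> positive_coefficients" and ne: "c \<noteq> unit_vec i" for i c
  proof -
    let ?F = "int_comb a {1..l}"
    obtain e f where tr: "sl2_triple (a i) e f" using ex_sl2_triple[OF simple_root[OF i]] by blast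
    have h: "brk e f = coroot H (a i)" using coroot_eq[OF tr] by simp
    have root: "?F c \<in> roots H" and c0: "\<And>k. 0 \<le> c k" and supp: "\<And>k. k \<notin> {1..l} \<Longrightarrow> c k = 0"
      using c by (auto simp: positive_coefficients_def)
    have val: "?F c (brk e f) = of_int (coroot_value X l i c)"
      unfolding h int_comb_def coroot_value_def
      using type[OF i] by (simp add: mult.commute)
    let ?k = "coroot_value X l i c"
    let ?c' = "simple_reflection X l i c"
    have c'_eq: "?c' = (\<lambda>j. c j + (- ?k) * unit_vec i j)"
      by (auto simp: simple_reflection_def unit_vec_def)
    have F': "?F ?c' = (\<lambda>x. ?F c x - ?F c (brk e f) * a i x)"
      unfolding c'_eq int_comb_add int_comb_unit[OF i] val by simp
    have not_mult: "\<exists>j. j \<noteq> i \<and> c j \<noteq> 0"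
    proof (rule ccontr)
      assume "\<not> ?thesis"
      then have c_eq: "c = (\<lambda>j. c i * unit_vec i j)" by (intro ext) (auto simp: unit_vec_def)
      then have "?F c = (\<lambda>x. of_int (c i) * a i x)" using int_comb_unit[OF i, of "c i"] by simp
      then have "(\<lambda>x. of_nat (nat (c i)) * a i x) \<in> roots H" using root c0[of i] by simp
      then have "nat (c i) \<le> 1" using multiple_root[OF simple_root[OF i]] by blast
      moreover have "c i \<noteq> 0"
      proof
        assume "c i = 0"
        then have "?F c = (\<lambda>_. 0)" using \<open>?F c = (\<lambda>x. of_int (c i) * a i x)\<close> by simp
        then show False using root by (simp add: roots_def)
      qed
      ultimately have "c i = 1" using c0[of i] by linarith
      then show False using c_eq ne by simp
    qed
    then obtain j where j: "j \<noteq> i" "c j \<noteq> 0" by blast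
    have c'j: "?c' j = c j" using j by (simp add: simple_reflection_def)
    have supp': "\<And>k. k \<notin> {1..l} \<Longrightarrow> ?c' k = 0" using supp i by (auto simp: simple_reflection_def)
    have "?F ?c' \<noteq> (\<lambda>_. 0)"
    proof
      assume "?F ?c' = (\<lambda>_. 0)"
      then have "?F ?c' = ?F (\<lambda>_. 0)" by (simp add: int_comb_def)
      then have "?c' = (\<lambda>_. 0)" using int_comb_inj supp' by blast
      then show False using c'j j by simp
    qed
    then have "?F ?c' \<in> roots H" using reflect_root[OF tr root] F' by simp
    then have "?c' \<in> positive_coefficients \<or> (\<lambda>i. - ?c' i) \<in> positive_coefficients"
      using root_sign supp' by blast
    moreover have "(\<lambda>i. - ?c' i) \<notin> positive_coefficients"
    proof
      assume "(\<lambda>i. - ?c' i) \<in> positive_coefficients"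
      then have "- ?c' j \<ge> 0" by (simp add: positive_coefficients_def)
      then show False using c'j j c0[of j] by simp
    qed
    ultimately show ?thesis by blast
  qed
qed (auto simp: positive_coefficients_def)

lemma root_iff_coefficients:
  "roots H = int_comb a {1..l} ` (positive_coefficients \<union> {c. (\<lambda>i. - c i) \<in> positive_coefficients})"
proof (intro antisym subsetI)
  fix \<beta> assume \<beta>: "\<beta> \<in> roots H"
  obtain c where c: "\<beta> = int_comb a {1..l} c" using root_coefficients[OF \<beta>] by blast
  let ?c = "\<lambda>i. if i \<in> {1..l} then c i else 0"
  have "\<beta> = int_comb a {1..l} ?c" unfolding c int_comb_restrict ..
  moreover have "?c \<in> positive_coefficients \<or> (\<lambda>i. - ?c i) \<in> positive_coefficients"
  proof (rule root_sign)
    show "int_comb a {1..l} ?c \<in> roots H" using \<beta> unfolding c int_comb_restrict .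
    show "?c i = 0" if "i \<notin> {1..l}" for i by (subst if_not_P[OF that]) (rule refl)
  qed
  ultimately show "\<beta> \<in> int_comb a {1..l} ` (positive_coefficients \<union> {c. (\<lambda>i. - c i) \<in> positive_coefficients})"
    by blast
next
  fix \<beta> assume "\<beta> \<in> int_comb a {1..l} ` (positive_coefficients \<union> {c. (\<lambda>i. - c i) \<in> positive_coefficients})"
  then obtain c where c: "\<beta> = int_comb a {1..l} c"
    "c \<in> positive_coefficients \<or> (\<lambda>i. - c i) \<in> positive_coefficients" by blast
  from c(2) show "\<beta> \<in> roots H"
  proof
    assume "(\<lambda>i. - c i) \<in> positive_coefficients"
    then have "(\<lambda>x. - \<beta> x) \<in> roots H"
      using c(1) by (simp add: positive_coefficients_def int_comb_minus)
    from minus_root[OF this] show ?thesis by simp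
  qed (use c in \<open>simp add: positive_coefficients_def\<close>)
qed

lemma positive_roots_coefficients:
  "positive_roots H l a = int_comb a {1..l} ` positive_coefficients"
proof (intro antisym subsetI)
  fix \<beta> assume "\<beta> \<in> positive_roots H l a"
  then obtain c where \<beta>: "\<beta> \<in> roots H" and c: "\<beta> = int_comb a {1..l} c" "\<forall>i\<in>{1..l}. 0 \<le> c i"
    by (auto simp: positive_roots_def)
  let ?c = "\<lambda>i. if i \<in> {1..l} then c i else 0"
  have "?c \<in> positive_coefficients" using \<beta> c int_comb_restrict[of c]
    by (auto simp: positive_coefficients_def)
  then show "\<beta> \<in> int_comb a {1..l} ` positive_coefficients"
    unfolding c(1) int_comb_restrict[of c, symmetric] by (rule imageI)
qed (auto simp: positive_roots_def positive_coefficients_def)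

lemma roots_of_subset_coefficients:
  assumes I: "I \<subseteq> {1..l}"
  shows "roots_of_subset H a I = int_comb a {1..l} ` levi_part positive_coefficients I"
proof -
  have restr: "int_comb a I d = int_comb a {1..l} (\<lambda>i. if i \<in> I then d i else 0)" for d
    unfolding int_comb_def using I by (intro ext sum.mono_neutral_cong_left) auto
  show ?thesis
  proof (intro antisym subsetI)
    fix \<beta> assume "\<beta> \<in> roots_of_subset H a I"
    then obtain d where \<beta>: "\<beta> \<in> roots H" "\<beta> = int_comb a I d"
      by (auto simp: roots_of_subset_def)
    then obtain c where c: "\<beta> = int_comb a {1..l} c"
      "c \<in> positive_coefficients \<or> (\<lambda>i. - c i) \<in> positive_coefficients"
      unfolding root_iff_coefficients by blast
    have "c = (\<lambda>i. if i \<in> I then d i else 0)"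
    proof (rule int_comb_inj)
      show "int_comb a {1..l} c = int_comb a {1..l} (\<lambda>i. if i \<in> I then d i else 0)"
        using c(1) \<beta>(2) restr by simp
    qed (use c(2) I in \<open>auto simp: positive_coefficients_def\<close>)
    then have "c i \<noteq> 0 \<Longrightarrow> i \<in> I" for i by metis
    then have "c \<in> levi_part positive_coefficients I" using c(2) by (simp add: levi_part_def)
    then show "\<beta> \<in> int_comb a {1..l} ` levi_part positive_coefficients I" using c(1) by blast
  next
    fix \<beta> assume "\<beta> \<in> int_comb a {1..l} ` levi_part positive_coefficients I"
    then obtain c where c: "\<beta> = int_comb a {1..l} c" "c \<in> levi_part positive_coefficients I" by blast
    have "c = (\<lambda>i. if i \<in> I then c i else 0)" using c(2) unfolding levi_part_def by (intro ext) auto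
    then have "\<beta> = int_comb a I c" using c(1) restr by metis
    moreover have "\<beta> \<in> roots H"
      using c unfolding root_iff_coefficients levi_part_def by blast
    ultimately show "\<beta> \<in> roots_of_subset H a I" by (auto simp: roots_of_subset_def)
  qed
qed

text \<open>Since the simple roots are linearly independent, passing to coefficients is injective and
  respects sums.\<close>

lemma card_ideal_root_sets:
  assumes I: "I \<subseteq> {1..l}"
  shows "card (ideal_root_sets H l a I) = card (ideal_family positive_coefficients I)"
proof -
  let ?F = "int_comb a {1..l}"
  let ?P = "positive_coefficients"
  let ?L = "levi_part ?P I"
  define Z where "Z = {c :: nat \<Rightarrow> int. \<forall>i. i \<notin> {1..l} \<longrightarrow> c i = 0}"
  have PZ: "?P \<subseteq> Z" and LZ: "?L \<subseteq> Z"
    by (auto simp: positive_coefficients_def levi_part_def Z_def)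
  have inj: "inj_on ?F Z" by (rule inj_onI) (rule int_comb_inj, auto simp: Z_def)
  have add: "(\<lambda>x. ?F c x + ?F d x) = ?F (\<lambda>i. c i + d i)" for c d
    by (simp add: int_comb_add)
  have addZ: "(\<lambda>i. c i + d i) \<in> Z" if "c \<in> Z" "d \<in> Z" for c d using that by (simp add: Z_def)
  have memF: "?F c \<in> ?F ` A \<longleftrightarrow> c \<in> A" if "c \<in> Z" "A \<subseteq> Z" for c A
    using inj_on_image_mem_iff[OF inj that] .
  have diff: "?F ` ?P - ?F ` ?L = ?F ` (?P - ?L)"
    using inj_on_image_set_diff[OF inj, of ?P ?L] PZ LZ by blast
  have closed: "?F ` \<Phi> \<in> ideal_root_sets H l a I \<longleftrightarrow> \<Phi> \<in> ideal_family ?P I" if \<Phi>: "\<Phi> \<subseteq> Z" for \<Phi>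
  proof -
    have "?F ` \<Phi> \<subseteq> ?F ` (?P - ?L) \<longleftrightarrow> \<Phi> \<subseteq> ?P - ?L"
      using memF[of _ "?P - ?L"] \<Phi> PZ by blast
    moreover have "(\<forall>\<alpha>\<in>?F ` \<Phi>. \<forall>\<beta>\<in>?F ` ?P \<union> ?F ` ?L. (\<lambda>x. \<alpha> x + \<beta> x) \<in> ?F ` ?P \<longrightarrow> (\<lambda>x. \<alpha> x + \<beta> x) \<in> ?F ` \<Phi>)
      \<longleftrightarrow> (\<forall>\<alpha>\<in>\<Phi>. \<forall>\<beta>\<in>?P \<union> ?L. (\<lambda>i. \<alpha> i + \<beta> i) \<in> ?P \<longrightarrow> (\<lambda>i. \<alpha> i + \<beta> i) \<in> \<Phi>)"
    proof -
      have "(?F (\<lambda>i. c i + d i) \<in> ?F ` ?P \<longrightarrow> ?F (\<lambda>i. c i + d i) \<in> ?F ` \<Phi>) \<longleftrightarrow>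
        ((\<lambda>i. c i + d i) \<in> ?P \<longrightarrow> (\<lambda>i. c i + d i) \<in> \<Phi>)" if "c \<in> \<Phi>" "d \<in> ?P \<union> ?L" for c d
      proof -
        have "(\<lambda>i. c i + d i) \<in> Z" by (rule addZ) (use that \<Phi> PZ LZ in blast)+
        then show ?thesis using memF[OF _ PZ] memF[OF _ \<Phi>] by blast
      qed
      then have "(\<forall>c\<in>\<Phi>. \<forall>d\<in>?P \<union> ?L. ?F (\<lambda>i. c i + d i) \<in> ?F ` ?P \<longrightarrow> ?F (\<lambda>i. c i + d i) \<in> ?F ` \<Phi>)
        \<longleftrightarrow> (\<forall>c\<in>\<Phi>. \<forall>d\<in>?P \<union> ?L. (\<lambda>i. c i + d i) \<in> ?P \<longrightarrow> (\<lambda>i. c i + d i) \<in> \<Phi>)"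
        by (intro ball_cong refl)
      then show ?thesis unfolding image_Un[symmetric] by (simp only: ball_simps(9) add)
    qed
    ultimately show ?thesis
      unfolding ideal_root_sets_def ideal_family_def positive_roots_coefficients
        roots_of_subset_coefficients[OF I] diff by blast
  qed
  have "bij_betw ((`) ?F) (ideal_family ?P I) (ideal_root_sets H l a I)"
  proof (rule bij_betwI')
    fix \<Phi> \<Psi> assume "\<Phi> \<in> ideal_family ?P I" "\<Psi> \<in> ideal_family ?P I"
    then have "\<Phi> \<subseteq> Z" "\<Psi> \<subseteq> Z" using PZ unfolding ideal_family_def by blast+
    then show "?F ` \<Phi> = ?F ` \<Psi> \<longleftrightarrow> \<Phi> = \<Psi>" using inj_on_image_eq_iff[OF inj] by blast
  next
    fix \<Phi> assume \<Phi>: "\<Phi> \<in> ideal_family ?P I"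
    then have "\<Phi> \<subseteq> Z" using PZ unfolding ideal_family_def by blast
    then show "?F ` \<Phi> \<in> ideal_root_sets H l a I" using closed \<Phi> by blast
  next
    fix \<Psi> assume \<Psi>: "\<Psi> \<in> ideal_root_sets H l a I"
    then have "\<Psi> \<subseteq> ?F ` ?P"
      unfolding ideal_root_sets_def positive_roots_coefficients by blast
    then obtain \<Phi> where \<Phi>: "\<Phi> \<subseteq> ?P" "\<Psi> = ?F ` \<Phi>" by (meson subset_imageE)
    then have "\<Phi> \<subseteq> Z" using PZ by blast
    then have "\<Phi> \<in> ideal_family ?P I" using closed \<Psi> \<Phi>(2) by blast
    then show "\<exists>\<Phi>\<in>ideal_family ?P I. \<Psi> = ?F ` \<Phi>" using \<Phi>(2) by blast
  qed
  then show ?thesis by (rule bij_betw_same_card[symmetric])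
qed

end

lemma cartan_matrix_diag: "cartan_matrix X l i i = 2"
  by (cases X) auto

theorem ideal_root_sets_reduction:
  assumes "simple_lie_algebra scale brk" "lie_algebra.cartan_subalgebra scale brk H"
    and "lie_algebra.simple_roots_of_type scale brk H X l a" and I: "I \<subseteq> {1..l}"
  shows "\<exists>P. positive_system X l P \<and>
    card (lie_algebra.ideal_root_sets scale brk H l a I) = card (ideal_family P I)"
proof -
  interpret simple_lie_algebra scale brk by fact
  obtain B wt where "weight_basis scale brk H B wt" using ex_weight_basis[OF assms(2)] by blast
  then interpret weight_basis scale brk H B wt .
  interpret simple_weight_basis scale brk H B wt l a
    using assms(3) by unfold_locales (simp add: simple_roots_of_type_def)
  have "positive_system X l positive_coefficients"
    by (rule positive_coefficients_system)
      (use assms(3) in \<open>auto simp: simple_roots_of_type_def cartan_matrix_diag\<close>)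
  then show ?thesis using card_ideal_root_sets[OF I] by blast
qed

section \<open>Positive systems are determined by the Cartan matrix\<close>

lemma coroot_value_add: "coroot_value X l i (\<lambda>j. c j + d j) = coroot_value X l i c + coroot_value X l i d"
  by (simp add: coroot_value_def distrib_left sum.distrib)

lemma coroot_value_diff: "coroot_value X l i (\<lambda>j. c j - d j) = coroot_value X l i c - coroot_value X l i d"
  by (simp add: coroot_value_def right_diff_distrib sum_subtractf)

lemma coroot_value_unit:
  assumes "i \<in> {1..l}"
  shows "coroot_value X l i (\<lambda>j. k * unit_vec i j) = 2 * k"
proof -
  have "coroot_value X l i (\<lambda>j. k * unit_vec i j) = (\<Sum>j\<in>{1..l}. if j = i then 2 * k else 0)"
    unfolding coroot_value_def unit_vec_def by (intro sum.cong) (auto simp: cartan_matrix_diag)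
  then show ?thesis using assms by simp
qed

lemma simple_reflection_alt:
  "simple_reflection X l i c = (\<lambda>j. c j + (- coroot_value X l i c) * unit_vec i j)"
  by (auto simp: simple_reflection_def unit_vec_def)

lemma coroot_value_simple_reflection:
  assumes "i \<in> {1..l}"
  shows "coroot_value X l i (simple_reflection X l i c) = - coroot_value X l i c"
  unfolding simple_reflection_alt coroot_value_add coroot_value_unit[OF assms] by simp

lemma simple_reflection_involution:
  assumes "i \<in> {1..l}"
  shows "simple_reflection X l i (simple_reflection X l i c) = c"
  using coroot_value_simple_reflection[OF assms, of X c]
  by (auto simp: simple_reflection_def fun_eq_iff)

text \<open>On the chain part of the diagram the coroot values are the second differences of \<open>c\<close>. This and the
  following formulas use \<open>c 0 = 0\<close> to treat the first node like an inner one.\<close>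

lemma coroot_value_A:
  assumes "i \<in> {1..l}" "c 0 = 0" "c (Suc l) = 0"
  shows "coroot_value TypeA l i c = 2 * c i - c (i - 1) - c (i + 1)"
proof -
  have "coroot_value TypeA l i c = (\<Sum>j\<in>{1..l}. (if j = i then 2 * c i else 0)
      + (if j = i - 1 then - c (i - 1) else 0) + (if j = i + 1 then - c (i + 1) else 0))"
    unfolding coroot_value_def using assms(1) by (intro sum.cong refl) auto
  also have "\<dots> = 2 * c i - c (i - 1) - c (i + 1)"
    using assms by (cases "i = 1"; cases "i = l") (auto simp: sum.distrib)
  finally show ?thesis .
qed

lemma coroot_value_B:
  assumes "i \<in> {1..l}" "c 0 = 0" "l \<ge> 2"
  shows "coroot_value TypeB l i c =
    (if i = l then 2 * c l - 2 * c (l - 1) else 2 * c i - c (i - 1) - c (i + 1))"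
proof (cases "i = l")
  case True
  have "coroot_value TypeB l i c = (\<Sum>j\<in>{1..l}. (if j = l then 2 * c l else 0)
      + (if j = l - 1 then - (2 * c (l - 1)) else 0))"
    unfolding coroot_value_def using True assms by (intro sum.cong refl) auto
  then show ?thesis using True assms by (simp add: sum.distrib)
next
  case False
  have "coroot_value TypeB l i c = (\<Sum>j\<in>{1..l}. (if j = i then 2 * c i else 0)
      + (if j = i - 1 then - c (i - 1) else 0) + (if j = i + 1 then - c (i + 1) else 0))"
    unfolding coroot_value_def using False assms by (intro sum.cong refl) auto
  also have "\<dots> = 2 * c i - c (i - 1) - c (i + 1)"
    using False assms by (cases "i = 1") (auto simp: sum.distrib)
  finally show ?thesis using False by simp
qed

lemma coroot_value_C:
  assumes "i \<in> {1..l}" "c 0 = 0" "l \<ge> 2"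
  shows "coroot_value TypeC l i c =
    (if i = l then 2 * c l - c (l - 1)
     else if i + 1 = l then 2 * c i - c (i - 1) - 2 * c l else 2 * c i - c (i - 1) - c (i + 1))"
proof (cases "i = l")
  case True
  have "coroot_value TypeC l i c = (\<Sum>j\<in>{1..l}. (if j = l then 2 * c l else 0)
      + (if j = l - 1 then - c (l - 1) else 0))"
    unfolding coroot_value_def using True assms by (intro sum.cong refl) auto
  then show ?thesis using True assms by (simp add: sum.distrib)
next
  case False
  have "coroot_value TypeC l i c = (\<Sum>j\<in>{1..l}. (if j = i then 2 * c i else 0)
      + (if j = i - 1 then - c (i - 1) else 0)
      + (if j = i + 1 then (if i + 1 = l then - 2 else - 1) * c (i + 1) else 0))"
    unfolding coroot_value_def using False assms by (intro sum.cong refl) auto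
  also have "\<dots> = 2 * c i - c (i - 1) + (if i + 1 = l then - 2 else - 1) * c (i + 1)"
    using False assms by (cases "i = 1") (auto simp: sum.distrib)
  finally show ?thesis using False by auto
qed

lemma coroot_value_D:
  assumes "i \<in> {1..l}" "c 0 = 0" "l \<ge> 4"
  shows "coroot_value TypeD l i c =
    (if i = l \<or> i + 1 = l then 2 * c i - c (l - 2)
     else if i + 2 = l then 2 * c i - c (i - 1) - c (l - 1) - c l
     else 2 * c i - c (i - 1) - c (i + 1))"
proof -
  consider "i = l \<or> i + 1 = l" | "i + 2 = l" | "i + 2 < l" using assms by fastforce
  then show ?thesis
  proof cases
    case 1
    have "coroot_value TypeD l i c = (\<Sum>j\<in>{1..l}. (if j = i then 2 * c i else 0)
        + (if j = l - 2 then - c (l - 2) else 0))"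
      unfolding coroot_value_def
    proof (intro sum.cong refl)
      fix j assume "j \<in> {1..l}"
      then show "cartan_matrix TypeD l i j * c j
          = (if j = i then 2 * c i else 0) + (if j = l - 2 then - c (l - 2) else 0)"
        using 1 assms by (cases "j = i"; cases "j + 2 = l") auto
    qed
    also have "\<dots> = 2 * c i - c (l - 2)"
      unfolding sum.distrib using assms by (simp add: le_diff_conv)
    finally show ?thesis using 1 by simp
  next
    case 2
    obtain n where n: "l = Suc (Suc (Suc n))" using assms(3) that[of "l - 3"] by simp
    have i: "i = Suc n" using 2 n by simp
    have n1: "1 \<le> n" using assms(3) n by simp
    have "coroot_value TypeD l i c = (\<Sum>j\<in>{1..l}. (if j = i then 2 * c i else 0)
        + (if j = n then - c n else 0) + (if j = Suc i then - c (Suc i) else 0)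
        + (if j = l then - c l else 0))"
      unfolding coroot_value_def by (intro sum.cong refl) (simp add: n i)
    also have "\<dots> = 2 * c i - c n - c (Suc i) - c l"
      unfolding sum.distrib using n1 by (simp add: n i)
    finally show ?thesis by (simp add: n i)
  next
    case 3
    have "coroot_value TypeD l i c = (\<Sum>j\<in>{1..l}. (if j = i then 2 * c i else 0)
        + (if j = i - 1 then - c (i - 1) else 0) + (if j = i + 1 then - c (i + 1) else 0))"
      unfolding coroot_value_def
    proof (intro sum.cong refl)
      fix j assume "j \<in> {1..l}"
      then show "cartan_matrix TypeD l i j * c j = (if j = i then 2 * c i else 0)
        + (if j = i - 1 then - c (i - 1) else 0) + (if j = i + 1 then - c (i + 1) else 0)"
        using 3 assms by (cases "j = i"; cases "j + 1 = i"; cases "j = i + 1") auto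
    qed
    also have "\<dots> = 2 * c i - c (i - 1) - c (i + 1)"
      using 3 assms by (cases "i = 1") (auto simp: sum.distrib)
    finally show ?thesis using 3 by simp
  qed
qed

lemma ex_leftmost_max:
  fixes b :: "nat \<Rightarrow> int"
  assumes "l \<ge> 1"
  obtains i where "i \<in> {1..l}" "\<And>j. j \<in> {1..l} \<Longrightarrow> b j \<le> b i"
    "\<And>j. j \<in> {1..l} \<Longrightarrow> j < i \<Longrightarrow> b j < b i"
proof -
  let ?m = "Max (b ` {1..l})"
  let ?Q = "\<lambda>i. i \<in> {1..l} \<and> b i = ?m"
  have "?m \<in> b ` {1..l}" using assms by (intro Max_in) auto
  then have "\<exists>i. ?Q i" by auto
  then have Q: "?Q (LEAST i. ?Q i)" by (rule LeastI_ex)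
  have le: "b j \<le> ?m" if "j \<in> {1..l}" for j using that by (intro Max_ge) auto
  show ?thesis
  proof (rule that[of "LEAST i. ?Q i"])
    fix j assume j: "j \<in> {1..l}" "j < (LEAST i. ?Q i)"
    have "b j \<noteq> ?m" using not_less_Least[OF j(2)] j(1) by blast
    then show "b j < b (LEAST i. ?Q i)" using le[OF j(1)] Q by simp
  qed (use Q le in auto)
qed

text \<open>A discrete maximum principle. After doubling the coefficients \<open>c\<^sub>l\<close> in type C and \<open>c\<^sub>l\<^sub>-\<^sub>1\<close>, \<open>c\<^sub>l\<close> in
  type D, the coroot value at a node is a positive combination of the differences from its neighbours.
  At a leftmost maximum none of these is negative, and the one on the left is positive.\<close>

lemma ex_positive_coroot_value:
  assumes "admissible_rank X l" and c0: "\<And>i. 0 \<le> c i" and supp: "\<And>i. i \<notin> {1..l} \<Longrightarrow> c i = 0"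
    and nz: "\<exists>i. c i \<noteq> 0"
  obtains i where "i \<in> {1..l}" "c i > 0" "coroot_value X l i c > 0"
proof -
  define b where "b i = (if X = TypeC \<and> i = l \<or> X = TypeD \<and> (i = l \<or> i + 1 = l) then 2 * c i else c i)" for i
  have l1: "l \<ge> 1" using assms(1) by (cases X) auto
  obtain i where i: "i \<in> {1..l}" and max: "\<And>j. j \<in> {1..l} \<Longrightarrow> b j \<le> b i"
    and left: "\<And>j. j \<in> {1..l} \<Longrightarrow> j < i \<Longrightarrow> b j < b i"
    using ex_leftmost_max[OF l1] by blast
  have bi: "b i > 0"
  proof -
    obtain j where "c j \<noteq> 0" using nz by blast
    then have "c j > 0" "j \<in> {1..l}" using c0[of j] supp by (force simp: less_le, metis)
    then have "b j > 0" by (simp add: b_def)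
    then show ?thesis using max[OF \<open>j \<in> {1..l}\<close>] by simp
  qed
  then have ci: "c i > 0" by (auto simp: b_def split: if_splits)
  have c00: "c 0 = 0" "c (Suc l) = 0" using supp by auto
  have b0: "b 0 = 0" using c00 by (simp add: b_def)
  have bl: "b (i - 1) < b i" using left[of "i - 1"] i b0 bi by (cases "i = 1") auto
  have br: "b (i + 1) \<le> b i"
    using max[of "i + 1"] i c00 bi by (cases "i = l") (auto simp: b_def)
  have "coroot_value X l i c > 0"
  proof (cases X)
    case TypeA
    then show ?thesis using coroot_value_A[of i l c, OF i c00] bl br by (simp add: b_def)
  next
    case TypeB
    then show ?thesis using coroot_value_B[of i l c, OF i c00(1)] assms(1) bl br by (auto simp: b_def)
  next
    case TypeC
    then show ?thesis using coroot_value_C[of i l c, OF i c00(1)] assms(1) bl br i by (auto simp: b_def split: if_splits)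
  next
    case TypeD
    then have l4: "l \<ge> 4" using assms(1) by simp
    have "b (l - 1) \<le> b i" "b l \<le> b i" using max[of "l - 1"] max[of l] l4 by auto
    moreover have "b (l - 2) < b i" if "i = l \<or> i + 1 = l" using left[of "l - 2"] that l4 by auto
    ultimately show ?thesis
      using coroot_value_D[of i l c, OF i c00(1) l4] TypeD l4 bl br i by (auto simp: b_def split: if_splits)
  qed
  then show ?thesis using that i ci by blast
qed

text \<open>By induction on the height: reflecting at a node with positive coroot value lowers the height,
  and reflecting back takes place inside \<open>Q\<close>, since the lowered vector has a negative coroot
  value and is not a unit vector.\<close>

lemma positive_system_mono:
  assumes X: "admissible_rank X l" and P: "positive_system X l P" and Q: "positive_system X l Q"
  shows "P \<subseteq> Q"
proof
  fix c assume "c \<in> P"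
  then show "c \<in> Q"
  proof (induction "nat (\<Sum>i\<in>{1..l}. c i)" arbitrary: c rule: less_induct)
    case less
    have c: "\<And>i. 0 \<le> c i" "\<And>i. i \<notin> {1..l} \<Longrightarrow> c i = 0" "\<exists>i. c i \<noteq> 0"
      using P less.prems unfolding positive_system_def by blast+
    obtain i where i: "i \<in> {1..l}" "c i > 0" "coroot_value X l i c > 0"
      using ex_positive_coroot_value[OF X c] .
    show ?case
    proof (cases "c = unit_vec i")
      case True
      then show ?thesis using Q i(1) unfolding positive_system_def by blast
    next
      case False
      let ?d = "simple_reflection X l i c"
      have d: "?d \<in> P" using P less.prems i(1) False unfolding positive_system_def by blast
      have "(\<Sum>j\<in>{1..l}. ?d j) < (\<Sum>j\<in>{1..l}. c j)"
        by (rule sum_strict_mono_ex1) (use i in \<open>auto simp: simple_reflection_def\<close>)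
      moreover have "0 \<le> (\<Sum>j\<in>{1..l}. ?d j)"
        using P d unfolding positive_system_def by (intro sum_nonneg) blast
      ultimately have dQ: "?d \<in> Q" using less.hyps[OF _ d] by simp
      have "?d \<noteq> unit_vec i"
      proof
        assume u: "?d = unit_vec i"
        have "coroot_value X l i ?d = 2" using coroot_value_unit[OF i(1), of X 1] u by simp
        then show False using coroot_value_simple_reflection[OF i(1), of X c] i(3) by simp
      qed
      then have "simple_reflection X l i ?d \<in> Q"
        using Q dQ i(1) unfolding positive_system_def by blast
      then show ?thesis using simple_reflection_involution[OF i(1)] by simp
    qed
  qed
qed

lemma positive_system_unique:
  "admissible_rank X l \<Longrightarrow> positive_system X l P \<Longrightarrow> positive_system X l Q \<Longrightarrow> P = Q"
  by (intro antisym positive_system_mono)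

section \<open>The classical positive systems\<close>

text \<open>The number \<open>M\<close> of weights of the natural representation. In type A these are
  \<open>\<epsilon>\<^sub>1, \<dots>, \<epsilon>\<^sub>l\<^sub>+\<^sub>1\<close>, in the other types \<open>\<epsilon>\<^sub>1, \<dots>, \<epsilon>\<^sub>l, - \<epsilon>\<^sub>l, \<dots>, - \<epsilon>\<^sub>1\<close> with a zero in the
  middle in type B; they are placed at the positions \<open>1, \<dots>, M\<close> in this order.\<close>

fun weight_count :: "classical_type \<Rightarrow> nat \<Rightarrow> nat" where
  "weight_count TypeA l = l + 1"
| "weight_count TypeB l = 2 * l + 1"
| "weight_count TypeC l = 2 * l"
| "weight_count TypeD l = 2 * l"

text \<open>Going from position 1 to position \<open>x\<close> passes the steps \<open>1, \<dots>, x - 1\<close>, where step \<open>k\<close> leads from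
  \<open>k\<close> to \<open>k + 1\<close>.\<close>

definition passed :: "nat \<Rightarrow> nat \<Rightarrow> int" where
  "passed k x = of_bool (k < x)"

text \<open>The difference of the weights at the positions 1 and \<open>x\<close>, in terms of the simple roots: step \<open>k\<close>
  subtracts \<open>\<alpha>\<^sub>k\<close>, and so does, apart from type A, the mirror step \<open>M - k\<close>. In type D step \<open>l\<close> leads from \<open>\<epsilon>\<^sub>l\<close> to \<open>- \<epsilon>\<^sub>l\<close> and
  subtracts \<open>2 \<epsilon>\<^sub>l = \<alpha>\<^sub>l - \<alpha>\<^sub>l\<^sub>-\<^sub>1\<close>.\<close>

fun depth_coeff :: "classical_type \<Rightarrow> nat \<Rightarrow> nat \<Rightarrow> nat \<Rightarrow> int" where
  "depth_coeff TypeA l x i = passed i x"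
| "depth_coeff TypeB l x i = passed i x + passed (2 * l + 1 - i) x"
| "depth_coeff TypeC l x i = (if i = l then passed l x else passed i x + passed (2 * l - i) x)"
| "depth_coeff TypeD l x i =
     (if i = l then passed l x
      else if i + 1 = l then passed i x - passed l x + passed (l + 1) x
      else passed i x + passed (2 * l - i) x)"

definition depth :: "classical_type \<Rightarrow> nat \<Rightarrow> nat \<Rightarrow> nat \<Rightarrow> int" where
  "depth X l x i = (if i \<in> {1..l} then depth_coeff X l x i else 0)"

text \<open>The coefficients of the weight at \<open>x\<close> minus the weight at \<open>y\<close>.\<close>

definition root_vec :: "classical_type \<Rightarrow> nat \<Rightarrow> nat \<Rightarrow> nat \<Rightarrow> nat \<Rightarrow> int" where
  "root_vec X l x y = (\<lambda>i. depth X l y i - depth X l x i)"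

text \<open>Mirror positions carry the weights \<open>\<epsilon>\<^sub>p\<close> and \<open>- \<epsilon>\<^sub>p\<close>; their difference is a root only in type C.\<close>

definition valid_pair :: "classical_type \<Rightarrow> nat \<Rightarrow> nat \<Rightarrow> nat \<Rightarrow> bool" where
  "valid_pair X l x y \<longleftrightarrow> 1 \<le> x \<and> x < y \<and> y \<le> weight_count X l \<and>
     (X = TypeB \<or> X = TypeD \<longrightarrow> x + y \<noteq> weight_count X l + 1)"

definition classical_positive :: "classical_type \<Rightarrow> nat \<Rightarrow> (nat \<Rightarrow> int) set" where
  "classical_positive X l = {root_vec X l x y |x y. valid_pair X l x y}"

definition adj_swap :: "nat \<Rightarrow> nat \<Rightarrow> nat" where
  "adj_swap i x = (if x = i then i + 1 else if x = i + 1 then i else x)"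

text \<open>Interchanging two neighbours only affects the step between them, and by the same second
  difference as in the formulas for the coroot values.\<close>

lemma passed_adj_swap:
  "1 \<le> i \<Longrightarrow> passed k (adj_swap i x)
    = (if k = i then passed (i - 1) x + passed (i + 1) x - passed i x else passed k x)"
  by (auto simp: passed_def adj_swap_def of_bool_def)

text \<open>The action of a simple reflection on the weights. At \<open>i = l\<close> it interchanges the positions \<open>l\<close> and
  \<open>l + 2\<close> in type B, and in type D \<open>l - 1\<close> with \<open>l + 1\<close> and \<open>l\<close> with \<open>l + 2\<close>. Writing everything as
  a product of neighbour interchanges reduces all cases to the effect of one.\<close>

definition weight_reflection :: "classical_type \<Rightarrow> nat \<Rightarrow> nat \<Rightarrow> nat \<Rightarrow> nat" where
  "weight_reflection X l i =
     (if X = TypeA \<or> X = TypeC \<and> i = l then adj_swap i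
      else if X = TypeB \<and> i = l then adj_swap l \<circ> adj_swap (l + 1) \<circ> adj_swap l
      else if X = TypeD \<and> i = l then adj_swap l \<circ> adj_swap (l - 1) \<circ> adj_swap (l + 1) \<circ> adj_swap l
      else adj_swap (weight_count X l - i) \<circ> adj_swap i)"

lemma depth_eq:
  assumes "admissible_rank X l" "1 \<le> x" "x \<le> weight_count X l" "k \<le> l"
  shows "depth X l x k = depth_coeff X l x k - of_bool (k = 0)"
  using assms by (cases X; cases "k = 0") (auto simp: depth_def passed_def)

text \<open>Reflecting a weight changes its distance from the first weight by the reflection formula,
  except that the first reflection also moves the first weight itself; this is the additional 1
  for \<open>i = 1\<close>. It cancels in differences.\<close>

lemma depth_weight_reflection:
  assumes "admissible_rank X l" "i \<in> {1..l}" "1 \<le> x" "x \<le> weight_count X l"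
  shows "depth X l (weight_reflection X l i x)
    = (\<lambda>j. depth X l x j + (of_bool (i = 1) - coroot_value X l i (depth X l x)) * unit_vec i j)"
proof (rule ext)
  fix j
  have i: "1 \<le> i" "i \<le> l" using assms(2) by auto
  have d0: "depth X l x 0 = 0" "depth X l x (Suc l) = 0" by (auto simp: depth_def)
  have d: "depth X l x k = depth_coeff X l x k - of_bool (k = 0)" if "k \<le> l" for k
    by (rule depth_eq) (use assms that in auto)
  let ?\<sigma> = "weight_reflection X l i"
  show "depth X l (?\<sigma> x) j
    = depth X l x j + (of_bool (i = 1) - coroot_value X l i (depth X l x)) * unit_vec i j"
  proof (cases "j \<in> {1..l}")
    case False
    then show ?thesis using assms(2) by (auto simp: depth_def unit_vec_def)
  next
    case j: True
    then have j': "1 \<le> j" "j \<le> l" by auto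
    have lhs: "depth X l (?\<sigma> x) j = depth_coeff X l (?\<sigma> x) j" using j by (simp add: depth_def)
    show ?thesis
    proof (cases "j = i")
      case False
      have "depth_coeff X l (?\<sigma> x) j = depth_coeff X l x j"
      proof (cases "X = TypeA \<or> i = l")
        case True
        then show ?thesis
        proof (cases X)
          case TypeD
          then have "i = l" "l \<ge> 4" using True assms(1) by auto
          show ?thesis
          proof (cases "j + 1 = l")
            case True
            then have "l = Suc j" by simp
            then show ?thesis
              using TypeD j' \<open>i = l\<close> by (simp add: weight_reflection_def passed_adj_swap)
          next
            case ne: False
            then have "j \<noteq> l - 1" "2 * l - j \<noteq> l + 1" "2 * l - j \<noteq> l - 1" "2 * l - j \<noteq> l" "j \<noteq> l + 1"
              using j' False \<open>i = l\<close> by auto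
            then show ?thesis
              using TypeD j' False ne \<open>i = l\<close> \<open>l \<ge> 4\<close> by (simp add: weight_reflection_def passed_adj_swap)
          qed
        qed (use True i j' False assms(1) in \<open>auto simp: weight_reflection_def passed_adj_swap\<close>)
      next
        case c: False
        let ?M = "weight_count X l"
        have il: "i < l" using i c by simp
        have M: "?M = 2 * l \<or> ?M = 2 * l + 1" using c by (cases X) auto
        have inv: "passed m (?\<sigma> x) = passed m x" if "m \<noteq> i" "m \<noteq> ?M - i" for m
          using c that i il M by (auto simp: weight_reflection_def passed_adj_swap)
        have "passed j (?\<sigma> x) = passed j x"
          by (rule inv) (use False M il j' in auto)
        moreover have "passed (?M - j) (?\<sigma> x) = passed (?M - j) x"
          by (rule inv) (use False M il j' in auto)
        moreover have "passed l (?\<sigma> x) = passed l x"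
          by (rule inv) (use M il in auto)
        moreover have "passed (l + 1) (?\<sigma> x) = passed (l + 1) x" if "X = TypeD" "j + 1 = l"
          by (rule inv) (use that il False in auto)
        ultimately show ?thesis using c by (cases X) auto
      qed
      then show ?thesis using lhs d[of j] j' False by (simp add: unit_vec_def)
    next
      case True
      have "depth_coeff X l (?\<sigma> x) i
        = depth_coeff X l x i + (of_bool (i = 1) - coroot_value X l i (depth X l x))"
      proof (cases "X = TypeA \<or> i = l")
        case True
        show ?thesis
        proof (cases X)
          case TypeA
          have "passed (l + 1) x = 0" using assms(4) TypeA by (simp add: passed_def)
          then show ?thesis
            using i d[of i] d[of "i - 1"] d[of "i + 1"] d0
            unfolding TypeA coroot_value_A[of i l "depth X l x", unfolded TypeA, OF assms(2) d0[unfolded TypeA]]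
            by (cases "i = l") (auto simp: weight_reflection_def passed_adj_swap)
        next
          case TypeB
          then obtain m where m: "i = l" "l = Suc m" "m \<ge> 1" using True assms(1) that[of "l - 1"] by auto
          have l: "l \<ge> 2" using m by simp
          have "depth TypeB l x m = passed m x + passed (Suc (Suc (Suc m))) x" "depth TypeB l x l = passed l x + passed (l + 1) x"
            using d[of m] d[of l] m TypeB by (auto simp: eval_nat_numeral)
          then show ?thesis using m
            unfolding TypeB coroot_value_B[of i l "depth X l x", unfolded TypeB, OF assms(2) d0(1)[unfolded TypeB] l]
            by (simp add: weight_reflection_def passed_adj_swap)
        next
          case TypeC
          then obtain m where m: "i = l" "l = Suc m" "m \<ge> 1" using True assms(1) that[of "l - 1"] by auto
          have l: "l \<ge> 2" using m by simp
          have "depth TypeC l x m = passed m x + passed (m + 2) x" "depth TypeC l x l = passed l x"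
            using d[of m] d[of l] m TypeC by auto
          then show ?thesis using m
            unfolding TypeC coroot_value_C[of i l "depth X l x", unfolded TypeC, OF assms(2) d0(1)[unfolded TypeC] l]
            by (simp add: weight_reflection_def passed_adj_swap)
        next
          case TypeD
          then obtain m where m: "i = l" "l = Suc (Suc m)" "m \<ge> 2" using True assms(1) that[of "l - 2"] by auto
          have l: "l \<ge> 4" using m by simp
          have "depth TypeD l x m = passed m x + passed (Suc (Suc (Suc (Suc m)))) x" "depth TypeD l x l = passed l x"
            using d[of m] d[of l] m TypeD by (auto simp: eval_nat_numeral)
          then show ?thesis using m
            unfolding TypeD coroot_value_D[of i l "depth X l x", unfolded TypeD, OF assms(2) d0(1)[unfolded TypeD] l]
            by (simp add: weight_reflection_def passed_adj_swap)
        qed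
      next
        case c: False
        have il: "i < l" using i c by simp
        define p where "p = weight_count X l - i"
        have M: "weight_count X l = 2 * l \<or> weight_count X l = 2 * l + 1" using c by (cases X) auto
        have pl: "l < p" "p - 1 + 1 = p" "p - 1 \<noteq> i" "p \<noteq> i" "p + 1 \<noteq> i" "1 \<le> p"
          using M il by (auto simp: p_def)
        have \<sigma>: "?\<sigma> x = adj_swap p (adj_swap i x)" using c by (simp add: weight_reflection_def p_def)
        have s1: "passed i (?\<sigma> x) = passed (i - 1) x + passed (i + 1) x - passed i x"
          unfolding \<sigma> using i pl by (simp add: passed_adj_swap)
        have s2: "passed p (?\<sigma> x) = passed (p - 1) x + passed (p + 1) x - passed p x"
          unfolding \<sigma> using i pl by (simp add: passed_adj_swap)
        have s3: "passed l (?\<sigma> x) = passed l x"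
          unfolding \<sigma> using i il pl by (simp add: passed_adj_swap)
        have dp: "depth X l x (i - 1) = passed (i - 1) x + passed (p + 1) x - of_bool (i = 1)"
        proof -
          obtain k where k: "i = Suc k" using i by (cases i) auto
          have "depth_coeff X l x k = passed k x + passed (weight_count X l - k) x"
            using c k il by (cases X) simp_all
          moreover have "weight_count X l - k = p + 1" using M k il by (auto simp: p_def)
          ultimately show ?thesis using d[of k] k il by simp
        qed
        show ?thesis
        proof (cases X)
          case TypeB
          have l: "l \<ge> 2" using assms TypeB by simp
          have "depth TypeB l x i = passed i x + passed p x"
            "depth TypeB l x (i + 1) = passed (i + 1) x + passed (p - 1) x"
            using d[of i] d[of "i + 1"] i il TypeB by (auto simp: p_def)
          then show ?thesis using s1 s2 dp il
            unfolding TypeB coroot_value_B[of i l "depth X l x", unfolded TypeB, OF assms(2) d0(1)[unfolded TypeB] l]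
            by (simp add: p_def TypeB)
        next
          case TypeC
          have l: "l \<ge> 2" using assms TypeC by simp
          have "depth TypeC l x i = passed i x + passed p x"
            using d[of i] i il TypeC by (auto simp: p_def)
          moreover have "i + 1 = l \<Longrightarrow> p - 1 = l" using TypeC by (auto simp: p_def)
          moreover have "i + 1 < l \<Longrightarrow> depth TypeC l x (i + 1) = passed (i + 1) x + passed (p - 1) x"
            "depth TypeC l x l = passed l x"
            using d[of l] d[of "i + 1"] i il TypeC by (auto simp: p_def)
          ultimately show ?thesis using s1 s2 dp il
            unfolding TypeC coroot_value_C[of i l "depth X l x", unfolded TypeC, OF assms(2) d0(1)[unfolded TypeC] l]
            by (cases "i + 1 = l") (simp_all add: p_def TypeC)
        next
          case TypeD
          have l: "l \<ge> 4" using assms TypeD by simp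
          note cv = coroot_value_D[of i l "depth X l x", unfolded TypeD, OF assms(2) d0(1)[unfolded TypeD] l]
          have dl: "depth TypeD l x l = passed l x" using d[of l] l TypeD by simp
          show ?thesis
          proof (cases "i + 1 = l")
            case True
            then have ps: "p = l + 1" "l - 2 = i - 1" "p - 1 = l" using i TypeD by (auto simp: p_def)
            have "depth TypeD l x i = passed i x - passed l x + passed p x"
              using d[of i] i il True ps TypeD by auto
            then show ?thesis using s1 s2 s3 dp il True ps unfolding TypeD cv by simp
          next
            case ne: False
            have di: "depth TypeD l x i = passed i x + passed p x"
              using d[of i] i il ne TypeD by (auto simp: p_def)
            have co: "depth_coeff TypeD l z i = passed i z + passed p z" for z
              using ne il TypeD by (simp add: p_def)
            show ?thesis
            proof (cases "i + 2 = l")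
              case True
              then have ps: "l - 1 = i + 1" "p - 1 = l + 1" using TypeD by (auto simp: p_def)
              have "depth TypeD l x (l - 1) = passed (i + 1) x - passed l x + passed (p - 1) x"
                using d[of "l - 1"] l TypeD ps by auto
              then show ?thesis using s1 s2 dp dl di il ne True TypeD unfolding TypeD cv co by simp
            next
              case False
              have "depth TypeD l x (i + 1) = passed (i + 1) x + passed (p - 1) x"
                using d[of "i + 1"] i il ne False TypeD by (auto simp: p_def)
              then show ?thesis using s1 s2 dp di il ne False TypeD unfolding TypeD cv co by simp
            qed
          qed
        qed (use c in simp)
      qed
      then show ?thesis using lhs d[of i] i True by (simp add: unit_vec_def)
    qed
  qed
qed

lemma root_vec_reflection:
  assumes "admissible_rank X l" "i \<in> {1..l}" "1 \<le> x" "x \<le> weight_count X l"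
    "1 \<le> y" "y \<le> weight_count X l"
  shows "root_vec X l (weight_reflection X l i x) (weight_reflection X l i y)
    = simple_reflection X l i (root_vec X l x y)"
  unfolding root_vec_def simple_reflection_alt coroot_value_diff
    depth_weight_reflection[OF assms(1-4)] depth_weight_reflection[OF assms(1,2,5,6)]
  by (auto simp: algebra_simps)

text \<open>The pairs \<open>x < y\<close> whose order is reversed by the reflection; they all represent \<open>\<alpha>\<^sub>i\<close>.\<close>

definition inverted_pair :: "classical_type \<Rightarrow> nat \<Rightarrow> nat \<Rightarrow> nat \<Rightarrow> nat \<Rightarrow> bool" where
  "inverted_pair X l i x y \<longleftrightarrow>
    (if X = TypeD \<and> i = l then (x + 1 = l \<and> y = l + 1) \<or> (x = l \<and> y = l + 2)
     else y = x + 1 \<and> (x = i \<or> X \<noteq> TypeA \<and> x + i = weight_count X l))"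

lemma passed_Suc: "passed k (Suc x) = passed k x + of_bool (k = x)"
  by (auto simp: passed_def)

lemma root_vec_inverted_pair:
  assumes "admissible_rank X l" "i \<in> {1..l}" "inverted_pair X l i x y"
  shows "root_vec X l x y = unit_vec i"
proof (rule ext)
  fix j
  have i: "1 \<le> i" "i \<le> l" using assms(2) by auto
  have "depth_coeff X l y j - depth_coeff X l x j = of_bool (j = i)" if j: "1 \<le> j" "j \<le> l"
  proof (cases "X = TypeD \<and> i = l")
    case True
    then consider "l = Suc x" "y = Suc (Suc x)" | "x = l" "y = Suc (Suc l)"
      using assms(3) by (auto simp: inverted_pair_def)
    then show ?thesis
    proof cases
      case 1
      then show ?thesis using True j assms(1) by (auto simp: passed_Suc)
    next
      case 2
      have "2 * l - j = Suc l \<longleftrightarrow> j + 1 = l" "2 * l - j = l \<longleftrightarrow> j = l" using j by auto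
      then show ?thesis using 2 True j by (auto simp: passed_Suc)
    qed
  next
    case False
    then have y: "y = Suc x" and x: "x = i \<or> X \<noteq> TypeA \<and> x + i = weight_count X l"
      using assms(3) by (auto simp: inverted_pair_def)
    have d: "2 * l - j = x \<longleftrightarrow> x + j = 2 * l" "2 * l + 1 - j = x \<longleftrightarrow> x + j = 2 * l + 1"
      using j by auto
    show ?thesis using x j i False unfolding y
      by (cases X) (auto simp: passed_Suc d)
  qed
  then show "root_vec X l x y j = unit_vec i j"
    using i by (auto simp: root_vec_def depth_def unit_vec_def)
qed

lemma adj_swap_less: "x < y \<Longrightarrow> \<not> (x = i \<and> y = i + 1) \<Longrightarrow> adj_swap i x < adj_swap i y"
  by (auto simp: adj_swap_def)

lemma adj_swap_bounds: "1 \<le> x \<Longrightarrow> x \<le> M \<Longrightarrow> 1 \<le> i \<Longrightarrow> i < M \<Longrightarrow> 1 \<le> adj_swap i x \<and> adj_swap i x \<le> M"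
  by (auto simp: adj_swap_def)

lemma adj_swap_lower: "Suc 0 \<le> x \<Longrightarrow> Suc 0 \<le> i \<Longrightarrow> Suc 0 \<le> adj_swap i x"
  by (auto simp: adj_swap_def)

lemma adj_swap_upper: "x \<le> M \<Longrightarrow> i < M \<Longrightarrow> adj_swap i x \<le> M"
  by (auto simp: adj_swap_def)

lemma adj_swap_eq_iff: "adj_swap i x = adj_swap i y \<longleftrightarrow> x = y"
  by (auto simp: adj_swap_def)

lemma adj_swap_other: "x \<noteq> i \<Longrightarrow> x \<noteq> i + 1 \<Longrightarrow> adj_swap i x = x" "adj_swap i i = i + 1" "adj_swap i (i + 1) = i"
  by (auto simp: adj_swap_def)

lemma adj_swap_adj_swap [simp]: "adj_swap i (adj_swap i x) = x"
  by (auto simp: adj_swap_def)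

text \<open>The values of the two composed reflections at \<open>i = l\<close>, in types B and D.\<close>

lemma adj_swap_triple: "adj_swap l (adj_swap (Suc l) (adj_swap l z)) = (if z = l then l + 2 else if z = l + 2 then l else z)"
  by (auto simp: adj_swap_def)

lemma adj_swap_quadruple: "adj_swap (Suc m) (adj_swap m (adj_swap (Suc (Suc m)) (adj_swap (Suc m) z))) =
  (if z = m then m + 2 else if z = m + 2 then m else if z = m + 1 then m + 3
   else if z = m + 3 then m + 1 else z)"
  by (auto simp: adj_swap_def)

lemma adj_swap_mirror: "x \<le> M + 1 \<Longrightarrow> 1 \<le> i \<Longrightarrow> i < M \<Longrightarrow> adj_swap i (M + 1 - x) = M + 1 - adj_swap (M - i) x"
  by (auto simp: adj_swap_def)

lemma adj_swap_commute: "i + 1 < k \<or> k + 1 < i \<or> i = k \<Longrightarrow> adj_swap i (adj_swap k x) = adj_swap k (adj_swap i x)"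
  by (auto simp: adj_swap_def)

text \<open>The reflection commutes with the mirror, so mirror pairs stay apart, and the order of \<open>x\<close> and \<open>y\<close>
  can only be reversed when they are neighbours in one of the interchanges.\<close>

lemma valid_pair_weight_reflection:
  assumes X: "admissible_rank X l" and "i \<in> {1..l}" and v: "valid_pair X l x y" and "\<not> inverted_pair X l i x y"
  shows "valid_pair X l (weight_reflection X l i x) (weight_reflection X l i y)"
proof -
  let ?M = "weight_count X l" and ?\<sigma> = "weight_reflection X l i"
  have i: "1 \<le> i" "i \<le> l" using assms(2) by auto
  have xy: "1 \<le> x" "x < y" "y \<le> ?M" and mir: "X = TypeB \<or> X = TypeD \<Longrightarrow> x + y \<noteq> ?M + 1"
    using v by (auto simp: valid_pair_def)
  have bounds: "1 \<le> ?\<sigma> z \<and> ?\<sigma> z \<le> ?M" if "1 \<le> z" "z \<le> ?M" for z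
    using that i X by (cases X) (auto simp: weight_reflection_def intro!: adj_swap_lower adj_swap_upper)
  have mirror: "?\<sigma> (?M + 1 - z) = ?M + 1 - ?\<sigma> z" if z: "1 \<le> z" "z \<le> ?M" and XBD: "X = TypeB \<or> X = TypeD" for z
  proof (cases "i = l")
    case False
    have b1: "adj_swap (?M - i) z \<le> ?M"
      using adj_swap_bounds[OF z, of "?M - i"] i XBD False by (cases X) simp_all
    have "adj_swap (?M - i) (adj_swap i (?M + 1 - z)) = adj_swap (?M - i) (?M + 1 - adj_swap (?M - i) z)"
      by (subst adj_swap_mirror) (use z i XBD False in auto)
    also have "\<dots> = ?M + 1 - adj_swap (?M - (?M - i)) (adj_swap (?M - i) z)"
      by (subst adj_swap_mirror) (use b1 i XBD False in auto)
    also have "\<dots> = ?M + 1 - adj_swap (?M - i) (adj_swap i z)"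
    proof -
      have "i + 1 < ?M - i" "?M - (?M - i) = i" using i XBD False by auto
      then show ?thesis using adj_swap_commute[of i "?M - i" z] by simp
    qed
    finally show ?thesis using False XBD by (auto simp: weight_reflection_def)
  next
    case True
    from XBD show ?thesis
    proof
      assume B: "X = TypeB"
      then have "z < l \<or> z = l \<or> z = l + 1 \<or> z = l + 2 \<or> l + 2 < z \<and> z \<le> 2 * l + 1" using z by auto
      then show ?thesis using True B i by (auto simp: weight_reflection_def adj_swap_triple)
    next
      assume D: "X = TypeD"
      then obtain m where m: "l = Suc m" "m \<ge> 3" using X that[of "l - 1"] by auto
      have "z < m \<or> z = m \<or> z = m + 1 \<or> z = m + 2 \<or> z = m + 3 \<or> m + 3 < z \<and> z \<le> 2 * m + 2"
        using z D m by auto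
      then show ?thesis using True D m by (auto simp: weight_reflection_def adj_swap_quadruple)
    qed
  qed
  have "?\<sigma> x < ?\<sigma> y"
  proof (cases "X = TypeA \<or> i = l")
    case False
    have "adj_swap i x < adj_swap i y"
      by (rule adj_swap_less) (use xy assms(4) False in \<open>auto simp: inverted_pair_def\<close>)
    moreover have "\<not> (adj_swap i x = ?M - i \<and> adj_swap i y = ?M - i + 1)"
    proof
      assume a: "adj_swap i x = ?M - i \<and> adj_swap i y = ?M - i + 1"
      have ne: "?M - i \<noteq> i" "?M - i \<noteq> i + 1" "?M - i + 1 \<noteq> i" "?M - i + 1 \<noteq> i + 1"
        using False i by (cases X; auto)+
      have "x = adj_swap i (?M - i)" "y = adj_swap i (?M - i + 1)" using a adj_swap_adj_swap by metis+
      then have "x = ?M - i" "y = ?M - i + 1" using ne adj_swap_other(1) by metis+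
      then show False using assms(4) False i by (cases X) (auto simp: inverted_pair_def)
    qed
    ultimately have "adj_swap (?M - i) (adj_swap i x) < adj_swap (?M - i) (adj_swap i y)" by (rule adj_swap_less)
    then show ?thesis using False by (auto simp: weight_reflection_def)
  next
    case True
    show ?thesis
    proof (cases X)
      case TypeB
      then have e: "?\<sigma> z = (if z = l then l + 2 else if z = l + 2 then l else z)" for z
        using True by (simp add: weight_reflection_def adj_swap_triple)
      have "\<not> (x = l \<and> y = l + 1)" "\<not> (x = l + 1 \<and> y = l + 2)" "\<not> (x = l \<and> y = l + 2)"
        using TypeB True mir assms(4) by (auto simp: inverted_pair_def)
      then show ?thesis using xy unfolding e by auto
    next
      case TypeD
      then obtain m where m: "l = Suc m" "m \<ge> 3" using X that[of "l - 1"] by auto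
      then have e: "?\<sigma> z = (if z = m then m + 2 else if z = m + 2 then m else if z = m + 1 then m + 3
          else if z = m + 3 then m + 1 else z)" for z
        using True TypeD by (simp add: weight_reflection_def adj_swap_quadruple)
      have "\<not> (x = m \<and> y = m + 2)" "\<not> (x = m + 1 \<and> y = m + 3)" "\<not> (x = m \<and> y = m + 3)"
        "\<not> (x = m + 1 \<and> y = m + 2)"
        using TypeD True mir assms(4) m by (auto simp: inverted_pair_def)
      then show ?thesis using xy unfolding e by auto
    qed (use True xy assms(4) in \<open>auto simp: weight_reflection_def inverted_pair_def intro!: adj_swap_less\<close>)
  qed
  moreover have "?\<sigma> x + ?\<sigma> y \<noteq> ?M + 1" if XBD: "X = TypeB \<or> X = TypeD"
  proof
    assume s: "?\<sigma> x + ?\<sigma> y = ?M + 1"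
    then have "?\<sigma> y = ?\<sigma> (?M + 1 - x)" using mirror[of x] xy XBD by simp
    then have "y = ?M + 1 - x" by (auto simp: weight_reflection_def adj_swap_eq_iff split: if_splits)
    then show False using mir XBD xy by simp
  qed
  ultimately show ?thesis using bounds[of x] bounds[of y] xy by (auto simp: valid_pair_def)
qed

lemma passed_diff: "x \<le> y \<Longrightarrow> passed k y - passed k x = of_bool (x \<le> k \<and> k < y)"
  by (auto simp: passed_def)

lemma passed_mono: "x \<le> y \<Longrightarrow> passed k x \<le> passed k y"
  by (auto simp: passed_def)

text \<open>The only negative contribution is that of step \<open>l\<close> to the coefficient of \<open>\<alpha>\<^sub>l\<^sub>-\<^sub>1\<close> in type D. A pair
  that passes it also passes one of the steps \<open>l - 1\<close>, \<open>l + 1\<close>, unless it is the mirror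
  pair \<open>(l, l + 1)\<close>.\<close>

lemma root_vec_nonneg:
  assumes "valid_pair X l x y" shows "0 \<le> root_vec X l x y i"
proof -
  have xy: "x \<le> y" using assms by (simp add: valid_pair_def)
  note mono = passed_mono[OF xy]
  have "depth_coeff X l x i \<le> depth_coeff X l y i"
  proof (cases X)
    case TypeD
    have "\<not> (x = l \<and> y = l + 1)" using assms TypeD by (auto simp: valid_pair_def)
    then have "passed i x - passed l x + passed (l + 1) x \<le> passed i y - passed l y + passed (l + 1) y"
      if "l = Suc i" unfolding that passed_def using xy by auto
    then show ?thesis using TypeD mono[of i] mono[of l] mono[of "2 * l - i"] by (cases "l = Suc i") auto
  qed (use mono[of i] mono[of "2 * l + 1 - i"] mono[of "2 * l - i"] mono[of l] in auto)
  then show ?thesis by (simp add: root_vec_def depth_def)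
qed

text \<open>In the left half the first step of the pair, in the right half the last one contributes to a
  coefficient without cancellation. In type D a pair across the centre is detected by the coefficient
  of \<open>\<alpha>\<^sub>l\<close>.\<close>

lemma root_vec_nonzero:
  assumes "admissible_rank X l" "valid_pair X l x y"
  shows "\<exists>i. root_vec X l x y i \<noteq> 0"
proof -
  have xy: "1 \<le> x" "x < y" "y \<le> weight_count X l" using assms(2) by (auto simp: valid_pair_def)
  have mono: "0 \<le> passed k y - passed k x" for k using passed_mono[of x y] xy by simp
  have pos: "passed k y - passed k x = 1" if "x \<le> k" "k < y" for k using passed_diff[of x y k] xy that by simp
  have root: "root_vec X l x y i = depth_coeff X l y i - depth_coeff X l x i" if "1 \<le> i" "i \<le> l" for i
    using that by (simp add: root_vec_def depth_def)
  have low: "0 < passed x y - passed x x" using pos[of x] xy by simp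
  have high: "passed (y - 1) y - passed (y - 1) x = 1" using pos[of "y - 1"] xy by simp
  show ?thesis
  proof (cases X)
    case TypeA
    then have "root_vec X l x y x > 0" using low root[of x] xy by simp
    then show ?thesis by (metis less_irrefl)
  next
    case TypeB
    show ?thesis
    proof (cases "x \<le> l")
      case True
      then have "root_vec X l x y x > 0" using low root[of x] xy mono[of "2 * l + 1 - x"] TypeB by simp
      then show ?thesis by (metis less_irrefl)
    next
      case False
      let ?i = "2 * l + 2 - y"
      have i: "1 \<le> ?i" "?i \<le> l" "2 * l + 1 - ?i = y - 1" using xy False TypeB by auto
      have "root_vec X l x y ?i > 0"
        unfolding root[OF i(1,2)] using TypeB high mono[of ?i] i(3) by simp
      then show ?thesis by (metis less_irrefl)
    qed
  next
    case TypeC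
    show ?thesis
    proof (cases "x \<le> l")
      case True
      then have "root_vec X l x y x > 0" using low root[of x] xy mono[of "2 * l - x"] TypeC by (cases "x = l") simp_all
      then show ?thesis by (metis less_irrefl)
    next
      case False
      let ?i = "2 * l + 1 - y"
      have i: "1 \<le> ?i" "?i \<le> l" "?i \<noteq> l" "2 * l - ?i = y - 1" using xy False TypeC by auto
      have "root_vec X l x y ?i > 0"
        unfolding root[OF i(1,2)] using TypeC high mono[of ?i] i(3,4) by simp
      then show ?thesis by (metis less_irrefl)
    qed
  next
    case TypeD
    have l: "l \<ge> 4" and ne: "x + y \<noteq> 2 * l + 1" and y: "y \<le> 2 * l"
      using assms TypeD by (auto simp: valid_pair_def)
    consider "x + 1 < l" | "l = Suc x" "y = l" | "x \<le> l" "l < y" | "x = l + 1" "y = l + 2" | "l < x" "l + 2 < y"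
      using xy ne by linarith
    then show ?thesis
    proof cases
      case 1
      then have "root_vec X l x y x > 0" using low root[of x] xy mono[of "2 * l - x"] TypeD by simp
      then show ?thesis by (metis less_irrefl)
    next
      case 2
      then have "root_vec X l x y x = 1" using root[of x] xy TypeD by (simp add: passed_def)
      then show ?thesis by (metis zero_neq_one)
    next
      case 3
      then have "root_vec X l x y l = 1" using root[of l] l TypeD pos[of l] by simp
      then show ?thesis by (metis zero_neq_one)
    next
      case 4
      obtain k where k: "l = Suc k" "k \<ge> 1" using l that[of "l - 1"] by auto
      have "root_vec X l x y k = 1" using root[of k] k TypeD 4 by (simp add: passed_def)
      then show ?thesis by (metis zero_neq_one)
    next
      case 5
      let ?i = "2 * l + 1 - y"
      have i: "1 \<le> ?i" "?i \<le> l" "?i \<noteq> l" "?i + 1 \<noteq> l" "2 * l - ?i = y - 1" using y 5 by auto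
      have "root_vec X l x y ?i > 0"
        unfolding root[OF i(1,2)] using TypeD high mono[of ?i] i(3-5) by simp
      then show ?thesis by (metis less_irrefl)
    qed
  qed
qed

text \<open>A pair that does not represent \<open>\<alpha>\<^sub>i\<close> is not inverted by the \<open>i\<close>-th reflection, so its image is
  again an ordered pair.\<close>

theorem classical_positive_system:
  assumes X: "admissible_rank X l"
  shows "positive_system X l (classical_positive X l)"
  unfolding positive_system_def
proof (intro conjI ballI allI impI)
  fix i assume i: "i \<in> {1..l}"
  let ?x = "if X = TypeD \<and> i = l then l - 1 else i"
  let ?y = "i + 1"
  have i': "1 \<le> i" "i \<le> l" using i by auto
  have "inverted_pair X l i ?x ?y" using i' by (simp add: inverted_pair_def)
  then have "unit_vec i = root_vec X l ?x ?y"
    by (rule root_vec_inverted_pair[OF X i, symmetric])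
  moreover have "valid_pair X l ?x ?y"
  proof (cases X)
    case TypeD
    then show ?thesis using i' X by (cases "i = l") (auto simp: valid_pair_def)
  qed (use i' X in \<open>simp_all add: valid_pair_def\<close>)
  ultimately show "unit_vec i \<in> classical_positive X l"
    unfolding classical_positive_def by blast
next
  fix i c assume i: "i \<in> {1..l}" and c: "c \<in> classical_positive X l" "c \<noteq> unit_vec i"
  then obtain x y where xy: "valid_pair X l x y" "c = root_vec X l x y"
    by (auto simp: classical_positive_def)
  then have "\<not> inverted_pair X l i x y" using root_vec_inverted_pair[OF X i] c(2) by blast
  then have "valid_pair X l (weight_reflection X l i x) (weight_reflection X l i y)"
    using valid_pair_weight_reflection[OF X i] xy by blast
  moreover have "simple_reflection X l i c
    = root_vec X l (weight_reflection X l i x) (weight_reflection X l i y)"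
    using root_vec_reflection[OF X i, of x y] xy by (auto simp: valid_pair_def)
  ultimately show "simple_reflection X l i c \<in> classical_positive X l"
    unfolding classical_positive_def by blast
qed (use root_vec_nonneg root_vec_nonzero[OF X] in
    \<open>auto simp: classical_positive_def root_vec_def depth_def passed_def\<close>)

theorem card_ideal_root_sets_classical:
  assumes "simple_lie_algebra scale brk" "lie_algebra.cartan_subalgebra scale brk H"
    and "lie_algebra.simple_roots_of_type scale brk H X l a" and "I \<subseteq> {1..l}"
  shows "card (lie_algebra.ideal_root_sets scale brk H l a I)
    = card (ideal_family (classical_positive X l) I)"
proof -
  obtain P where P: "positive_system X l P"
    "card (lie_algebra.ideal_root_sets scale brk H l a I) = card (ideal_family P I)"
    using ideal_root_sets_reduction[OF assms] by blast
  interpret simple_lie_algebra scale brk by fact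
  have X: "admissible_rank X l" using assms(3) by (simp add: simple_roots_of_type_def)
  have "P = classical_positive X l"
    using positive_system_unique[OF X P(1) classical_positive_system[OF X]] .
  then show ?thesis using P(2) by simp
qed

section \<open>Up-closed sets of cells and ballot numbers\<close>

text \<open>A cell \<open>(p, y)\<close> stands for the interval from \<open>p\<close> to \<open>y\<close>, and the order is inclusion of intervals.\<close>

definition grid_le :: "nat \<times> nat \<Rightarrow> nat \<times> nat \<Rightarrow> bool" where
  "grid_le a b \<longleftrightarrow> fst b \<le> fst a \<and> snd a \<le> snd b"

definition up_sets :: "(nat \<times> nat) set \<Rightarrow> (nat \<times> nat) set set" where
  "up_sets R = {U. U \<subseteq> R \<and> (\<forall>a\<in>U. \<forall>b\<in>R. grid_le a b \<longrightarrow> b \<in> U)}"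

definition triangle :: "nat \<Rightarrow> (nat \<times> nat) set" where
  "triangle n = {(p, y). 1 \<le> p \<and> p < y \<and> p + y \<le> n + 1}"

text \<open>The cells of the antidiagonal next to the triangle \<open>triangle n\<close>, restricted to first coordinates in
  \<open>S\<close>.\<close>

definition antidiagonal :: "nat \<Rightarrow> nat set \<Rightarrow> (nat \<times> nat) set" where
  "antidiagonal n S = (\<lambda>p. (p, n + 2 - p)) ` S"

text \<open>The up-closed subsets of the triangle containing exactly the first \<open>v\<close> cells of its last
  antidiagonal. The bound on \<open>v\<close> makes \<open>v\<close> unique, as there are only \<open>n div 2\<close> such cells.\<close>

definition ending :: "nat \<Rightarrow> nat \<Rightarrow> (nat \<times> nat) set set" where
  "ending n v = {U \<in> up_sets (triangle n). 2 * v \<le> n \<and>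
     (\<forall>p. 1 \<le> p \<longrightarrow> 2 * p \<le> n \<longrightarrow> ((p, n + 1 - p) \<in> U \<longleftrightarrow> p \<le> v))}"

lemma finite_triangle [simp]: "finite (triangle n)"
  by (rule finite_subset[of _ "{0..n+1} \<times> {0..n+1}"]) (auto simp: triangle_def)

lemma finite_up_sets: "finite R \<Longrightarrow> finite (up_sets R)"
  by (rule finite_subset[of _ "Pow R"]) (auto simp: up_sets_def)

lemma up_setsD: "U \<in> up_sets R \<Longrightarrow> (p, y) \<in> U \<Longrightarrow> (q, z) \<in> R \<Longrightarrow> q \<le> p \<Longrightarrow> y \<le> z \<Longrightarrow> (q, z) \<in> U"
  by (force simp: up_sets_def grid_le_def)

lemma up_setsI:
  assumes "U \<subseteq> R"
    and "\<And>p y q z. (p, y) \<in> U \<Longrightarrow> (q, z) \<in> R \<Longrightarrow> q \<le> p \<Longrightarrow> y \<le> z \<Longrightarrow> (q, z) \<in> U"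
  shows "U \<in> up_sets R"
  unfolding up_sets_def grid_le_def
proof (intro CollectI conjI ballI impI)
  fix a b assume "a \<in> U" "b \<in> R" "fst b \<le> fst a \<and> snd a \<le> snd b"
  then show "b \<in> U" using assms(2)[of "fst a" "snd a" "fst b" "snd b"] by simp
qed (rule assms(1))

lemma up_sets_restrict: "U \<in> up_sets R \<Longrightarrow> R' \<subseteq> R \<Longrightarrow> U \<inter> R' \<in> up_sets R'"
  by (auto simp: up_sets_def)

lemma ex_ending:
  assumes U: "U \<in> up_sets (triangle n)"
  shows "\<exists>v. U \<in> ending n v"
proof -
  let ?Q = "\<lambda>v. 2 * v \<le> n \<and> (v = 0 \<or> (v, n + 1 - v) \<in> U)"
  have Q0: "?Q 0" by simp
  have bound: "\<forall>v. ?Q v \<longrightarrow> v \<le> n" by auto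
  \<comment> \<open>the case \<open>v = 0\<close> stands for an empty last antidiagonal\<close>
  define v where "v = (GREATEST v. ?Q v)"
  have v: "?Q v" unfolding v_def by (rule GreatestI_nat[of ?Q 0 n]) (use Q0 bound in auto)
  have max: "p \<le> v" if "?Q p" for p
    unfolding v_def by (rule Greatest_le_nat[of ?Q p n]) (use that bound in auto)
  have "(p, n + 1 - p) \<in> U \<longleftrightarrow> p \<le> v" if p: "1 \<le> p" "2 * p \<le> n" for p
  proof
    assume "p \<le> v"
    then have "(v, n + 1 - v) \<in> U" using v p by auto
    then show "(p, n + 1 - p) \<in> U"
      by (rule up_setsD[OF U]) (use p \<open>p \<le> v\<close> in \<open>auto simp: triangle_def\<close>)
  qed (use max p in auto)
  then have "U \<in> ending n v" using U v by (auto simp: ending_def)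
  then show ?thesis by blast
qed

lemma ending_unique: "U \<in> ending n v \<Longrightarrow> U \<in> ending n w \<Longrightarrow> v = w"
proof -
  have "v \<le> w" if "U \<in> ending n v" "U \<in> ending n w" for v w
    using that by (cases "v = 0") (auto simp: ending_def dest: spec[of _ v])
  then show "U \<in> ending n v \<Longrightarrow> U \<in> ending n w \<Longrightarrow> v = w" by (meson antisym)
qed

lemma antidiagonal_disjoint:
  assumes "S \<subseteq> {p. 1 \<le> p \<and> 2 * p \<le> n + 1}"
  shows "antidiagonal n S \<inter> triangle n = {}"
  using assms by (auto simp: antidiagonal_def triangle_def)

text \<open>A cell \<open>(p, n + 2 - p)\<close> of the next antidiagonal contains \<open>(p, n + 1 - p)\<close> and is contained in
  \<open>(p - 1, n + 2 - p)\<close>. It is forced into the extension if \<open>p \<le> v\<close> and admissible only if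
  \<open>p - 1 \<le> v\<close>.\<close>

lemma up_set_extend:
  assumes W: "W \<in> ending n v" and S: "S \<subseteq> {p. 1 \<le> p \<and> 2 * p \<le> n + 1}" and k: "k = v \<or> k = v + 1"
  shows "W \<union> antidiagonal n (S \<inter> {..k}) \<in> up_sets (triangle n \<union> antidiagonal n S)"
proof -
  have Wup: "W \<in> up_sets (triangle n)" and v: "2 * v \<le> n"
    and Wv: "\<And>p. 1 \<le> p \<Longrightarrow> 2 * p \<le> n \<Longrightarrow> (p, n + 1 - p) \<in> W \<longleftrightarrow> p \<le> v"
    using W by (auto simp: ending_def)
  have Wsub: "W \<subseteq> triangle n" using Wup by (auto simp: up_sets_def)
  let ?U = "W \<union> antidiagonal n (S \<inter> {..k})"
  have "(q, z) \<in> ?U" if a: "(p, y) \<in> ?U" and b: "(q, z) \<in> triangle n \<union> antidiagonal n S"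
    and le: "q \<le> p" "y \<le> z" for p y q z
    using a
  proof
    assume aW: "(p, y) \<in> W"
    then have py: "1 \<le> p" "p < y" "p + y \<le> n + 1" using Wsub by (auto simp: triangle_def)
    from b show ?thesis
    proof
      assume "(q, z) \<in> triangle n"
      then show ?thesis using up_setsD[OF Wup aW _ le] by blast
    next
      assume "(q, z) \<in> antidiagonal n S"
      then have q: "q \<in> S" "z = n + 2 - q" "1 \<le> q" using S by (auto simp: antidiagonal_def)
      have 2: "2 * q \<le> n" using py le by linarith
      have "(q, n + 1 - q) \<in> W"
        by (rule up_setsD[OF Wup aW]) (use 2 q py le in \<open>auto simp: triangle_def\<close>)
      then have "q \<le> v" using Wv q(3) 2 by blast
      then show ?thesis using q k by (auto simp: antidiagonal_def)
    qed
  next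
    assume "(p, y) \<in> antidiagonal n (S \<inter> {..k})"
    then have p: "p \<in> S" "p \<le> k" "y = n + 2 - p" "1 \<le> p" "2 * p \<le> n + 1"
      using S by (auto simp: antidiagonal_def)
    from b show ?thesis
    proof
      assume bt: "(q, z) \<in> triangle n"
      then have q: "1 \<le> q" "q < z" "q + z \<le> n + 1" by (auto simp: triangle_def)
      then have "q < p" using le p by linarith
      have "(p - 1, n + 1 - (p - 1)) \<in> W"
        by (subst Wv) (use p q \<open>q < p\<close> k in auto)
      then show ?thesis
        using up_setsD[OF Wup _ bt] \<open>q < p\<close> le p(3) by fastforce
    next
      assume "(q, z) \<in> antidiagonal n S"
      then have "q \<in> S" "z = n + 2 - q" using S by (auto simp: antidiagonal_def)
      then show ?thesis using le p by (auto simp: antidiagonal_def)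
    qed
  qed
  moreover have "?U \<subseteq> triangle n \<union> antidiagonal n S"
    using Wsub by (auto simp: antidiagonal_def)
  ultimately show ?thesis by (intro up_setsI) blast+
qed

text \<open>Cells with \<open>p \<le> v\<close> are forced and those with \<open>p > v + 1\<close> excluded, so at most one cell is free.\<close>

lemma up_set_fiber:
  assumes W: "W \<in> ending n v" and S: "S \<subseteq> {p. 1 \<le> p \<and> 2 * p \<le> n + 1}"
  shows "{U \<in> up_sets (triangle n \<union> antidiagonal n S). U \<inter> triangle n = W} =
    {W \<union> antidiagonal n (S \<inter> {..v}), W \<union> antidiagonal n (S \<inter> {..v + 1})}"
proof (intro antisym subsetI)
  have Wup: "W \<in> up_sets (triangle n)" and v: "2 * v \<le> n"
    and Wv: "\<And>p. 1 \<le> p \<Longrightarrow> 2 * p \<le> n \<Longrightarrow> (p, n + 1 - p) \<in> W \<longleftrightarrow> p \<le> v"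
    using W by (auto simp: ending_def)
  have Wsub: "W \<subseteq> triangle n" using Wup by (auto simp: up_sets_def)
  {
    fix U assume "U \<in> {W \<union> antidiagonal n (S \<inter> {..v}), W \<union> antidiagonal n (S \<inter> {..v + 1})}"
    then obtain k where k: "k = v \<or> k = v + 1" "U = W \<union> antidiagonal n (S \<inter> {..k})" by blast
    have "antidiagonal n (S \<inter> {..k}) \<inter> triangle n = {}"
      by (rule antidiagonal_disjoint) (use S in blast)
    then have "U \<inter> triangle n = W" using k(2) Wsub by blast
    then show "U \<in> {U \<in> up_sets (triangle n \<union> antidiagonal n S). U \<inter> triangle n = W}"
      using up_set_extend[OF W S k(1)] k(2) by simp
  next
    fix U assume "U \<in> {U \<in> up_sets (triangle n \<union> antidiagonal n S). U \<inter> triangle n = W}"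
    then have U: "U \<in> up_sets (triangle n \<union> antidiagonal n S)" "U \<inter> triangle n = W" by auto
    have Usub: "U \<subseteq> triangle n \<union> antidiagonal n S" using U(1) by (auto simp: up_sets_def)
    let ?T = "{p \<in> S. (p, n + 2 - p) \<in> U}"
    have UT: "U = W \<union> antidiagonal n ?T"
      using Usub U(2) by (auto simp: antidiagonal_def)
    have low: "p \<in> ?T" if p: "p \<in> S" "p \<le> v" for p
    proof -
      have "1 \<le> p" "2 * p \<le> n" using p S v by auto
      then have "(p, n + 1 - p) \<in> U" using Wv p(2) U(2) by blast
      moreover have "(p, n + 2 - p) \<in> triangle n \<union> antidiagonal n S" using p by (auto simp: antidiagonal_def)
      ultimately show ?thesis using up_setsD[OF U(1)] p by force
    qed
    have high: "p \<le> v + 1" if "p \<in> ?T" for p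
    proof (cases "p = 1")
      case False
      then have p: "2 \<le> p" "2 * p \<le> n + 1" using that S by force+
      have "(p - 1, n + 1 - (p - 1)) \<in> triangle n" using p by (auto simp: triangle_def)
      then have "(p - 1, n + 1 - (p - 1)) \<in> U"
        using up_setsD[OF U(1), of p "n + 2 - p" "p - 1" "n + 1 - (p - 1)"] that p by auto
      then have "(p - 1, n + 1 - (p - 1)) \<in> W" using U(2) \<open>(p - 1, n + 1 - (p - 1)) \<in> triangle n\<close> by blast
      then have "p - 1 \<le> v" using Wv[of "p - 1"] p by auto
      then show ?thesis by simp
    qed simp
    have "?T = S \<inter> {..v} \<or> ?T = S \<inter> {..v + 1}"
    proof (cases "v + 1 \<in> ?T")
      case True
      then have "?T = S \<inter> {..v + 1}" using low high by (auto simp: le_Suc_eq)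
      then show ?thesis ..
    next
      case False
      have "p \<le> v" if "p \<in> ?T" for p using high[OF that] that False by (cases "p = v + 1") auto
      then have "?T = S \<inter> {..v}" using low by auto
      then show ?thesis ..
    qed
    then have "antidiagonal n ?T = antidiagonal n (S \<inter> {..v})
        \<or> antidiagonal n ?T = antidiagonal n (S \<inter> {..v + 1})"
      by (elim disjE) simp_all
    then show "U \<in> {W \<union> antidiagonal n (S \<inter> {..v}), W \<union> antidiagonal n (S \<inter> {..v + 1})}"
      by (subst (1) UT) blast
  }
qed

lemma antidiagonal_inject: "antidiagonal n S = antidiagonal n T \<longleftrightarrow> S = T"
  unfolding antidiagonal_def by (rule inj_image_eq_iff) (auto intro: injI)

text \<open>The two extensions coincide when there is no cell with \<open>p = v + 1\<close>.\<close>

lemma card_up_set_fiber: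
  assumes W: "W \<in> ending n v" and S: "S \<subseteq> {p. 1 \<le> p \<and> 2 * p \<le> n + 1}"
  shows "card {U \<in> up_sets (triangle n \<union> antidiagonal n S). U \<inter> triangle n = W}
    = 1 + of_bool (v + 1 \<in> S)"
proof -
  have Wsub: "W \<subseteq> triangle n" using W by (auto simp: ending_def up_sets_def)
  have d: "antidiagonal n (S \<inter> {..k}) \<inter> triangle n = {}" for k
    by (rule antidiagonal_disjoint) (use S in blast)
  have cancel: "W \<union> A = W \<union> A' \<longleftrightarrow> A = A'"
    if "A \<inter> triangle n = {}" "A' \<inter> triangle n = {}" for A A'
    using that Wsub by blast
  have "W \<union> antidiagonal n (S \<inter> {..v}) = W \<union> antidiagonal n (S \<inter> {..v + 1})
      \<longleftrightarrow> antidiagonal n (S \<inter> {..v}) = antidiagonal n (S \<inter> {..v + 1})"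
    by (rule cancel[OF d d])
  also have "\<dots> \<longleftrightarrow> S \<inter> {..v} = S \<inter> {..v + 1}" by (rule antidiagonal_inject)
  also have "\<dots> \<longleftrightarrow> v + 1 \<notin> S" proof
    assume "S \<inter> {..v} = S \<inter> {..v + 1}"
    then have "v + 1 \<in> S \<Longrightarrow> v + 1 \<in> S \<inter> {..v}" by simp
    then show "v + 1 \<notin> S" by auto
  qed (auto simp: le_Suc_eq)
  finally show ?thesis unfolding up_set_fiber[OF W S] by (auto simp: card_insert_if)
qed

lemma up_sets_triangle: "up_sets (triangle n) = (\<Union>v\<in>{..n div 2}. ending n v)"
proof (intro antisym subsetI)
  fix U assume "U \<in> up_sets (triangle n)"
  then obtain v where v: "U \<in> ending n v" using ex_ending by blast
  then have "v \<le> n div 2" by (auto simp: ending_def)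
  then show "U \<in> (\<Union>v\<in>{..n div 2}. ending n v)" using v by blast
qed (auto simp: ending_def)

lemma finite_ending [simp]: "finite (ending n v)"
  by (rule finite_subset[OF _ finite_up_sets[OF finite_triangle[of n]]]) (auto simp: ending_def)

lemma card_up_sets_antidiagonal:
  assumes S: "S \<subseteq> {p. 1 \<le> p \<and> 2 * p \<le> n + 1}"
  shows "card (up_sets (triangle n \<union> antidiagonal n S))
    = (\<Sum>v\<le>n div 2. card (ending n v) * (1 + of_bool (v + 1 \<in> S)))"
proof -
  let ?A = "up_sets (triangle n \<union> antidiagonal n S)"
  have "finite S" by (rule finite_subset[OF S]) (rule finite_subset[of _ "{..n+1}"], auto)
  then have fin: "finite ?A" by (intro finite_up_sets) (auto simp: antidiagonal_def)
  have img: "(\<lambda>U. U \<inter> triangle n) ` ?A \<subseteq> up_sets (triangle n)"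
    using up_sets_restrict by blast
  have "card ?A = (\<Sum>U\<in>?A. 1)" by simp
  also have "\<dots> = (\<Sum>W\<in>up_sets (triangle n). \<Sum>U\<in>{U \<in> ?A. U \<inter> triangle n = W}. 1)"
    by (rule sum.group[OF fin finite_up_sets[OF finite_triangle] img, symmetric])
  also have "\<dots> = (\<Sum>v\<in>{..n div 2}. \<Sum>W\<in>ending n v. card {U \<in> ?A. U \<inter> triangle n = W})"
    unfolding up_sets_triangle
    by (subst sum.UNION_disjoint) (auto dest: ending_unique)
  also have "\<dots> = (\<Sum>v\<in>{..n div 2}. \<Sum>W\<in>ending n v. 1 + of_bool (v + 1 \<in> S))"
    by (intro sum.cong refl card_up_set_fiber S)
  finally show ?thesis by simp
qed

lemma triangle_Suc: "triangle (Suc n) = triangle n \<union> antidiagonal n {p. 1 \<le> p \<and> 2 * p \<le> n + 1}"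
  by (auto simp: triangle_def antidiagonal_def image_iff)

text \<open>Pascal's recursion: with each new antidiagonal the number \<open>v\<close> stays or increases by one.\<close>

lemma card_ending_Suc:
  assumes k: "2 * k \<le> Suc n"
  shows "card (ending (Suc n) k) = card (ending n k) + (if k = 0 then 0 else card (ending n (k - 1)))"
proof -
  let ?S = "{p. 1 \<le> p \<and> 2 * p \<le> n + 1}"
  let ?E = "ending n k \<union> (if k = 0 then {} else ending n (k - 1))"
  let ?D = "antidiagonal n (?S \<inter> {..k})"
  have Dt: "?D \<inter> triangle n = {}" by (rule antidiagonal_disjoint) blast
  have mem: "U \<in> ending (Suc n) k \<longleftrightarrow> U \<in> up_sets (triangle (Suc n)) \<and> U \<inter> antidiagonal n ?S = ?D" for U
  proof -
    have "U \<inter> antidiagonal n ?S = ?D \<longleftrightarrow> (\<forall>p. 1 \<le> p \<longrightarrow> 2 * p \<le> Suc n \<longrightarrow> ((p, Suc n + 1 - p) \<in> U \<longleftrightarrow> p \<le> k))"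
      by (auto simp: antidiagonal_def set_eq_iff image_iff)
    then show ?thesis using k by (auto simp: ending_def)
  qed
  have "ending (Suc n) k = (\<lambda>W. W \<union> ?D) ` ?E"
  proof (intro antisym subsetI)
    fix U assume U: "U \<in> ending (Suc n) k"
    then have up: "U \<in> up_sets (triangle n \<union> antidiagonal n ?S)" using mem triangle_Suc by auto
    let ?W = "U \<inter> triangle n"
    have "?W \<in> up_sets (triangle n)" using up_sets_restrict[OF up] by blast
    then obtain v where v: "?W \<in> ending n v" using ex_ending by blast
    have UD: "U = ?W \<union> ?D"
    proof -
      have "U \<subseteq> triangle n \<union> antidiagonal n ?S" using up by (simp add: up_sets_def)
      moreover have "U \<inter> antidiagonal n ?S = ?D" using mem U by blast
      ultimately show ?thesis by blast
    qed
    have "U \<in> {U \<in> up_sets (triangle n \<union> antidiagonal n ?S). U \<inter> triangle n = ?W}" using up by simp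
    then have "U = ?W \<union> antidiagonal n (?S \<inter> {..v}) \<or> U = ?W \<union> antidiagonal n (?S \<inter> {..v + 1})"
      unfolding up_set_fiber[OF v order_refl] by blast
    moreover have "antidiagonal n (?S \<inter> {..j}) \<inter> triangle n = {}" for j
      by (rule antidiagonal_disjoint) blast
    ultimately have "?D = antidiagonal n (?S \<inter> {..v}) \<or> ?D = antidiagonal n (?S \<inter> {..v + 1})"
      using UD Dt by blast
    then have eq: "?S \<inter> {..k} = ?S \<inter> {..v} \<or> ?S \<inter> {..k} = ?S \<inter> {..v + 1}"
      unfolding antidiagonal_inject .
    have v2: "2 * v \<le> n" using v by (auto simp: ending_def)
    have seg: "j \<le> i" if "?S \<inter> {..i} = ?S \<inter> {..j}" "2 * j \<le> n + 1" for i j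
    proof (cases "j = 0")
      case False
      then have "j \<in> ?S \<inter> {..j}" using that by simp
      then have "j \<in> ?S \<inter> {..i}" using that(1) by blast
      then show ?thesis by simp
    qed simp
    have "k = v \<or> k = v + 1"
      using eq
    proof
      assume e: "?S \<inter> {..k} = ?S \<inter> {..v}"
      then show ?thesis using seg[OF e] seg[OF e[symmetric]] v2 k by auto
    next
      assume e: "?S \<inter> {..k} = ?S \<inter> {..v + 1}"
      show ?thesis
      proof (cases "2 * (v + 1) \<le> n + 1")
        case True
        then show ?thesis using seg[OF e] seg[OF e[symmetric]] k by auto
      next
        case False
        then have "k \<le> v" using k by simp
        moreover have "?S \<inter> {..v + 1} = ?S \<inter> {..v}" using False by (auto simp: le_Suc_eq)
        then have "v \<le> k" using seg[of k v] e v2 by simp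
        ultimately show ?thesis by simp
      qed
    qed
    then have "?W \<in> ?E" using v by auto
    then show "U \<in> (\<lambda>W. W \<union> ?D) ` ?E" using UD by blast
  next
    fix U assume "U \<in> (\<lambda>W. W \<union> ?D) ` ?E"
    then obtain W v where W: "U = W \<union> ?D" "W \<in> ending n v" "k = v \<or> k = v + 1"
      by (auto split: if_splits)
    have "U \<in> up_sets (triangle (Suc n))"
      using up_set_extend[OF W(2) order_refl W(3)] W(1) triangle_Suc by simp
    moreover have "W \<subseteq> triangle n" using W(2) by (auto simp: ending_def up_sets_def)
    then have "U \<inter> antidiagonal n ?S = ?D"
      using W(1) antidiagonal_disjoint[OF order_refl, of n] by (auto simp: antidiagonal_def)
    ultimately show "U \<in> ending (Suc n) k" using mem by blast
  qed
  moreover have "inj_on (\<lambda>W. W \<union> ?D) ?E"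
  proof (rule inj_onI)
    fix W W' assume "W \<in> ?E" "W' \<in> ?E" "W \<union> ?D = W' \<union> ?D"
    moreover have "W \<subseteq> triangle n" "W' \<subseteq> triangle n"
      using \<open>W \<in> ?E\<close> \<open>W' \<in> ?E\<close> by (auto simp: ending_def up_sets_def split: if_splits)
    ultimately show "W = W'" using Dt by blast
  qed
  ultimately have "card (ending (Suc n) k) = card ?E" by (simp add: card_image)
  also have "\<dots> = card (ending n k) + (if k = 0 then 0 else card (ending n (k - 1)))"
  proof (cases "k = 0")
    case False
    then have "k \<noteq> k - 1" by simp
    then have "ending n k \<inter> ending n (k - 1) = {}" using ending_unique by blast
    then show ?thesis using False by (simp add: card_Un_disjoint)
  qed simp
  finally show ?thesis .
qed

text \<open>A ballot number: for \<open>2 v \<le> n\<close> it counts the sequences of \<open>n\<close> votes, \<open>v\<close> of them for the second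
  candidate, in which the first candidate is never behind.\<close>

definition ballot :: "nat \<Rightarrow> nat \<Rightarrow> int" where
  "ballot n v = int (n choose v) - (if v = 0 then 0 else int (n choose (v - 1)))"

lemma ballot_Suc: "ballot (Suc n) v = ballot n v + (if v = 0 then 0 else ballot n (v - 1))"
proof (cases v)
  case (Suc w)
  then show ?thesis by (cases w) (auto simp: ballot_def)
qed (simp add: ballot_def)

text \<open>The recursion above may lead to \<open>2 v = n + 1\<close>, where both sides are zero.\<close>

lemma card_ending: "2 * v \<le> n \<Longrightarrow> int (card (ending n v)) = ballot n v"
proof (induction n arbitrary: v)
  case 0
  have "up_sets (triangle 0) = {{}}" by (auto simp: up_sets_def triangle_def)
  then have "ending 0 0 = {{}}" by (auto simp: ending_def)
  then show ?case using 0 by (simp add: ballot_def)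
next
  case (Suc n)
  have 1: "int (card (ending n v)) = ballot n v"
  proof (cases "2 * v \<le> n")
    case True
    then show ?thesis using Suc.IH by simp
  next
    case False
    then have n: "2 * v = Suc n" using Suc.prems by simp
    have "ending n v = {}" using False by (auto simp: ending_def)
    moreover have "n choose v = n choose (v - 1)"
    proof -
      have "v \<le> n" "n - v = v - 1" using n by auto
      then show ?thesis using binomial_symmetric[of v n] by simp
    qed
    ultimately show ?thesis using n by (simp add: ballot_def)
  qed
  have 2: "int (card (ending n (v - 1))) = ballot n (v - 1)" if "v \<noteq> 0"
    by (rule Suc.IH) (use Suc.prems that in auto)
  show ?case using card_ending_Suc[OF Suc.prems] 1 2 by (auto simp: ballot_Suc)
qed

lemma sum_ballot: "(\<Sum>v\<le>k. ballot n v) = int (n choose k)"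
  by (induction k) (auto simp: ballot_def)

text \<open>The ballot numbers for \<open>v \<le> n div 2\<close> add up to the binomial coefficient by telescoping. A cell \<open>p\<close>
  of the additional antidiagonal doubles the up-closed sets with \<open>v = p - 1\<close>.\<close>

theorem card_up_sets_ballot:
  assumes S: "S \<subseteq> {p. 1 \<le> p \<and> 2 * p \<le> n + 1}"
  shows "int (card (up_sets (triangle n \<union> antidiagonal n S)))
    = int (n choose (n div 2)) + (\<Sum>p\<in>S. ballot n (p - 1))"
proof -
  have fin: "finite S" by (rule finite_subset[OF S]) (rule finite_subset[of _ "{..n+1}"], auto)
  have "int (card (up_sets (triangle n \<union> antidiagonal n S)))
      = (\<Sum>v\<le>n div 2. ballot n v * (1 + of_bool (v + 1 \<in> S)))"
    unfolding card_up_sets_antidiagonal[OF S] of_nat_sum of_nat_mult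
    by (intro sum.cong) (auto simp: card_ending)
  also have "\<dots> = (\<Sum>v\<le>n div 2. ballot n v) + (\<Sum>v\<le>n div 2. if v + 1 \<in> S then ballot n v else 0)"
    unfolding sum.distrib[symmetric] by (intro sum.cong) auto
  also have "(\<Sum>v\<le>n div 2. if v + 1 \<in> S then ballot n v else 0) = (\<Sum>v | v \<le> n div 2 \<and> v + 1 \<in> S. ballot n v)"
    by (subst sum.inter_filter[symmetric]) (auto intro!: sum.cong)
  also have "\<dots> = (\<Sum>p\<in>S. ballot n (p - 1))"
    by (rule sum.reindex_bij_witness[of _ "\<lambda>p. p - 1" Suc]) (use S in force)+
  finally show ?thesis by (simp add: sum_ballot)
qed

text \<open>An up-closed subset of the triangle of size \<open>2 m\<close> whose last antidiagonal is full contains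
  \<open>(m, m + 1)\<close>, hence all intervals with \<open>p \<le> m < y\<close>. What remains of it is an arbitrary up-closed
  set of intervals inside \<open>{1..m}\<close>.\<close>

theorem card_up_sets_staircase:
  "int (card (up_sets {(p, y). 1 \<le> p \<and> p < y \<and> y \<le> m})) = ballot (2 * m) m"
proof -
  let ?R = "{(p, y). 1 \<le> p \<and> p < y \<and> y \<le> m}"
  let ?T = "triangle (2 * m)"
  have RT: "?R \<subseteq> ?T" by (auto simp: triangle_def)
  have upper: "?T - ?R \<subseteq> U" if U: "U \<in> ending (2 * m) m" for U
  proof
    fix a assume "a \<in> ?T - ?R"
    moreover obtain p y where "a = (p, y)" by (cases a)
    ultimately have a: "a = (p, y)" "(p, y) \<in> ?T" "1 \<le> p" "p < y" "m < y" "p \<le> m"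
      by (auto simp: triangle_def)
    have "(m, m + 1) \<in> U" using U a by (auto simp: ending_def dest!: spec[of _ m])
    moreover have "U \<in> up_sets ?T" using U by (auto simp: ending_def)
    ultimately show "a \<in> U" using up_setsD a by fastforce
  qed
  have "bij_betw (\<lambda>U. U \<inter> ?R) (ending (2 * m) m) (up_sets ?R)"
  proof (rule bij_betw_byWitness[where f' = "\<lambda>V. V \<union> (?T - ?R)"])
    show "\<forall>U\<in>ending (2 * m) m. U \<inter> ?R \<union> (?T - ?R) = U"
    proof
      fix U assume U: "U \<in> ending (2 * m) m"
      then have "U \<subseteq> ?T" by (auto simp: ending_def up_sets_def)
      then show "U \<inter> ?R \<union> (?T - ?R) = U" using upper[OF U] by blast
    qed
    show "\<forall>V\<in>up_sets ?R. (V \<union> (?T - ?R)) \<inter> ?R = V" by (auto simp: up_sets_def)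
    show "(\<lambda>U. U \<inter> ?R) ` ending (2 * m) m \<subseteq> up_sets ?R"
      using up_sets_restrict[OF _ RT] by (auto simp: ending_def)
    show "(\<lambda>V. V \<union> (?T - ?R)) ` up_sets ?R \<subseteq> ending (2 * m) m"
    proof safe
      fix V assume V: "V \<in> up_sets ?R"
      have "(q, z) \<in> V \<union> (?T - ?R)" if a: "(p, y) \<in> V \<union> (?T - ?R)" "(q, z) \<in> ?T" "q \<le> p" "y \<le> z" for p y q z
      proof (cases "(q, z) \<in> ?R")
        case True
        then have "(p, y) \<in> V" using a by (auto simp: triangle_def)
        then show ?thesis using up_setsD[OF V _ True a(3,4)] by blast
      qed (use a in blast)
      moreover have "V \<union> (?T - ?R) \<subseteq> ?T" using V RT by (auto simp: up_sets_def)
      ultimately have "V \<union> (?T - ?R) \<in> up_sets ?T" by (intro up_setsI) blast+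
      then show "V \<union> (?T - ?R) \<in> ending (2 * m) m" by (auto simp: ending_def triangle_def)
    qed
  qed
  then have "card (ending (2 * m) m) = card (up_sets ?R)" by (rule bij_betw_same_card)
  then show ?thesis using card_ending[of m "2 * m"] by simp
qed

section \<open>Blocks of positions and ideals\<close>

text \<open>The positions are cut after every \<open>k\<close> in \<open>J\<close>; the blocks are numbered from 1.\<close>

definition block :: "nat set \<Rightarrow> nat \<Rightarrow> nat" where
  "block J x = Suc (card (J \<inter> {..<x}))"

lemma block_mono: "finite J \<Longrightarrow> x \<le> y \<Longrightarrow> block J x \<le> block J y"
  unfolding block_def by (simp, rule card_mono) auto

lemma block_less_iff:
  assumes "finite J"
  shows "block J x < block J y \<longleftrightarrow> (\<exists>k\<in>J. x \<le> k \<and> k < y)"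
proof
  assume *: "block J x < block J y"
  show "\<exists>k\<in>J. x \<le> k \<and> k < y"
  proof (rule ccontr)
    assume "\<not> ?thesis"
    then have "J \<inter> {..<y} \<subseteq> J \<inter> {..<x}" by auto
    then have "card (J \<inter> {..<y}) \<le> card (J \<inter> {..<x})" using assms by (intro card_mono) auto
    then show False using * by (simp add: block_def)
  qed
next
  assume "\<exists>k\<in>J. x \<le> k \<and> k < y"
  then obtain k where k: "k \<in> J" "x \<le> k" "k < y" by blast
  have "J \<inter> {..<x} \<subseteq> J \<inter> {..<y}" using k by auto
  moreover have "k \<in> J \<inter> {..<y}" "k \<notin> J \<inter> {..<x}" using k by auto
  ultimately have "J \<inter> {..<x} \<subset> J \<inter> {..<y}" by blast
  then have "card (J \<inter> {..<x}) < card (J \<inter> {..<y})" using assms by (intro psubset_card_mono) auto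
  then show "block J x < block J y" by (simp add: block_def)
qed

lemma block_onto:
  assumes J: "J \<subseteq> {1..<M}" and M: "1 \<le> M" and p: "1 \<le> p" "p \<le> card J + 1"
  shows "\<exists>x. 1 \<le> x \<and> x \<le> M \<and> block J x = p"
proof -
  have fin: "finite J" using J finite_subset by blast
  have b1: "block J 1 = 1" using J by (auto simp: block_def)
  have bM: "block J M = card J + 1"
  proof -
    have "J \<inter> {..<M} = J" using J by auto
    then show ?thesis by (simp add: block_def)
  qed
  define x where "x = (LEAST x. p \<le> block J x)"
  have x: "p \<le> block J x" unfolding x_def by (rule LeastI[of _ M]) (use bM p in simp)
  have xM: "x \<le> M" unfolding x_def by (rule Least_le) (use bM p in simp)
  have "block J 0 = 1" by (simp add: block_def)
  show ?thesis
  proof (cases "p = 1")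
    case True
    then show ?thesis using b1 M by blast
  next
    case False
    then have "x \<noteq> 0" using x p \<open>block J 0 = 1\<close> by (metis One_nat_def le_antisym)
    then obtain w where w: "x = Suc w" by (cases x) auto
    have "\<not> p \<le> block J w" unfolding x_def using w x_def by (intro not_less_Least) simp
    moreover have "card (J \<inter> {..<Suc w}) \<le> Suc (card (J \<inter> {..<w}))"
      by (simp add: lessThan_Suc card_insert_if Int_insert_right)
    then have "block J (Suc w) \<le> Suc (block J w)" by (simp add: block_def)
    ultimately have "block J x = p" using x w by simp
    then show ?thesis using xM \<open>x \<noteq> 0\<close> by (intro exI[of _ x]) simp
  qed
qed

text \<open>Mirroring reverses the numbering of the \<open>card J + 1\<close> blocks.\<close>

lemma block_mirror:
  assumes J: "J \<subseteq> {1..<M}" and mir: "\<And>k. k \<in> J \<Longrightarrow> M - k \<in> J" and x: "1 \<le> x" "x \<le> M"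
  shows "block J (M + 1 - x) + block J x = card J + 2"
proof -
  have fin: "finite J" using J finite_subset by blast
  have "J \<inter> {..<M + 1 - x} = (\<lambda>k. M - k) ` (J - {..<x})"
  proof (intro antisym subsetI)
    fix k assume k: "k \<in> J \<inter> {..<M + 1 - x}"
    then have "k < M" "M - k \<in> J" using J mir by auto
    moreover have "x \<le> M - k" using k x by auto
    ultimately show "k \<in> (\<lambda>k. M - k) ` (J - {..<x})" by (intro image_eqI[of _ _ "M - k"]) auto
  next
    fix k assume "k \<in> (\<lambda>k. M - k) ` (J - {..<x})"
    then show "k \<in> J \<inter> {..<M + 1 - x}" using mir J x by auto
  qed
  moreover have "inj_on (\<lambda>k. M - k) (J - {..<x})"
  proof (rule inj_onI)
    fix u w assume "u \<in> J - {..<x}" "w \<in> J - {..<x}" and e: "M - u = M - w"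
    then have "u < M" "w < M" using J by auto
    then show "u = w" using e by simp
  qed
  ultimately have "card (J \<inter> {..<M + 1 - x}) = card (J - {..<x})" by (simp add: card_image)
  moreover have "card J = card (J \<inter> {..<x}) + card (J - {..<x})"
    using fin by (metis Int_commute card_Int_Diff)
  ultimately show ?thesis by (simp add: block_def)
qed

text \<open>Apart from type A, a pair and its mirror represent the same root; the normal pair is the one whose
  left end is at least as far from the centre as its right end.\<close>

definition normal_pairs :: "classical_type \<Rightarrow> nat \<Rightarrow> (nat \<times> nat) set" where
  "normal_pairs X l = {(x, y). valid_pair X l x y \<and> x + y \<le> weight_count X l + 1}"

text \<open>How often a pair passes the step \<open>k\<close> or its mirror \<open>M - k\<close>; these steps coincide if \<open>2 k = M\<close>.\<close>

definition crossings :: "nat \<Rightarrow> nat \<Rightarrow> nat \<Rightarrow> nat \<Rightarrow> int" where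
  "crossings M k x y = of_bool (x \<le> k \<and> k < y) + of_bool (2 * k \<noteq> M \<and> x \<le> M - k \<and> M - k < y)"

text \<open>A normal pair that passes \<open>M - k\<close>, in the right half, also passes \<open>k\<close>. So the crossing number for
  \<open>k\<close> tells which of the two steps are passed, and a pair with larger crossing numbers at all
  cuts spans a larger interval of blocks.\<close>

lemma crossings_mono_block:
  assumes fin: "finite J" and J: "J \<subseteq> {1..<M}" and mir: "\<And>k. k \<in> J \<Longrightarrow> M - k \<in> J"
    and xy: "x < y" "x + y \<le> M + 1" and xy': "x' < y'" "x' + y' \<le> M + 1"
    and b: "block J x < block J y"
    and le: "\<And>k. k \<in> J \<Longrightarrow> 2 * k \<le> M \<Longrightarrow> crossings M k x y \<le> crossings M k x' y'"
  shows "block J x' \<le> block J x \<and> block J y \<le> block J y'"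
proof
  obtain j where j: "j \<in> J" "x \<le> j" "j < y" using b block_less_iff[OF fin] by blast
  have jM: "j < M" using j J by auto
  show "block J x' \<le> block J x"
  proof (rule ccontr)
    assume "\<not> ?thesis"
    then obtain k0 where k0: "k0 \<in> J" "x \<le> k0" "k0 < x'" using block_less_iff[OF fin, of x x'] by auto
    \<comment> \<open>if \<open>k0\<close> lies beyond \<open>y\<close>, the cut \<open>j\<close> serves\<close>
    obtain k where k: "k \<in> J" "x \<le> k" "k < x'" "k < y"
      using k0 j by (cases "k0 < y") auto
    have "2 * k \<le> M" using k xy' by linarith
    then have "crossings M k x y \<le> crossings M k x' y'" using le k by blast
    moreover have "crossings M k x y \<ge> 1" using k by (simp add: crossings_def)
    moreover have "crossings M k x' y' = 0" using k xy' by (auto simp: crossings_def)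
    ultimately show False by simp
  qed
  show "block J y \<le> block J y'"
  proof (rule ccontr)
    assume "\<not> ?thesis"
    then obtain k where k: "k \<in> J" "y' \<le> k" "k < y" using block_less_iff[OF fin, of y' y] by auto
    have kM: "k < M" using k J by auto
    show False
    proof (cases "k < x")
      case True
      let ?i = "if 2 * j \<le> M then j else M - j"
      have i: "?i \<in> J" "2 * ?i \<le> M" using j mir by auto
      have "crossings M ?i x y \<ge> 1" using j jM by (auto simp: crossings_def)
      moreover have "crossings M ?i x' y' = 0" using True k j jM xy xy' by (auto simp: crossings_def)
      ultimately show False using le[OF i] by simp
    next
      case False
      show ?thesis
      proof (cases "2 * k \<le> M")
        case True
        have "crossings M k x y \<ge> 1" using False k by (simp add: crossings_def)
        moreover have "crossings M k x' y' = 0" using True k by (auto simp: crossings_def)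
        ultimately show False using le[OF k(1) True] by simp
      next
        case h: False
        have i: "M - k \<in> J" "2 * (M - k) \<le> M" using k mir h by auto
        have "crossings M (M - k) x y = 2" using h False k kM xy by (auto simp: crossings_def)
        moreover have "crossings M (M - k) x' y' \<le> 1" using k kM by (auto simp: crossings_def)
        ultimately show False using le[OF i] by simp
      qed
    qed
  qed
qed

text \<open>Mirroring negates weights and therefore exchanges the two ends of a difference.\<close>

lemma mirror_root_vec:
  assumes "X \<noteq> TypeA" "1 \<le> x" "x \<le> weight_count X l" "1 \<le> y" "y \<le> weight_count X l"
  shows "root_vec X l (weight_count X l + 1 - y) (weight_count X l + 1 - x) = root_vec X l x y"
proof -
  let ?M = "weight_count X l"
  have p: "passed k (?M + 1 - z) = 1 - passed (?M - k) z" if "k \<le> ?M" "1 \<le> z" "z \<le> ?M" for k z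
    using that by (auto simp: passed_def)
  have c: "depth_coeff X l (?M + 1 - z) i = (if X = TypeC \<and> i = l then 1 else if X = TypeD \<and> i = l \<or> X = TypeD \<and> i + 1 = l then 1 else 2)
      - depth_coeff X l z i" if z: "1 \<le> z" "z \<le> ?M" and i: "1 \<le> i" "i \<le> l" for z i
  proof (cases X)
    case TypeD
    have p': "passed k (2 * l + 1 - z) = 1 - passed (2 * l - k) z" if "k \<le> 2 * l" for k
      using p[of k z] z that TypeD by simp
    consider "i = l" | "l = Suc i" | "i + 1 < l" using i by linarith
    then show ?thesis
      using TypeD p'[of i] p'[of "2 * l - i"] p'[of l] p'[of "l + 1"] i
      by cases (simp_all add: numeral_2_eq_2)
  qed (use assms(1) p[of i z] p[of "?M - i" z] p[of l z] z i in auto)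
  show ?thesis
  proof (rule ext)
    fix i show "root_vec X l (?M + 1 - y) (?M + 1 - x) i = root_vec X l x y i"
      using c[of x i] c[of y i] assms by (auto simp: root_vec_def depth_def)
  qed
qed

lemma classical_positive_normal:
  assumes "X \<noteq> TypeA"
  shows "classical_positive X l = (\<lambda>(x, y). root_vec X l x y) ` normal_pairs X l"
proof (intro antisym subsetI)
  fix c assume "c \<in> classical_positive X l"
  then obtain x y where v: "valid_pair X l x y" and c: "c = root_vec X l x y"
    by (auto simp: classical_positive_def)
  let ?M = "weight_count X l"
  show "c \<in> (\<lambda>(x, y). root_vec X l x y) ` normal_pairs X l"
  proof (cases "x + y \<le> ?M + 1")
    case True
    then show ?thesis using v c by (auto simp: normal_pairs_def)
  next
    case False
    have "(?M + 1 - y, ?M + 1 - x) \<in> normal_pairs X l"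
      using v False by (auto simp: normal_pairs_def valid_pair_def)
    moreover have "c = root_vec X l (?M + 1 - y) (?M + 1 - x)"
      using c mirror_root_vec[OF assms, of x l y] v by (auto simp: valid_pair_def)
    ultimately show ?thesis by force
  qed
qed (auto simp: classical_positive_def normal_pairs_def)

lemma levi_part_minus: "c \<in> levi_part P I \<Longrightarrow> (\<lambda>i. - c i) \<in> levi_part P I"
  by (auto simp: levi_part_def)

lemma ideal_familyD:
  "\<Phi> \<in> ideal_family P I \<Longrightarrow> \<alpha> \<in> \<Phi> \<Longrightarrow> \<beta> \<in> P \<union> levi_part P I \<Longrightarrow> (\<lambda>i. \<alpha> i + \<beta> i) \<in> P \<Longrightarrow>
    (\<lambda>i. \<alpha> i + \<beta> i) \<in> \<Phi>"
  unfolding ideal_family_def by blast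

text \<open>Families closed under an order that is pulled back from the grid along \<open>t\<close> correspond to up-closed
  sets of cells, also when several \<open>q\<close> have the same cell or the same value under \<open>f\<close>.\<close>

lemma card_up_closed_families:
  fixes f :: "'q \<Rightarrow> 'c" and t :: "'q \<Rightarrow> nat \<times> nat"
  assumes det: "\<And>q q'. q \<in> Q \<Longrightarrow> q' \<in> Q \<Longrightarrow> f q = f q' \<Longrightarrow> t q = t q'"
  shows "card {\<Phi>. \<Phi> \<subseteq> f ` Q \<and> (\<forall>q\<in>Q. \<forall>q'\<in>Q. grid_le (t q) (t q') \<longrightarrow> f q \<in> \<Phi> \<longrightarrow> f q' \<in> \<Phi>)}
    = card (up_sets (t ` Q))"
proof -
  let ?f = "\<lambda>U. f ` {q \<in> Q. t q \<in> U}"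
  let ?A = "up_sets (t ` Q)"
  let ?B = "{\<Phi>. \<Phi> \<subseteq> f ` Q \<and> (\<forall>q\<in>Q. \<forall>q'\<in>Q. grid_le (t q) (t q') \<longrightarrow> f q \<in> \<Phi> \<longrightarrow> f q' \<in> \<Phi>)}"
  have mem: "f q \<in> ?f U \<longleftrightarrow> t q \<in> U" if "q \<in> Q" for q U
  proof
    assume "f q \<in> ?f U"
    then obtain q' where q': "q' \<in> Q" "t q' \<in> U" "f q = f q'"
      by blast
    then show "t q \<in> U" using det[OF that q'(1,3)] by simp
  qed (use that in blast)
  have "bij_betw ?f ?A ?B"
  proof (rule bij_betw_imageI)
    show "inj_on ?f ?A"
    proof (rule inj_onI)
      fix U V assume U: "U \<in> ?A" and V: "V \<in> ?A" and e: "?f U = ?f V"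
      have "t q \<in> U \<longleftrightarrow> t q \<in> V" if "q \<in> Q" for q
        unfolding mem[OF that, symmetric] e ..
      moreover have "U \<subseteq> t ` Q" "V \<subseteq> t ` Q"
        using U V by (auto simp: up_sets_def)
      ultimately show "U = V" by blast
    qed
    show "?f ` ?A = ?B"
    proof (intro antisym subsetI)
      fix \<Phi> assume "\<Phi> \<in> ?f ` ?A"
      then obtain U where U: "U \<in> ?A" "\<Phi> = ?f U" by blast
      have "\<Phi> \<subseteq> f ` Q" using U(2) by blast
      moreover have "f q' \<in> \<Phi>"
        if q: "q \<in> Q" "q' \<in> Q" "grid_le (t q) (t q')"
          "f q \<in> \<Phi>" for q q'
      proof -
        have "t q \<in> U" using mem[OF q(1)] q(4) U(2) by blast
        then have "t q' \<in> U" using U(1) q by (auto simp: up_sets_def)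
        then show ?thesis using mem[OF q(2)] U(2) by blast
      qed
      ultimately show "\<Phi> \<in> ?B" by blast
    next
      fix \<Phi> assume "\<Phi> \<in> ?B"
      then have \<Phi>: "\<Phi> \<subseteq> f ` Q"
        "\<And>q q'. q \<in> Q \<Longrightarrow> q' \<in> Q \<Longrightarrow> grid_le (t q) (t q') \<Longrightarrow>
          f q \<in> \<Phi> \<Longrightarrow> f q' \<in> \<Phi>"
        by blast+
      let ?U = "t ` {q \<in> Q. f q \<in> \<Phi>}"
      have refl: "grid_le b b" for b by (simp add: grid_le_def)
      have U_mem: "t q \<in> ?U \<longleftrightarrow> f q \<in> \<Phi>" if q: "q \<in> Q" for q
      proof
        assume "t q \<in> ?U"
        then obtain q0 where q0: "q0 \<in> Q" "f q0 \<in> \<Phi>" "t q = t q0"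
          by blast
        then show "f q \<in> \<Phi>" using \<Phi>(2)[OF q0(1) q _ q0(2)] refl[of "t q0"] by simp
      qed (use q in blast)
      have "?U \<in> ?A"
        unfolding up_sets_def
      proof (intro CollectI conjI ballI impI)
        fix u b assume "u \<in> ?U" "b \<in> t ` Q" "grid_le u b"
        then obtain q q' where q: "q \<in> Q" "f q \<in> \<Phi>" "u = t q"
          "q' \<in> Q" "b = t q'" by blast
        then have "f q' \<in> \<Phi>" using \<Phi>(2)[OF q(1,4)] \<open>grid_le u b\<close> by blast
        then show "b \<in> ?U" using q by blast
      qed blast
      moreover have "?f ?U = \<Phi>"
      proof (intro antisym subsetI)
        fix c assume c: "c \<in> \<Phi>"
        then obtain q where q: "q \<in> Q" "c = f q" using \<Phi>(1) by blast
        then show "c \<in> ?f ?U" using U_mem[OF q(1)] c by blast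
      next
        fix c assume "c \<in> ?f ?U"
        then obtain q where "q \<in> Q" "t q \<in> ?U" "c = f q" by blast
        then show "c \<in> \<Phi>" using U_mem by simp
      qed
      ultimately show "\<Phi> \<in> ?f ` ?A" by (intro image_eqI[of _ _ ?U]) (rule sym)
    qed
  qed
  then show ?thesis by (rule bij_betw_same_card[symmetric])
qed

text \<open>Cuts such that every root passing none of them is a combination of the simple roots in \<open>I\<close>.\<close>

locale cut_structure =
  fixes X :: classical_type and l :: nat and I J :: "nat set"
  assumes rank: "admissible_rank X l"
    and J_sub: "J \<subseteq> {1..<weight_count X l}"
    and uncut: "valid_pair X l x y \<Longrightarrow> J \<inter> {x..<y} = {} \<Longrightarrow> i \<notin> I \<Longrightarrow> root_vec X l x y i = 0"
begin

abbreviation M :: nat where "M \<equiv> weight_count X l"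
abbreviation P :: "(nat \<Rightarrow> int) set" where "P \<equiv> classical_positive X l"
abbreviation rv :: "nat \<Rightarrow> nat \<Rightarrow> nat \<Rightarrow> int" where "rv \<equiv> root_vec X l"
abbreviation bl :: "nat \<Rightarrow> nat" where "bl \<equiv> block J"

text \<open>For \<open>x \<noteq> y\<close> this says that the weights at \<open>x\<close> and \<open>y\<close> differ by a root.\<close>

definition compatible :: "nat \<Rightarrow> nat \<Rightarrow> bool" where
  "compatible x y \<longleftrightarrow> (X = TypeB \<or> X = TypeD \<longrightarrow> x + y \<noteq> M + 1)"

lemma finite_J: "finite J" using J_sub finite_subset by blast

lemma bl_mono: "x \<le> y \<Longrightarrow> bl x \<le> bl y" by (rule block_mono[OF finite_J])

lemma bl_less: "bl x < bl y \<Longrightarrow> x < y" using bl_mono by (meson leD leI)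

lemma valid_pair_iff: "valid_pair X l x y \<longleftrightarrow> 1 \<le> x \<and> x < y \<and> y \<le> M \<and> compatible x y"
  by (auto simp: valid_pair_def compatible_def)

lemma P_I: "valid_pair X l x y \<Longrightarrow> rv x y \<in> P"
  by (auto simp: classical_positive_def)

lemma levi_of_same_block:
  assumes "valid_pair X l x y" "bl x = bl y"
  shows "rv x y \<in> levi_part P I"
proof -
  have "J \<inter> {x..<y} = {}" using assms(2) block_less_iff[OF finite_J, of x y] by auto
  then show ?thesis using uncut[OF assms(1)] P_I[OF assms(1)] by (auto simp: levi_part_def)
qed

text \<open>Moving to the left, or to the right within a block, adds an element of \<open>\<Delta>\<^sup>+ \<union> \<Delta>\<^sub>I\<close>; this is what makes
  the two moves below available in every ideal.\<close>

lemma step_root: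
  assumes "1 \<le> x" "x \<le> M" "1 \<le> x'" "x' \<le> M" "x \<noteq> x'" "compatible x x'" "bl x' \<le> bl x"
  shows "rv x' x \<in> P \<union> levi_part P I"
proof (cases "x' < x")
  case True
  then have "valid_pair X l x' x" using assms by (auto simp: valid_pair_iff compatible_def)
  then show ?thesis using P_I by blast
next
  case False
  then have v: "valid_pair X l x x'" using assms by (auto simp: valid_pair_iff)
  have "bl x = bl x'" using bl_mono[of x x'] assms False by simp
  from levi_part_minus[OF levi_of_same_block[OF v this]]
  show ?thesis by (simp add: root_vec_def)
qed

lemma move_left:
  assumes \<Phi>: "\<Phi> \<in> ideal_family P I" and v: "valid_pair X l x y" "rv x y \<in> \<Phi>"
    and v': "valid_pair X l x' y" "compatible x x'" "bl x' \<le> bl x"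
  shows "rv x' y \<in> \<Phi>"
proof (cases "x = x'")
  case False
  have "rv x' x \<in> P \<union> levi_part P I"
    by (rule step_root) (use v(1) v' False in \<open>simp_all add: valid_pair_iff\<close>)
  moreover have "(\<lambda>i. rv x y i + rv x' x i) = rv x' y" by (auto simp: root_vec_def)
  ultimately show ?thesis using ideal_familyD[OF \<Phi> v(2)] P_I[OF v'(1)] by metis
qed (use v in simp)

lemma move_right:
  assumes \<Phi>: "\<Phi> \<in> ideal_family P I" and v: "valid_pair X l x y" "rv x y \<in> \<Phi>"
    and v': "valid_pair X l x y'" "compatible y y'" "bl y \<le> bl y'"
  shows "rv x y' \<in> \<Phi>"
proof (cases "y = y'")
  case False
  have "rv y y' \<in> P \<union> levi_part P I"
  proof (rule step_root)
    show "compatible y' y" using v'(2) by (simp add: compatible_def add.commute)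
  qed (use v(1) v' False in \<open>simp_all add: valid_pair_iff\<close>)
  moreover have "(\<lambda>i. rv x y i + rv y y' i) = rv x y'" by (auto simp: root_vec_def)
  ultimately show ?thesis using ideal_familyD[OF \<Phi> v(2)] P_I[OF v'(1)] by metis
qed (use v in simp)

lemma bl_eq: "x \<le> y \<Longrightarrow> J \<inter> {x..<y} = {} \<Longrightarrow> bl x = bl y"
  using block_less_iff[OF finite_J, of x y] bl_mono[of x y] by auto

lemma bl_lt: "k \<in> J \<Longrightarrow> x \<le> k \<Longrightarrow> k < y \<Longrightarrow> bl x < bl y"
  using block_less_iff[OF finite_J, of x y] by blast

definition proper :: "(nat \<times> nat) set \<Rightarrow> (nat \<times> nat) set" where
  "proper N = {(x, y) \<in> N. bl x < bl y}"

definition block_pair :: "nat \<times> nat \<Rightarrow> nat \<times> nat" where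
  "block_pair q = (bl (fst q), bl (snd q))"

text \<open>\<open>N\<close> contains a pair for each positive root, and the coefficients outside \<open>I\<close> of such a pair determine
  its blocks, monotonically.\<close>

definition representing_pairs :: "(nat \<times> nat) set \<Rightarrow> bool" where
  "representing_pairs N \<longleftrightarrow> P = case_prod rv ` N \<and> (\<forall>x y. (x, y) \<in> N \<longrightarrow> valid_pair X l x y) \<and>
     (\<forall>x y. (x, y) \<in> proper N \<longrightarrow> rv x y \<notin> levi_part P I) \<and>
     (\<forall>x y x' y'. (x, y) \<in> proper N \<longrightarrow> (x', y') \<in> N \<longrightarrow> (\<forall>i. i \<notin> I \<longrightarrow> rv x y i \<le> rv x' y' i) \<longrightarrow>
        bl x' \<le> bl x \<and> bl y \<le> bl y')"

definition block_closed :: "(nat \<times> nat) set \<Rightarrow> (nat \<Rightarrow> int) set \<Rightarrow> bool" where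
  "block_closed N \<Phi> \<longleftrightarrow> (\<forall>q\<in>proper N. \<forall>q'\<in>proper N. grid_le (block_pair q) (block_pair q') \<longrightarrow>
     case_prod rv q \<in> \<Phi> \<longrightarrow> case_prod rv q' \<in> \<Phi>)"

lemma block_closedD:
  assumes "block_closed N \<Phi>" "(x, y) \<in> proper N" "(x', y') \<in> proper N"
    "bl x' \<le> bl x" "bl y \<le> bl y'" "rv x y \<in> \<Phi>"
  shows "rv x' y' \<in> \<Phi>"
proof -
  have g: "grid_le (block_pair (x, y)) (block_pair (x', y'))"
    using assms by (simp add: grid_le_def block_pair_def)
  have m: "case_prod rv (x, y) \<in> \<Phi>" using assms by simp
  have "case_prod rv (x', y') \<in> \<Phi>"
    by (rule mp[OF mp[OF bspec[OF bspec[OF assms(1)[unfolded block_closed_def] assms(2)] assms(3)] g] m])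
  then show ?thesis by simp
qed

lemma block_closedI:
  assumes "\<And>x y x' y'. (x, y) \<in> proper N \<Longrightarrow> (x', y') \<in> proper N \<Longrightarrow> bl x' \<le> bl x \<Longrightarrow> bl y \<le> bl y' \<Longrightarrow>
    rv x y \<in> \<Phi> \<Longrightarrow> rv x' y' \<in> \<Phi>"
  shows "block_closed N \<Phi>"
  unfolding block_closed_def
proof (intro ballI impI)
  fix q q' assume q: "q \<in> proper N" "q' \<in> proper N" "grid_le (block_pair q) (block_pair q')"
    "case_prod rv q \<in> \<Phi>"
  obtain x y x' y' where "q = (x, y)" "q' = (x', y')" by (cases q; cases q') auto
  then show "case_prod rv q' \<in> \<Phi>"
    using assms[of x y x' y'] q by (simp add: grid_le_def block_pair_def)
qed

lemma ideal_subset_proper: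
  assumes N: "representing_pairs N" and \<Phi>: "\<Phi> \<in> ideal_family P I"
  shows "\<Phi> \<subseteq> case_prod rv ` proper N"
proof
  have sub: "\<Phi> \<subseteq> P - levi_part P I" using \<Phi> by (simp add: ideal_family_def)
  fix c assume c: "c \<in> \<Phi>"
  have PN: "P = case_prod rv ` N" using N by (simp add: representing_pairs_def)
  have "c \<in> P" using sub c by blast
  then obtain q where "q \<in> N" "c = case_prod rv q" unfolding PN by blast
  moreover obtain x y where "q = (x, y)" by (cases q)
  ultimately have xy: "(x, y) \<in> N" "c = rv x y" by simp_all
  have v: "valid_pair X l x y" using N xy(1) by (simp add: representing_pairs_def)
  have "bl x \<noteq> bl y" using levi_of_same_block[OF v] c xy(2) sub by blast
  moreover have "bl x \<le> bl y" using bl_mono v by (simp add: valid_pair_def)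
  ultimately have "(x, y) \<in> proper N" using xy(1) by (simp add: proper_def)
  then show "c \<in> case_prod rv ` proper N" using xy(2) by force
qed

text \<open>Adding an element of \<open>\<Delta>\<^sup>+ \<union> \<Delta>\<^sub>I\<close> does not decrease coefficients outside \<open>I\<close>, so the
  interval of blocks can only grow.\<close>

lemma block_closed_ideal:
  assumes N: "representing_pairs N" and sub: "\<Phi> \<subseteq> case_prod rv ` proper N" and closed: "block_closed N \<Phi>"
  shows "\<Phi> \<in> ideal_family P I"
proof -
  have PN: "P = case_prod rv ` N" using N by (simp add: representing_pairs_def)
  have mono: "bl x' \<le> bl x \<and> bl y \<le> bl y'"
    if "(x, y) \<in> proper N" "(x', y') \<in> N" "\<And>i. i \<notin> I \<Longrightarrow> rv x y i \<le> rv x' y' i" for x y x' y'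
    using N that unfolding representing_pairs_def by blast
  have "\<Phi> \<subseteq> P - levi_part P I"
  proof
    fix c assume "c \<in> \<Phi>"
    then obtain x y where "(x, y) \<in> proper N" "c = rv x y" using sub by auto
    then show "c \<in> P - levi_part P I"
      using N P_I by (auto simp: representing_pairs_def proper_def)
  qed
  moreover have "(\<lambda>i. \<alpha> i + \<beta> i) \<in> \<Phi>"
    if \<alpha>: "\<alpha> \<in> \<Phi>" and \<beta>: "\<beta> \<in> P \<union> levi_part P I" and s: "(\<lambda>i. \<alpha> i + \<beta> i) \<in> P" for \<alpha> \<beta>
  proof -
    obtain x y where xy: "(x, y) \<in> proper N" "\<alpha> = rv x y" using sub \<alpha> by auto
    obtain q where "q \<in> N" "(\<lambda>i. \<alpha> i + \<beta> i) = case_prod rv q" using s unfolding PN by blast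
    moreover obtain x' y' where "q = (x', y')" by (cases q)
    ultimately have xy': "(x', y') \<in> N" "(\<lambda>i. \<alpha> i + \<beta> i) = rv x' y'" by simp_all
    have \<beta>0: "\<beta> i \<ge> 0" if "i \<notin> I" for i
      using \<beta>
    proof
      assume "\<beta> \<in> P"
      then show ?thesis using root_vec_nonneg by (auto simp: classical_positive_def)
    next
      assume "\<beta> \<in> levi_part P I"
      then have "\<beta> i = 0" using that unfolding levi_part_def by blast
      then show ?thesis by simp
    qed
    have "rv x y i \<le> rv x' y' i" if "i \<notin> I" for i
      using \<beta>0[OF that] fun_cong[OF xy'(2), of i] xy(2) by simp
    then have le: "bl x' \<le> bl x \<and> bl y \<le> bl y'" by (rule mono[OF xy(1) xy'(1)])
    moreover have "bl x < bl y" using xy(1) by (simp add: proper_def)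
    ultimately have "(x', y') \<in> proper N" using xy'(1) by (simp add: proper_def)
    then have "rv x' y' \<in> \<Phi>" using block_closedD[OF closed xy(1)] le \<alpha> xy(2) by blast
    then show ?thesis using xy'(2) by simp
  qed
  ultimately show ?thesis by (simp add: ideal_family_def)
qed

text \<open>The condition \<open>C\<close> singles out the ideals that are closed under enlarging block intervals. It
  is kept general because in type D not all ideals are.\<close>

theorem card_ideals_by_blocks:
  assumes N: "representing_pairs N"
    and C: "\<And>\<Phi>. \<Phi> \<in> ideal_family P I \<Longrightarrow> C \<Phi> \<longleftrightarrow> block_closed N \<Phi>"
  shows "card {\<Phi> \<in> ideal_family P I. C \<Phi>} = card (up_sets (block_pair ` proper N))"
proof -
  have "{\<Phi> \<in> ideal_family P I. C \<Phi>} = {\<Phi>. \<Phi> \<subseteq> case_prod rv ` proper N \<and> block_closed N \<Phi>}"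
    using C ideal_subset_proper[OF N] block_closed_ideal[OF N] by blast
  also have "card \<dots> = card (up_sets (block_pair ` proper N))"
    unfolding block_closed_def
  proof (rule card_up_closed_families)
    fix q q' assume q: "q \<in> proper N" "q' \<in> proper N" "case_prod rv q = case_prod rv q'"
    obtain x y x' y' where e: "q = (x, y)" "q' = (x', y')" by (cases q; cases q') auto
    have xy: "(x, y) \<in> proper N" "(x', y') \<in> proper N" "(x, y) \<in> N" "(x', y') \<in> N" "rv x y = rv x' y'"
      using q e by (auto simp: proper_def)
    then have "bl x' \<le> bl x \<and> bl y \<le> bl y'" "bl x \<le> bl x' \<and> bl y' \<le> bl y"
      using N unfolding representing_pairs_def by (metis order_refl)+
    then show "block_pair q = block_pair q'" by (simp add: e block_pair_def)
  qed
  finally show ?thesis .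
qed

end

text \<open>The situation of types B, C and D: the cuts are symmetric under the mirror, and the crossing numbers of
  cuts can be read off from the coefficients outside \<open>I\<close>.\<close>

locale block_structure = cut_structure +
  assumes not_A: "X \<noteq> TypeA"
    and J_mirror: "k \<in> J \<Longrightarrow> weight_count X l - k \<in> J"
    and crossing: "k \<in> J \<Longrightarrow> 2 * k \<le> weight_count X l \<Longrightarrow> \<exists>K. finite K \<and> K \<inter> I = {} \<and>
      (\<forall>x y. (x, y) \<in> normal_pairs X l \<longrightarrow> crossings (weight_count X l) k x y = (\<Sum>i\<in>K. root_vec X l x y i))"
begin

abbreviation block_pairs :: "(nat \<times> nat) set" where
  "block_pairs \<equiv> proper (normal_pairs X l)"

text \<open>Closure under the one move that is not given by adding an element of \<open>\<Delta>\<^sup>+ \<union> \<Delta>\<^sub>I\<close>: from \<open>y\<close> to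
  its mirror, which adds \<open>2 \<epsilon>\<close>.\<close>

definition mirror_closed :: "(nat \<Rightarrow> int) set \<Rightarrow> bool" where
  "mirror_closed \<Phi> \<longleftrightarrow> (X = TypeB \<or> X = TypeD \<longrightarrow>
     (\<forall>x y. valid_pair X l x y \<longrightarrow> x + y \<le> M \<longrightarrow> bl x < bl y \<longrightarrow> bl y \<le> bl (M + 1 - y) \<longrightarrow>
       rv x y \<in> \<Phi> \<longrightarrow> rv x (M + 1 - y) \<in> \<Phi>))"

lemma block_pairs_iff: "(x, y) \<in> block_pairs \<longleftrightarrow> valid_pair X l x y \<and> x + y \<le> M + 1 \<and> bl x < bl y"
  by (auto simp: proper_def normal_pairs_def)

text \<open>Moving the two ends one after the other leads from one pair to any pair with a larger block
  interval. In types B and D the order of the moves is chosen so that the intermediate pair is not a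
  mirror pair, and a move of \<open>y\<close> to its own mirror is supplied by \<open>mirror_closed\<close>.\<close>

lemma reach_wider_pair:
  assumes \<Phi>: "\<Phi> \<in> ideal_family P I" and ex: "mirror_closed \<Phi>"
    and q: "(x, y) \<in> block_pairs" "rv x y \<in> \<Phi>" and q': "(x', y') \<in> block_pairs"
    and le: "bl x' \<le> bl x" "bl y \<le> bl y'"
  shows "rv x' y' \<in> \<Phi>"
proof -
  have v: "valid_pair X l x y" "x + y \<le> M + 1" "bl x < bl y"
    and v': "valid_pair X l x' y'" "x' + y' \<le> M + 1" "bl x' < bl y'"
    using q q' by (auto simp: block_pairs_iff)
  have lt: "x' < y" "x < y'" using bl_less le v(3) v'(3) by fastforce+
  show ?thesis
  proof (cases "X = TypeB \<or> X = TypeD")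
    case False
    then have comp: "compatible u w" for u w by (simp add: compatible_def)
    have v1: "valid_pair X l x' y" using v v' lt comp by (auto simp: valid_pair_iff)
    have "rv x' y \<in> \<Phi>" using move_left[OF \<Phi> v(1) q(2) v1 comp le(1)] .
    then show ?thesis using move_right[OF \<Phi> v1 _ v'(1) comp le(2)] by blast
  next
    case True
    have s: "x + y \<le> M" "x' + y' \<le> M" using v v' True by (auto simp: valid_pair_def)
    have cx: "compatible x x'" using s v(1) v'(1) by (auto simp: valid_pair_def compatible_def)
    show ?thesis
    proof (cases "compatible y y'")
      case cy: True
      show ?thesis
      proof (cases "compatible x' y")
        case c: True
        then have v1: "valid_pair X l x' y" using v v' lt by (auto simp: valid_pair_iff)
        have "rv x' y \<in> \<Phi>" using move_left[OF \<Phi> v(1) q(2) v1 cx le(1)] .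
        then show ?thesis using move_right[OF \<Phi> v1 _ v'(1) cy le(2)] by blast
      next
        case c: False
        then have "compatible x y'" using s by (auto simp: compatible_def)
        then have v1: "valid_pair X l x y'" using v v' lt by (auto simp: valid_pair_iff)
        have "rv x y' \<in> \<Phi>" using move_right[OF \<Phi> v(1) q(2) v1 cy le(2)] .
        then show ?thesis using move_left[OF \<Phi> v1 _ v'(1) cx le(1)] by blast
      qed
    next
      case False
      then have y': "y' = M + 1 - y" by (auto simp: compatible_def)
      have "rv x y' \<in> \<Phi>" using ex True v s(1) q(2) le(2) unfolding mirror_closed_def y' by blast
      moreover have "valid_pair X l x y'"
        using v v' lt True by (auto simp: valid_pair_def y')
      ultimately show ?thesis using move_left[OF \<Phi> _ _ v'(1) cx le(1)] by blast
    qed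
  qed
qed

text \<open>Crossing numbers are sums of coefficients outside \<open>I\<close>, so they grow with these.\<close>

lemma block_pairs_mono:
  assumes q: "(x, y) \<in> block_pairs" and q': "(x', y') \<in> normal_pairs X l"
    and le: "\<And>i. i \<notin> I \<Longrightarrow> rv x y i \<le> rv x' y' i"
  shows "bl x' \<le> bl x \<and> bl y \<le> bl y'"
proof (rule crossings_mono_block[OF finite_J J_sub J_mirror])
  fix k assume k: "k \<in> J" "2 * k \<le> M"
  obtain K where K: "finite K" "K \<inter> I = {}"
    "\<And>x y. (x, y) \<in> normal_pairs X l \<Longrightarrow> crossings M k x y = (\<Sum>i\<in>K. rv x y i)"
    using crossing[OF k] by blast
  have "(\<Sum>i\<in>K. rv x y i) \<le> (\<Sum>i\<in>K. rv x' y' i)" using le K(2) by (intro sum_mono) blast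
  then show "crossings M k x y \<le> crossings M k x' y'"
    using K(3)[OF q'] K(3)[of x y] q by (auto simp: proper_def)
qed (use q q' in \<open>auto simp: proper_def normal_pairs_def valid_pair_def\<close>)

lemma block_pairs_not_levi:
  assumes "(x, y) \<in> block_pairs" shows "rv x y \<notin> levi_part P I"
proof
  assume L: "rv x y \<in> levi_part P I"
  have n: "(x, y) \<in> normal_pairs X l" and b: "bl x < bl y" using assms by (auto simp: proper_def)
  obtain j where j: "j \<in> J" "x \<le> j" "j < y" using b block_less_iff[OF finite_J] by blast
  let ?k = "if 2 * j \<le> M then j else M - j"
  have jM: "j < M" using j J_sub by auto
  have k: "?k \<in> J" "2 * ?k \<le> M" using j J_mirror by auto
  obtain K where K: "finite K" "K \<inter> I = {}" "crossings M ?k x y = (\<Sum>i\<in>K. rv x y i)"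
    using crossing[OF k] n by blast
  have "(\<Sum>i\<in>K. rv x y i) = 0" using L K(2) by (intro sum.neutral) (auto simp: levi_part_def)
  moreover have "crossings M ?k x y \<ge> 1" using j jM by (auto simp: crossings_def)
  ultimately show False using K(3) by simp
qed

lemma representing_normal_pairs: "representing_pairs (normal_pairs X l)"
  unfolding representing_pairs_def
proof (intro conjI allI impI)
  show "P = case_prod rv ` normal_pairs X l" by (rule classical_positive_normal[OF not_A])
qed (use block_pairs_not_levi block_pairs_mono in \<open>auto simp: normal_pairs_def\<close>)

lemma mirror_closed_iff_block_closed:
  assumes \<Phi>: "\<Phi> \<in> ideal_family P I"
  shows "mirror_closed \<Phi> \<longleftrightarrow> block_closed (normal_pairs X l) \<Phi>"
proof
  assume m: "mirror_closed \<Phi>"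
  show "block_closed (normal_pairs X l) \<Phi>"
    by (rule block_closedI) (rule reach_wider_pair[OF \<Phi> m])
next
  assume closed: "block_closed (normal_pairs X l) \<Phi>"
  show "mirror_closed \<Phi>"
    unfolding mirror_closed_def
  proof (intro impI allI)
    fix x y assume v: "valid_pair X l x y" "x + y \<le> M" "bl x < bl y"
      and le: "bl y \<le> bl (M + 1 - y)" and m: "rv x y \<in> \<Phi>"
    have q: "(x, y) \<in> block_pairs" using v by (simp add: block_pairs_iff)
    have b: "bl x < bl (M + 1 - y)" using v(3) le by simp
    then have "(x, M + 1 - y) \<in> block_pairs"
      using bl_less[OF b] v by (auto simp: block_pairs_iff valid_pair_def)
    then show "rv x (M + 1 - y) \<in> \<Phi>" by (rule block_closedD[OF closed q _ order_refl le m])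
  qed
qed

theorem card_mirror_closed:
  "card {\<Phi> \<in> ideal_family P I. mirror_closed \<Phi>} = card (up_sets (block_pair ` block_pairs))"
  by (rule card_ideals_by_blocks[OF representing_normal_pairs mirror_closed_iff_block_closed])

text \<open>The blocks \<open>p\<close> left of the centre that are joined to their mirror block by a root: by some
  \<open>2 \<epsilon>\<close> in type C, otherwise by a sum \<open>\<epsilon> + \<epsilon>'\<close> of different weights of the block.\<close>

definition doubled_blocks :: "nat set" where
  "doubled_blocks = {p. 1 \<le> p \<and> 2 * p \<le> card J + 1 \<and>
     (X = TypeC \<or> (\<exists>x. 1 \<le> x \<and> x < M \<and> bl x = p \<and> bl (x + 1) = p))}"

text \<open>The mirror of block \<open>r\<close> is block \<open>n + 2 - r\<close>. Normal pairs satisfy \<open>p + r \<le> n + 2\<close>, and all such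
  cells with \<open>p < r\<close> occur, except that a cell with \<open>p + r = n + 2\<close> requires a root joining the block
  \<open>p\<close> to its mirror.\<close>

lemma block_pairs_image:
  "block_pair ` block_pairs = triangle (card J) \<union> antidiagonal (card J) doubled_blocks"
proof (intro antisym subsetI)
  let ?n = "card J"
  have M1: "1 \<le> M" using not_A rank by (cases X) auto
  have mir: "bl (M + 1 - x) + bl x = ?n + 2" if "1 \<le> x" "x \<le> M" for x
    by (rule block_mirror[OF J_sub J_mirror that])
  {
    fix b assume "b \<in> block_pair ` block_pairs"
    then obtain x y where xy: "(x, y) \<in> block_pairs" "b = (bl x, bl y)" by (auto simp: block_pair_def)
    then have v: "1 \<le> x" "x < y" "y \<le> M" "x + y \<le> M + 1" "bl x < bl y"
      by (auto simp: block_pairs_iff valid_pair_def)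
    have pos: "1 \<le> bl x" by (simp add: block_def)
    have "bl y \<le> bl (M + 1 - x)" using v by (intro bl_mono) auto
    then have le: "bl x + bl y \<le> ?n + 2" using mir[of x] v by simp
    show "b \<in> triangle ?n \<union> antidiagonal ?n doubled_blocks"
    proof (cases "bl x + bl y \<le> ?n + 1")
      case True
      then show ?thesis using xy(2) pos v(5) by (auto simp: triangle_def)
    next
      case False
      then have sum: "bl x + bl y = ?n + 2" using le by simp
      have "X = TypeC \<or> bl (x + 1) = bl x"
      proof (cases "X = TypeC")
        case F: False
        then have "X = TypeB \<or> X = TypeD" using not_A by (cases X) auto
        then have "x + y \<le> M" using xy(1) v(4) unfolding block_pairs_iff valid_pair_def by auto
        then have "x + 1 \<le> M + 1 - y" by simp
        then have "bl (x + 1) \<le> bl (M + 1 - y)" by (rule bl_mono)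
        also have "bl (M + 1 - y) = bl x" using mir[of y] v sum by simp
        finally show ?thesis using bl_mono[of x "x + 1"] by simp
      qed simp
      then have "bl x \<in> doubled_blocks"
        unfolding doubled_blocks_def using pos sum v by (auto intro!: exI[of _ x])
      moreover have "b = (bl x, ?n + 2 - bl x)" using sum xy(2) by simp
      ultimately show ?thesis by (auto simp: antidiagonal_def)
    qed
  next
    fix b assume "b \<in> triangle ?n \<union> antidiagonal ?n doubled_blocks"
    then show "b \<in> block_pair ` block_pairs"
    proof
      assume "b \<in> triangle ?n"
      then obtain p r where b: "b = (p, r)" "1 \<le> p" "p < r" "p + r \<le> ?n + 1" by (auto simp: triangle_def)
      obtain x where x: "1 \<le> x" "x \<le> M" "bl x = p" using block_onto[OF J_sub M1, of p] b by auto
      obtain z where z: "1 \<le> z" "z \<le> M" "bl z = ?n + 2 - r"       proof -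
        have "1 \<le> ?n + 2 - r" "?n + 2 - r \<le> ?n + 1" using b by auto
        then show ?thesis using block_onto[OF J_sub M1] that by blast
      qed
      have y: "bl (M + 1 - z) = r" using mir[of z] z b by simp
      have "x < z" using bl_less[of x z] x z b by simp
      moreover have "x < M + 1 - z" using bl_less[of x "M + 1 - z"] x y b by simp
      ultimately have "(x, M + 1 - z) \<in> block_pairs"
        using x z y b by (auto simp: block_pairs_iff valid_pair_def)
      then show ?thesis using b(1) x y by (force simp: block_pair_def)
    next
      assume "b \<in> antidiagonal ?n doubled_blocks"
      then obtain p where p: "p \<in> doubled_blocks" "b = (p, ?n + 2 - p)" by (auto simp: antidiagonal_def)
      then have p1: "1 \<le> p" "2 * p \<le> ?n + 1" by (auto simp: doubled_blocks_def)
      have "\<exists>x z. 1 \<le> x \<and> x \<le> z \<and> z \<le> M \<and> bl x = p \<and> bl z = p \<and> (X = TypeC \<or> x < z)"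
      proof (cases "X = TypeC")
        case True
        then show ?thesis using block_onto[OF J_sub M1, of p] p1 by auto
      next
        case False
        then obtain x where "1 \<le> x" "x < M" "bl x = p" "bl (x + 1) = p"
          using p(1) by (auto simp: doubled_blocks_def)
        then show ?thesis by (intro exI[of _ x] exI[of _ "x + 1"]) auto
      qed
      then obtain x z where xz: "1 \<le> x" "x \<le> z" "z \<le> M" "bl x = p" "bl z = p" "X = TypeC \<or> x < z"
        by blast
      have y: "bl (M + 1 - z) = ?n + 2 - p" using mir[of z] xz p1 by simp
      have "x < M + 1 - z" using bl_less[of x "M + 1 - z"] xz y p1 by simp
      then have "(x, M + 1 - z) \<in> block_pairs"
        using xz y p1 by (auto simp: block_pairs_iff valid_pair_def)
      then show ?thesis using p(2) xz y by (force simp: block_pair_def)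
    qed
  }
qed

theorem card_mirror_closed_ballot:
  "int (card {\<Phi> \<in> ideal_family P I. mirror_closed \<Phi>})
    = int (card J choose (card J div 2)) + (\<Sum>p\<in>doubled_blocks. ballot (card J) (p - 1))"
  unfolding card_mirror_closed block_pairs_image
  by (rule card_up_sets_ballot) (auto simp: doubled_blocks_def)

end

section \<open>The cuts in types B, C and D\<close>

text \<open>The steps belonging to simple roots outside \<open>I\<close>, where the steps \<open>k\<close> and \<open>M - k\<close> belong to the same
  simple root. In type D step \<open>l\<close> is attributed to \<open>\<alpha>\<^sub>l\<close>, although passing it also changes
  the coefficient of \<open>\<alpha>\<^sub>l\<^sub>-\<^sub>1\<close>.\<close>

definition cut_set :: "nat \<Rightarrow> nat set \<Rightarrow> nat set" where
  "cut_set M I = {k \<in> {1..<M}. min k (M - k) \<notin> I}"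

lemma cut_set_mirror: "k \<in> cut_set M I \<Longrightarrow> M - k \<in> cut_set M I"
  by (auto simp: cut_set_def min.commute)

lemma finite_cut_set [simp]: "finite (cut_set M I)"
  by (simp add: cut_set_def)

lemma cut_set_low: "k \<in> cut_set M I \<longleftrightarrow> k \<notin> I" if "1 \<le> k" "2 * k \<le> M"
  using that by (auto simp: cut_set_def)

lemma cut_set_high: "M - k \<in> cut_set M I \<longleftrightarrow> k \<notin> I" if "1 \<le> k" "2 * k \<le> M"
  using that by (auto simp: cut_set_def)

lemma card_cut_set:
  "card (cut_set M I) = 2 * card {k. 1 \<le> k \<and> 2 * k < M \<and> k \<notin> I} + of_bool (\<exists>k\<ge>1. 2 * k = M \<and> k \<notin> I)"
proof -
  let ?A = "{k. 1 \<le> k \<and> 2 * k < M \<and> k \<notin> I}"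
  let ?B = "{k. 1 \<le> k \<and> 2 * k = M \<and> k \<notin> I}"
  have fin: "finite ?A" by (rule finite_subset[of _ "{..M}"]) auto
  have eq: "cut_set M I = ?A \<union> (\<lambda>k. M - k) ` ?A \<union> ?B"
  proof (intro antisym subsetI)
    fix k assume "k \<in> cut_set M I"
    then have k: "1 \<le> k" "k < M" "min k (M - k) \<notin> I" by (auto simp: cut_set_def)
    consider "2 * k < M" | "2 * k = M" | "2 * k > M" by linarith
    then show "k \<in> ?A \<union> (\<lambda>k. M - k) ` ?A \<union> ?B"
    proof cases
      case 3
      then have "min k (M - k) = M - k" by simp
      then have "M - k \<in> ?A" using k 3 by auto
      moreover have "k = M - (M - k)" using k by simp
      ultimately show ?thesis by blast
    next
      case 1
      then have "min k (M - k) = k" by simp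
      then show ?thesis using k 1 by auto
    next
      case 2
      then have "min k (M - k) = k" by simp
      then show ?thesis using k 2 by auto
    qed
  qed (auto simp: cut_set_def min_def)
  have inj: "inj_on (\<lambda>k. M - k) ?A" by (rule inj_onI) auto
  have "card (?A \<union> (\<lambda>k. M - k) ` ?A) = 2 * card ?A"
    by (subst card_Un_disjoint) (use fin inj in \<open>auto simp: card_image\<close>)
  moreover have "?B = (if \<exists>k\<ge>1. 2 * k = M \<and> k \<notin> I then {M div 2} else {})" by auto
  then have B: "card ?B = of_bool (\<exists>k\<ge>1. 2 * k = M \<and> k \<notin> I)" "finite ?B" by simp_all
  moreover have "card (?A \<union> (\<lambda>k. M - k) ` ?A \<union> ?B) = card (?A \<union> (\<lambda>k. M - k) ` ?A) + card ?B"
    by (rule card_Un_disjoint) (use fin B(2) in auto)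
  ultimately show ?thesis using eq by simp
qed

text \<open>Coefficients as numbers of passed steps. In type D the coefficient of \<open>\<alpha>\<^sub>l\<^sub>-\<^sub>1\<close> counts step \<open>l\<close> with
  sign \<open>-1\<close>.\<close>

lemma root_vec_passed:
  assumes "x \<le> y"
  shows "X = TypeB \<Longrightarrow> 1 \<le> i \<Longrightarrow> i \<le> l \<Longrightarrow> root_vec X l x y i =
      of_bool (x \<le> i \<and> i < y) + of_bool (x \<le> 2 * l + 1 - i \<and> 2 * l + 1 - i < y)"
    and "X = TypeC \<or> X = TypeD \<Longrightarrow> 1 \<le> i \<Longrightarrow> i < l \<Longrightarrow> X = TypeD \<longrightarrow> i + 1 \<noteq> l \<Longrightarrow> root_vec X l x y i =
      of_bool (x \<le> i \<and> i < y) + of_bool (x \<le> 2 * l - i \<and> 2 * l - i < y)"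
    and "X = TypeC \<or> X = TypeD \<Longrightarrow> 1 \<le> l \<Longrightarrow> root_vec X l x y l = of_bool (x \<le> l \<and> l < y)"
    and "X = TypeD \<Longrightarrow> 1 \<le> i \<Longrightarrow> l = Suc i \<Longrightarrow> root_vec X l x y i =
      of_bool (x \<le> i \<and> i < y) - of_bool (x \<le> l \<and> l < y) + of_bool (x \<le> l + 1 \<and> l + 1 < y)"
  using passed_diff[OF assms, of i] passed_diff[OF assms, of l] passed_diff[OF assms, of "l + 1"]
    passed_diff[OF assms, of "2 * l + 1 - i"] passed_diff[OF assms, of "2 * l - i"]
  by (auto simp: root_vec_def depth_def)

lemma block_structure_B:
  assumes "admissible_rank TypeB l"
  shows "block_structure TypeB l I (cut_set (2 * l + 1) I)"
proof
  show "TypeB \<noteq> TypeA" "admissible_rank TypeB l" using assms by simp_all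
  show "cut_set (2 * l + 1) I \<subseteq> {1..<weight_count TypeB l}" by (auto simp: cut_set_def)
  show "weight_count TypeB l - k \<in> cut_set (2 * l + 1) I" if "k \<in> cut_set (2 * l + 1) I" for k
    using cut_set_mirror[OF that] by simp
next
  fix x y i assume v: "valid_pair TypeB l x y" and e: "cut_set (2 * l + 1) I \<inter> {x..<y} = {}" and i: "i \<notin> I"
  show "root_vec TypeB l x y i = 0"
  proof (cases "i \<in> {1..l}")
    case True
    then have "i \<in> cut_set (2 * l + 1) I" "2 * l + 1 - i \<in> cut_set (2 * l + 1) I"
      using i cut_set_low[of i "2 * l + 1"] cut_set_high[of i "2 * l + 1"] by auto
    then have "\<not> (x \<le> i \<and> i < y)" "\<not> (x \<le> 2 * l + 1 - i \<and> 2 * l + 1 - i < y)" using e by auto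
    then show ?thesis using root_vec_passed(1)[of x y TypeB i l] v True by (auto simp: valid_pair_def)
  qed (auto simp: root_vec_def depth_def)
next
  fix k assume k: "k \<in> cut_set (2 * l + 1) I" "2 * k \<le> weight_count TypeB l"
  then have k': "1 \<le> k" "k \<le> l" "k \<notin> I" by (auto simp: cut_set_def min_def split: if_splits)
  have "crossings (2 * l + 1) k x y = root_vec TypeB l x y k" if "(x, y) \<in> normal_pairs TypeB l" for x y
  proof -
    have "2 * k \<noteq> 2 * l + 1" by presburger
    moreover have "x \<le> y" using that by (auto simp: normal_pairs_def valid_pair_def)
    ultimately show ?thesis using root_vec_passed(1)[of x y TypeB k l] k' by (simp add: crossings_def)
  qed
  then show "\<exists>K. finite K \<and> K \<inter> I = {} \<and> (\<forall>x y. (x, y) \<in> normal_pairs TypeB l \<longrightarrow>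
      crossings (weight_count TypeB l) k x y = sum (root_vec TypeB l x y) K)"
    using k' by (intro exI[of _ "{k}"]) auto
qed

text \<open>In type D with \<open>\<alpha>\<^sub>l\<^sub>-\<^sub>1\<close> and \<open>\<alpha>\<^sub>l\<close> outside \<open>I\<close> the cut \<open>l\<close> may be dropped, since the only pair passing
  just this step is a mirror pair; both choices of cuts will be used. The crossing
  number of \<open>l - 1\<close> is then the sum of the coefficients of \<open>\<alpha>\<^sub>l\<^sub>-\<^sub>1\<close> and \<open>\<alpha>\<^sub>l\<close>. With only
  \<open>\<alpha>\<^sub>l\<close> in \<open>I\<close> this fails: the pair \<open>(l - 1, l + 1)\<close> represents \<open>\<alpha>\<^sub>l\<close> but passes the cut \<open>l - 1\<close>.\<close>

lemma block_structure_CD: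
  assumes X: "X = TypeC \<or> X = TypeD" and rank: "admissible_rank X l"
    and J: "J = cut_set (2 * l) I \<or> X = TypeD \<and> l - 1 \<notin> I \<and> l \<notin> I \<and> J = cut_set (2 * l) I - {l}"
    and D: "X = TypeD \<Longrightarrow> l - 1 \<in> I \<or> l \<notin> I"
  shows "block_structure X l I J"
proof
  have l2: "l \<ge> 2" using X rank by auto
  have M: "weight_count X l = 2 * l" using X by auto
  show "X \<noteq> TypeA" "admissible_rank X l" using X rank by auto
  show "J \<subseteq> {1..<weight_count X l}" using J M by (auto simp: cut_set_def)
  show "weight_count X l - k \<in> J" if "k \<in> J" for k
    using J cut_set_mirror[of k "2 * l" I] that M by (auto simp: cut_set_def)
  have memJ: "k \<in> J" "2 * l - k \<in> J" if "1 \<le> k" "k < l" "k \<notin> I" for k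
    using J cut_set_low[of k "2 * l" I] cut_set_high[of k "2 * l" I] that by auto
  {
    fix x y i assume v: "valid_pair X l x y" and e: "J \<inter> {x..<y} = {}" and i: "i \<notin> I"
    have xy: "x \<le> y" using v by (simp add: valid_pair_def)
    have out: "\<not> (x \<le> k \<and> k < y)" if "k \<in> J" for k using e that by auto
    have outl: "\<not> (x \<le> l \<and> l < y)" if "l \<notin> I"
    proof (cases "l \<in> J")
      case False
      have "l \<in> cut_set (2 * l) I" using cut_set_low[of l "2 * l" I] l2 that by simp
      then have D: "X = TypeD" "l - 1 \<notin> I" using J False by auto
      then have "l - 1 \<in> J" "l + 1 \<in> J" using memJ[of "l - 1"] l2 by auto
      then have "\<not> (x \<le> l - 1 \<and> l - 1 < y)" "\<not> (x \<le> l + 1 \<and> l + 1 < y)" using out by blast+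
      moreover have "x + y \<noteq> 2 * l + 1" using v D by (simp add: valid_pair_def)
      ultimately show ?thesis by auto
    qed (use out in blast)
    consider "i \<notin> {1..l}" | "i = l" | "1 \<le> i" "i < l" "X = TypeD \<longrightarrow> i + 1 \<noteq> l" | "X = TypeD" "l = Suc i" by fastforce
    then show "root_vec X l x y i = 0"
    proof cases
      case 1
      then show ?thesis by (auto simp: root_vec_def depth_def)
    next
      case 2
      then show ?thesis using root_vec_passed(3)[OF xy X] outl i l2 by simp
    next
      case 3
      then show ?thesis using root_vec_passed(2)[OF xy X 3] out memJ[OF 3(1,2) i] by simp
    next
      case 4
      then have "l \<notin> I" using D i by auto
      moreover have "i \<in> J" "l + 1 \<in> J" using memJ[of i] i 4 l2 by auto
      ultimately show ?thesis using root_vec_passed(4)[OF xy 4(1) _ 4(2)] outl out 4 l2 by auto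
    qed
  next
    fix k assume k: "k \<in> J" "2 * k \<le> weight_count X l"
    then have k': "1 \<le> k" "k \<le> l" "k \<notin> I" using J M by (auto simp: cut_set_def min_def split: if_splits)
    show "\<exists>K. finite K \<and> K \<inter> I = {} \<and> (\<forall>x y. (x, y) \<in> normal_pairs X l \<longrightarrow>
      crossings (weight_count X l) k x y = sum (root_vec X l x y) K)"
    proof (cases "X = TypeD \<and> l = Suc k")
      case True
      then have "l \<notin> I" using D k' by auto
      moreover have "crossings (2 * l) k x y = root_vec X l x y k + root_vec X l x y l" if "x \<le> y" for x y
      proof -
        have "2 * l - k = l + 1" "2 * k \<noteq> 2 * l" using True by auto
        then show ?thesis
          using root_vec_passed(3)[OF that X] root_vec_passed(4)[OF that, of X k l] True k' by (simp add: crossings_def)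
      qed
      ultimately show ?thesis using k' True M
        by (intro exI[of _ "{k, l}"]) (auto simp: normal_pairs_def valid_pair_def)
    next
      case False
      have "crossings (2 * l) k x y = root_vec X l x y k" if "x \<le> y" for x y
      proof (cases "k = l")
        case True
        then show ?thesis using root_vec_passed(3)[OF that X] l2 by (simp add: crossings_def)
      next
        case ne: False
        then show ?thesis using root_vec_passed(2)[OF that X k'(1)] k' False by (auto simp: crossings_def)
      qed
      then show ?thesis using k' M
        by (intro exI[of _ "{k}"]) (auto simp: normal_pairs_def valid_pair_def)
    qed
  }
qed

context block_structure
begin

text \<open>The move from \<open>y\<close> to its mirror splits into two admissible moves when there is a third position
  \<open>z\<close> in a block between them.\<close>

lemma mirror_closed_via:
  assumes \<Phi>: "\<Phi> \<in> ideal_family P I" and v: "valid_pair X l x y" "rv x y \<in> \<Phi>" "bl x < bl y"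
    and le: "bl y \<le> bl z" "bl z \<le> bl (M + 1 - y)" and z: "z + y \<noteq> M + 1" "z \<noteq> y" "z \<le> M" "x + z \<noteq> M + 1"
  shows "rv x (M + 1 - y) \<in> \<Phi>"
proof -
  have b: "bl x < bl z" "bl x < bl (M + 1 - y)" using v(3) le by auto
  have v1: "valid_pair X l x z" using v(1) z bl_less[OF b(1)] by (auto simp: valid_pair_def)
  have "rv x z \<in> \<Phi>"
    by (rule move_right[OF \<Phi> v(1,2) v1 _ le(1)]) (use z in \<open>simp add: compatible_def add.commute\<close>)
  moreover have "valid_pair X l x (M + 1 - y)" using v(1) bl_less[OF b(2)] by (auto simp: valid_pair_def)
  moreover have "compatible z (M + 1 - y)" using z v(1) by (auto simp: compatible_def valid_pair_def)
  ultimately show ?thesis using move_right[OF \<Phi> v1 _ _ _ le(2)] by blast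
qed

lemma mirror_closedD:
  assumes "mirror_closed \<Phi>" "X = TypeB \<or> X = TypeD" "valid_pair X l x y" "x + y \<le> M"
    "bl x < bl y" "bl y \<le> bl (M + 1 - y)" "rv x y \<in> \<Phi>"
  shows "rv x (M + 1 - y) \<in> \<Phi>"
  using assms unfolding mirror_closed_def by blast

lemma mirror_closed_C: "X = TypeC \<Longrightarrow> mirror_closed \<Phi>"
  unfolding mirror_closed_def by auto

text \<open>The position \<open>l + 1\<close> of the zero weight lies between \<open>y\<close> and its mirror.\<close>

lemma mirror_closed_B:
  assumes XB: "X = TypeB" and \<Phi>: "\<Phi> \<in> ideal_family P I"
  shows "mirror_closed \<Phi>"
  unfolding mirror_closed_def
proof (intro impI allI)
  fix x y assume v: "valid_pair X l x y" "x + y \<le> M" "bl x < bl y" "bl y \<le> bl (M + 1 - y)" "rv x y \<in> \<Phi>"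
  have M: "M = 2 * l + 1" using XB by simp
  have x: "x \<le> l" using v(1,2) M by (simp add: valid_pair_def)
  show "rv x (M + 1 - y) \<in> \<Phi>"
  proof (cases "y = l + 1")
    case True
    then show ?thesis using v(5) M by simp
  next
    case False
    have "bl y \<le> bl (l + 1) \<and> bl (l + 1) \<le> bl (M + 1 - y)"
    proof (cases "y \<le> l + 1")
      case True
      then show ?thesis using M by (auto intro!: bl_mono)
    next
      case h: False
      have "bl (M + 1 - y) \<le> bl (l + 1)" "bl (l + 1) \<le> bl y" using h M by (auto intro!: bl_mono)
      then show ?thesis using v(4) by auto
    qed
    then show ?thesis
      using mirror_closed_via[OF \<Phi> v(1,5,3), of "l + 1"] False x M by simp
  qed
qed

text \<open>The positions \<open>l - 1\<close> and \<open>l\<close> are in the same central block, and one of them is neither \<open>y\<close> nor its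
  mirror.\<close>

lemma mirror_closed_D:
  assumes XD: "X = TypeD" and J: "l - 1 \<notin> J" and \<Phi>: "\<Phi> \<in> ideal_family P I"
  shows "mirror_closed \<Phi>"
  unfolding mirror_closed_def
proof (intro impI allI)
  fix x y assume v: "valid_pair X l x y" "x + y \<le> M" "bl x < bl y" "bl y \<le> bl (M + 1 - y)" "rv x y \<in> \<Phi>"
  have M: "M = 2 * l" and l: "l \<ge> 4" using XD rank by auto
  have b1: "bl (l - 1) = bl l" 
  proof (rule bl_eq)
    have "{l - 1..<l} = {l - 1}" using l by auto
    then show "J \<inter> {l - 1..<l} = {}" using J by simp
  qed simp
  \<comment> \<open>\<open>z\<close> must differ from \<open>y\<close> and from its mirror\<close>
  let ?z = "if y = l \<or> y = l + 1 then l - 1 else l"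
  have "bl y \<le> bl ?z \<and> bl ?z \<le> bl (M + 1 - y)"
  proof -
    consider "y < l" | "y = l" | "y = l + 1" | "y > l + 1" by linarith
    then show ?thesis
    proof cases
      case 1
      then show ?thesis using M by (auto intro!: bl_mono)
    next
      case 2
      then show ?thesis using b1 M by (auto intro!: bl_mono)
    next
      case 3
      then have "bl (l + 1) \<le> bl l" using v(4) M by simp
      then show ?thesis using 3 b1 M by simp
    next
      case 4
      have "bl (M + 1 - y) \<le> bl l" "bl l \<le> bl y" using 4 M by (auto intro!: bl_mono)
      then show ?thesis using v(4) 4 by auto
    qed
  qed
  moreover have "x < l" using v(1,2) M XD by (auto simp: valid_pair_def)
  ultimately show "rv x (M + 1 - y) \<in> \<Phi>"
  proof -
    assume b: "bl y \<le> bl ?z \<and> bl ?z \<le> bl (M + 1 - y)" and "x < l"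
    have "?z + y \<noteq> M + 1 \<and> ?z \<noteq> y \<and> ?z \<le> M \<and> x + ?z \<noteq> M + 1"
      using \<open>x < l\<close> M l by (cases "y = l"; cases "y = l + 1") auto
    then show ?thesis using mirror_closed_via[OF \<Phi> v(1,5,3), of ?z] b by blast
  qed
qed

text \<open>The first elements of those maximal runs of \<open>I\<close> that are separated from the centre by a cut.\<close>

definition run_starts :: "nat set" where
  "run_starts = {m \<in> I. 1 \<le> m \<and> m < l \<and> m - 1 \<notin> I \<and> (\<exists>k\<in>J. m \<le> k \<and> k \<le> l)}"

text \<open>A block left of the centre with two or more positions consists of a maximal run of \<open>I\<close> and the position after
  it; its number is one more than the number of cuts before the run.\<close>

lemma sum_doubled_blocks:
  assumes X: "X \<noteq> TypeC" and J: "\<And>k. 1 \<le> k \<Longrightarrow> k < l \<Longrightarrow> k \<in> J \<longleftrightarrow> k \<notin> I" and I0: "0 \<notin> I"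
  shows "(\<Sum>p\<in>doubled_blocks. f (p - 1)) = (\<Sum>m\<in>run_starts. f (card ({1..<m} - I)))"
proof -
  have XBD: "X = TypeB \<or> X = TypeD" using X not_A by (cases X) auto
  have M: "2 * l \<le> M" "M \<le> 2 * l + 1" using XBD by auto
  have bl_card: "bl m = Suc (card ({1..<m} - I))" if "m \<le> l" for m
  proof -
    have "J \<inter> {..<m} = {1..<m} - I" using J J_sub that by auto
    then show ?thesis by (simp add: block_def)
  qed
  have mir: "bl (M + 1 - x) + bl x = card J + 2" if "1 \<le> x" "x \<le> M" for x
    by (rule block_mirror[OF J_sub J_mirror that])
  have "doubled_blocks = bl ` run_starts"
  proof (intro antisym subsetI)
    fix p assume "p \<in> doubled_blocks"
    then obtain x where x: "1 \<le> x" "x < M" "bl x = p" "bl (x + 1) = p" and p: "2 * p \<le> card J + 1"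
      using X by (auto simp: doubled_blocks_def)
    have xJ: "x \<notin> J" using bl_lt[of x x "x + 1"] x by auto
    have "bl x < bl (M + 1 - x)" using mir[of x] x p by simp
    then obtain k0 where k0: "k0 \<in> J" "x \<le> k0" "k0 < M + 1 - x" using block_less_iff[OF finite_J] by blast
    \<comment> \<open>a cut in the left half, by symmetry of the cuts\<close>
    define k where "k = (if 2 * k0 \<le> M then k0 else M - k0)"
    have k: "k \<in> J" "x \<le> k" "2 * k \<le> M" using k0 J_mirror[OF k0(1)] J_sub by (auto simp: k_def)
    have "k \<noteq> x" using xJ k by auto
    then have xl: "x < k" "k \<le> l" using k M by auto
    have xI: "x \<in> I" using J[of x] x xJ xl by auto
    \<comment> \<open>the start of the run of \<open>I\<close> containing \<open>x\<close>\<close>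
    define m where "m = (LEAST m. 1 \<le> m \<and> {m..x} \<subseteq> I)"
    have Q: "1 \<le> x \<and> {x..x} \<subseteq> I" using xI x by simp
    have m: "1 \<le> m" "{m..x} \<subseteq> I" unfolding m_def using LeastI[of "\<lambda>m. 1 \<le> m \<and> {m..x} \<subseteq> I", OF Q] by auto
    have mx: "m \<le> x" unfolding m_def by (rule Least_le) (rule Q)
    have "m - 1 \<notin> I"
    proof
      assume mI: "m - 1 \<in> I"
      then have "1 \<le> m - 1" using I0 by (cases "m - 1") auto
      moreover have "{m - 1..x} \<subseteq> I"
      proof
        fix u assume "u \<in> {m - 1..x}"
        then show "u \<in> I" using mI m(2) by (cases "u = m - 1") auto
      qed
      ultimately have "m \<le> m - 1" unfolding m_def by (intro Least_le) auto
      then show False using m(1) by simp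
    qed
    moreover have "m \<in> I" using m(2) mx by auto
    moreover have "m < l" "m \<le> k" using mx xl by auto
    ultimately have "m \<in> run_starts" using m(1) k(1) xl(2) unfolding run_starts_def by blast
    moreover have "bl m = bl x"
    proof (rule bl_eq[OF mx])
      have "u \<notin> J" if "m \<le> u" "u < x" for u
      proof -
        have "u \<in> {m..x}" using that by simp
        then have "u \<in> I" using m(2) by blast
        then show ?thesis using J[of u] that m(1) xl by simp
      qed
      then show "J \<inter> {m..<x} = {}" by auto
    qed
    then have "p = bl m" using x(3) by simp
    ultimately show "p \<in> bl ` run_starts" by blast
  next
    fix p assume "p \<in> bl ` run_starts"
    then obtain m where m: "m \<in> run_starts" "p = bl m" by blast
    then have mI: "m \<in> I" "1 \<le> m" "m < l" by (auto simp: run_starts_def)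
    obtain k where k: "k \<in> J" "m \<le> k" "k \<le> l" using m(1) by (auto simp: run_starts_def)
    have "m \<notin> J" using J[of m] mI by blast
    then have "bl (m + 1) = bl m" using bl_eq[of m "m + 1"] by (simp add: atLeastLessThanSuc)
    moreover have "bl m < bl (M + 1 - m)" using bl_lt[OF k(1,2), of "M + 1 - m"] k mI M \<open>m \<notin> J\<close>
      by (cases "k = m") auto
    then have "2 * p \<le> card J + 1" using mir[of m] mI M m(2) by simp
    moreover have "1 \<le> p" using m(2) by (simp add: block_def)
    ultimately show "p \<in> doubled_blocks"
      unfolding doubled_blocks_def using m(2) mI M by (auto intro!: exI[of _ m])
  qed
  moreover have "inj_on bl run_starts"
  proof -
    have "bl m < bl m'" if "m \<in> run_starts" "m' \<in> run_starts" "m < m'" for m m'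
    proof -
      have *: "m \<in> I" "m' - 1 \<notin> I" "m' < l" using that by (auto simp: run_starts_def)
      then have "m \<noteq> m' - 1" by auto
      then have "m' - 1 \<in> J" using J[of "m' - 1"] * that by auto
      then show ?thesis using bl_lt[of "m' - 1" m m'] that by auto
    qed
    then show ?thesis by (intro inj_onI) (metis less_irrefl linorder_neqE_nat)
  qed
  ultimately have "(\<Sum>p\<in>doubled_blocks. f (p - 1)) = (\<Sum>m\<in>run_starts. f (bl m - 1))"
    by (simp add: sum.reindex)
  also have "\<dots> = (\<Sum>m\<in>run_starts. f (card ({1..<m} - I)))"
    by (intro sum.cong refl) (auto simp: run_starts_def bl_card)
  finally show ?thesis .
qed

end

text \<open>The centre is a position and not a step, so the cuts come in mirror pairs and their number is \<open>2 d\<close>.\<close>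

theorem card_ideal_family_B:
  assumes rank: "admissible_rank TypeB l" and I: "I \<subseteq> {1..l}"
  defines "d \<equiv> l - card I"
  shows "int (card (ideal_family (classical_positive TypeB l) I)) = int ((2 * d) choose d)
    + (\<Sum>m | m \<in> I \<and> m - 1 \<notin> I \<and> \<not> {m..l} \<subseteq> I. ballot (2 * d) (card ({1..<m} - I)))"
proof -
  let ?J = "cut_set (2 * l + 1) I"
  interpret block_structure TypeB l I ?J by (rule block_structure_B[OF rank])
  have "{k. 1 \<le> k \<and> 2 * k < 2 * l + 1 \<and> k \<notin> I} = {1..l} - I" by auto
  moreover have "\<not> (\<exists>k\<ge>1. 2 * k = 2 * l + 1 \<and> k \<notin> I)" by presburger
  ultimately have cJ: "card ?J = 2 * d"
    using card_cut_set[of "2 * l + 1" I] I by (simp add: d_def card_Diff_subset finite_subset)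
  have all: "{\<Phi> \<in> ideal_family P I. mirror_closed \<Phi>} = ideal_family P I"
    using mirror_closed_B by blast
  have "run_starts = {m. m \<in> I \<and> m - 1 \<notin> I \<and> \<not> {m..l} \<subseteq> I}"
  proof -
    have "(\<exists>k\<in>?J. m \<le> k \<and> k \<le> l) \<longleftrightarrow> \<not> {m..l} \<subseteq> I" if "1 \<le> m" for m
      using cut_set_low[of _ "2 * l + 1" I] that by force
    moreover have "m < l" if "m \<in> I" "\<not> {m..l} \<subseteq> I" for m
      using that I by (cases "m = l") force+
    moreover have "1 \<le> m" if "m \<in> I" for m using that I by auto
    ultimately show ?thesis unfolding run_starts_def by blast
  qed
  moreover have "(\<Sum>p\<in>doubled_blocks. ballot (2 * d) (p - 1))
      = (\<Sum>m\<in>run_starts. ballot (2 * d) (card ({1..<m} - I)))"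
    by (rule sum_doubled_blocks) (use I cut_set_low[of _ "2 * l + 1" I] in auto)
  ultimately show ?thesis using card_mirror_closed_ballot unfolding all cJ by simp
qed

section \<open>Counting the ideals in each type\<close>

theorem card_ideal_family_A:
  assumes rank: "admissible_rank TypeA l" and I: "I \<subseteq> {1..l}"
  shows "int (card (ideal_family (classical_positive TypeA l) I))
    = ballot (2 * (l - card I + 1)) (l - card I + 1)"
proof -
  define J where "J = {1..l} - I"
  have mem_J: "k \<in> J \<longleftrightarrow> 1 \<le> k \<and> k \<le> l \<and> k \<notin> I" for k by (auto simp: J_def)
  have rv: "root_vec TypeA l x y i = of_bool (i \<in> {1..l} \<and> x \<le> i \<and> i < y)" if "x \<le> y" for x y i
    using passed_diff[OF that, of i] by (auto simp: root_vec_def depth_def)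
  interpret cut_structure TypeA l I J
  proof
    fix x y i assume v: "valid_pair TypeA l x y" and e: "J \<inter> {x..<y} = {}" and i: "i \<notin> I"
    have "\<not> (i \<in> {1..l} \<and> x \<le> i \<and> i < y)"
    proof
      assume "i \<in> {1..l} \<and> x \<le> i \<and> i < y"
      then have "i \<in> J \<inter> {x..<y}" using i by (simp add: mem_J)
      then show False using e by blast
    qed
    then show "root_vec TypeA l x y i = 0" using rv[of x y i] v by (simp add: valid_pair_def)
  qed (use rank in \<open>auto simp: mem_J\<close>)
  define N where "N = {(x, y). valid_pair TypeA l x y}"
  have v_iff: "valid_pair TypeA l x y \<longleftrightarrow> 1 \<le> x \<and> x < y \<and> y \<le> l + 1" for x y
    by (simp add: valid_pair_def)
  have comp: "compatible x y" for x y by (simp add: compatible_def)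
  have proper_iff: "(x, y) \<in> proper N \<longleftrightarrow> valid_pair TypeA l x y \<and> bl x < bl y" for x y
    by (simp add: proper_def N_def)
  have mono: "bl x' \<le> bl x \<and> bl y \<le> bl y'"
    if v: "valid_pair TypeA l x y" "valid_pair TypeA l x' y'" and b: "bl x < bl y"
      and le: "\<And>i. i \<notin> I \<Longrightarrow> rv x y i \<le> rv x' y' i" for x y x' y'
  proof -
    have xy: "x \<le> y" "x' \<le> y'" using v by (auto simp: v_iff)
    have cut: "x' \<le> k \<and> k < y'" if "k \<in> J" "x \<le> k" "k < y" for k
      using le[of k] that rv[OF xy(1), of k] rv[OF xy(2), of k] by (auto simp: mem_J split: if_splits)
    obtain j where j: "j \<in> J" "x \<le> j" "j < y" using b block_less_iff[OF finite_J] by blast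
    have "bl x' \<le> bl x"
    proof (rule ccontr)
      assume "\<not> ?thesis"
      then obtain k where k: "k \<in> J" "x \<le> k" "k < x'" using block_less_iff[OF finite_J, of x x'] by auto
      show False using cut[OF k(1,2)] cut[OF j] k j by linarith
    qed
    moreover have "bl y \<le> bl y'"
    proof (rule ccontr)
      assume "\<not> ?thesis"
      then obtain k where k: "k \<in> J" "y' \<le> k" "k < y" using block_less_iff[OF finite_J, of y' y] by auto
      show False using cut[OF k(1) _ k(3)] cut[OF j] k j by linarith
    qed
    ultimately show ?thesis ..
  qed
  have "representing_pairs N"
    unfolding representing_pairs_def
  proof (intro conjI allI impI)
    show "P = case_prod rv ` N" by (auto simp: classical_positive_def N_def)
    show "rv x y \<notin> levi_part P I" if q: "(x, y) \<in> proper N" for x y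
    proof
      assume L: "rv x y \<in> levi_part P I"
      have xy: "x \<le> y" "bl x < bl y" using q by (auto simp: proper_iff v_iff)
      obtain j where j: "j \<in> J" "x \<le> j" "j < y" using xy(2) block_less_iff[OF finite_J] by blast
      then have "rv x y j = 1" using rv[OF xy(1), of j] by (simp add: mem_J)
      then show False using L j(1) by (auto simp: levi_part_def mem_J)
    qed
    show "bl x' \<le> bl x" "bl y \<le> bl y'"
      if "(x, y) \<in> proper N" "(x', y') \<in> N" "\<forall>i. i \<notin> I \<longrightarrow> rv x y i \<le> rv x' y' i" for x y x' y'
      using mono[of x y x' y'] that(1)[unfolded proper_iff] that(2,3) by (auto simp: N_def)
  qed (simp add: N_def)
  moreover have "block_closed N \<Phi>" if \<Phi>: "\<Phi> \<in> ideal_family P I" for \<Phi>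
  proof (rule block_closedI)
    fix x y x' y' assume q: "(x, y) \<in> proper N" "(x', y') \<in> proper N"
      and le: "bl x' \<le> bl x" "bl y \<le> bl y'" and m: "rv x y \<in> \<Phi>"
    have v: "valid_pair TypeA l x y" "valid_pair TypeA l x' y'" "bl x < bl y"
      using q by (auto simp: proper_iff)
    have "bl x' < bl y" using v(3) le(1) by simp
    then have v1: "valid_pair TypeA l x' y"
      using v(1,2) bl_less[of x' y] unfolding v_iff by simp
    have "rv x' y \<in> \<Phi>" using move_left[OF \<Phi> v(1) m v1 comp le(1)] .
    then show "rv x' y' \<in> \<Phi>" by (rule move_right[OF \<Phi> v1 _ v(2) comp le(2)])
  qed
  ultimately have e1: "card {\<Phi> \<in> ideal_family P I. True} = card (up_sets (block_pair ` proper N))"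
    by (intro card_ideals_by_blocks) simp_all
  have e2: "block_pair ` proper N = {(p, y). 1 \<le> p \<and> p < y \<and> y \<le> card J + 1}"
  proof (intro antisym subsetI)
    fix b assume "b \<in> block_pair ` proper N"
    moreover have "bl y \<le> card J + 1" for y
      unfolding block_def using card_mono[OF finite_J, of "J \<inter> {..<y}"] by simp
    ultimately show "b \<in> {(p, y). 1 \<le> p \<and> p < y \<and> y \<le> card J + 1}"
      by (auto simp: block_pair_def proper_def block_def)
  next
    fix b assume "b \<in> {(p, y). 1 \<le> p \<and> p < y \<and> y \<le> card J + 1}"
    then obtain p r where b: "b = (p, r)" "1 \<le> p" "p < r" "r \<le> card J + 1" by blast
    have J: "J \<subseteq> {1..<l + 1}" by (auto simp: mem_J)
    obtain x where x: "1 \<le> x" "x \<le> l + 1" "bl x = p" using block_onto[OF J, of p] b by auto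
    obtain y where y: "1 \<le> y" "y \<le> l + 1" "bl y = r" using block_onto[OF J, of r] b by auto
    have "x < y" using bl_less[of x y] x y b by simp
    then have "(x, y) \<in> proper N" using x y b by (simp add: proper_iff v_iff)
    then show "b \<in> block_pair ` proper N" using b(1) x(3) y(3) by (force simp: block_pair_def)
  qed
  have "int (card (ideal_family P I)) = ballot (2 * (card J + 1)) (card J + 1)"
    using e1 card_up_sets_staircase[of "card J + 1"] unfolding e2 by simp
  moreover have "card J = l - card I" using I by (simp add: J_def card_Diff_subset finite_subset)
  ultimately show ?thesis by simp
qed

lemma card_cut_set_even:
  assumes "1 \<le> l" "I \<subseteq> {1..l}"
  shows "card (cut_set (2 * l) I) = (if l \<in> I then 2 * (l - card I) else 2 * (l - card I) - 1)"
    and "l \<notin> I \<Longrightarrow> 1 \<le> l - card I"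
proof -
  have fin: "finite I" using assms(2) finite_subset by blast
  have d: "card ({1..l} - I) = l - card I" using assms(2) fin by (simp add: card_Diff_subset)
  have e: "{k. 1 \<le> k \<and> 2 * k < 2 * l \<and> k \<notin> I} = {1..<l} - I" by auto
  have mid: "(\<exists>k\<ge>1. 2 * k = 2 * l \<and> k \<notin> I) \<longleftrightarrow> l \<notin> I" using assms(1) by auto
  have "l - card I = card ({1..<l} - I) + of_bool (l \<notin> I)"
  proof (cases "l \<in> I")
    case True
    then have "{1..l} - I = {1..<l} - I" by (auto simp: le_less)
    then show ?thesis using d True by simp
  next
    case False
    then have "{1..l} - I = insert l ({1..<l} - I)" using assms(1) by (auto simp: le_less)
    then have "card ({1..l} - I) = Suc (card ({1..<l} - I))" by simp
    then show ?thesis using d False by simp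
  qed
  then show "card (cut_set (2 * l) I) = (if l \<in> I then 2 * (l - card I) else 2 * (l - card I) - 1)"
    and "l \<notin> I \<Longrightarrow> 1 \<le> l - card I"
    unfolding card_cut_set e mid by auto
qed

text \<open>Every block left of the centre is doubled, so the sum telescopes. The centre is a cut if and only if
  \<open>\<alpha>\<^sub>l\<close> is not in \<open>I\<close>.\<close>

theorem card_ideal_family_C:
  assumes rank: "admissible_rank TypeC l" and I: "I \<subseteq> {1..l}"
  defines "d \<equiv> l - card I"
  shows "int (card (ideal_family (classical_positive TypeC l) I))
    = int (if l \<in> I then (2 * d + 1) choose d else (2 * d) choose d)"
proof -
  let ?J = "cut_set (2 * l) I"
  interpret block_structure TypeC l I ?J by (rule block_structure_CD) (use rank in auto)
  have l1: "1 \<le> l" using rank by simp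
  have cJ: "card ?J = (if l \<in> I then 2 * d else 2 * d - 1)"
    using card_cut_set_even(1)[OF l1 I] by (simp add: d_def)
  have all: "{\<Phi> \<in> ideal_family P I. mirror_closed \<Phi>} = ideal_family P I"
    using mirror_closed_C by blast
  have "doubled_blocks = Suc ` {..<(card ?J + 1) div 2}"
  proof (intro antisym subsetI)
    fix p assume "p \<in> doubled_blocks"
    then have "p = Suc (p - 1)" "p - 1 < (card ?J + 1) div 2" by (auto simp: doubled_blocks_def)
    then show "p \<in> Suc ` {..<(card ?J + 1) div 2}" by blast
  qed (auto simp: doubled_blocks_def)
  then have sum: "(\<Sum>p\<in>doubled_blocks. ballot (card ?J) (p - 1)) = (\<Sum>v<(card ?J + 1) div 2. ballot (card ?J) v)"
    by (simp add: sum.reindex)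
  have N: "int (card (ideal_family P I)) = int (card ?J choose (card ?J div 2))
      + (\<Sum>v<(card ?J + 1) div 2. ballot (card ?J) v)"
    using card_mirror_closed_ballot unfolding all sum .
  show ?thesis
  proof (cases "l \<in> I")
    case True
    show ?thesis
    proof (cases d)
      case 0
      then show ?thesis using N cJ True by simp
    next
      case (Suc e)
      have "(\<Sum>v<d. ballot (2 * d) v) = int ((2 * d) choose e)"
        using sum_ballot[of "2 * d" e] Suc by (simp add: lessThan_Suc_atMost)
      moreover have "(2 * d + 1) choose d = (2 * d choose e) + (2 * d choose d)"
        using Suc by simp
      ultimately show ?thesis using N cJ True by simp
    qed
  next
    case False
    then obtain e where e: "d = Suc e" using card_cut_set_even(2)[OF l1 I] by (cases d) (auto simp: d_def)
    have "(\<Sum>v<d. ballot (2 * d - 1) v) = int ((2 * d - 1) choose e)"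
      using sum_ballot[of "2 * d - 1" e] e by (simp add: lessThan_Suc_atMost)
    moreover have "(2 * d) choose d = (2 * d - 1 choose e) + (2 * d - 1 choose d)" using e by simp
    moreover have "(2 * d - 1 choose d) = (2 * d - 1 choose e)"
      using binomial_symmetric[of d "2 * d - 1"] e by simp
    ultimately show ?thesis using N cJ False e by simp
  qed
qed

theorem card_ideal_family_D_fork:
  assumes rank: "admissible_rank TypeD l" and I: "I \<subseteq> {1..l}" and fork: "l - 1 \<in> I"
  defines "n \<equiv> if l \<in> I then 2 * (l - card I) else 2 * (l - card I) - 1"
  shows "int (card (ideal_family (classical_positive TypeD l) I)) = int (n choose (n div 2))
    + (\<Sum>m | m \<in> I \<and> m - 1 \<notin> I \<and> m < l \<and> \<not> {m..l} \<subseteq> I. ballot n (card ({1..<m} - I)))"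
proof -
  let ?J = "cut_set (2 * l) I"
  interpret block_structure TypeD l I ?J by (rule block_structure_CD) (use rank fork in auto)
  have l: "4 \<le> l" using rank by simp
  have cJ: "card ?J = n"
    using card_cut_set_even(1)[OF _ I] l by (simp add: n_def)
  have "l - 1 \<notin> ?J" using fork cut_set_low[of "l - 1" "2 * l" I] l by simp
  then have all: "{\<Phi> \<in> ideal_family P I. mirror_closed \<Phi>} = ideal_family P I"
    using mirror_closed_D by blast
  have "run_starts = {m. m \<in> I \<and> m - 1 \<notin> I \<and> m < l \<and> \<not> {m..l} \<subseteq> I}"
  proof -
    have "(\<exists>k\<in>?J. m \<le> k \<and> k \<le> l) \<longleftrightarrow> \<not> {m..l} \<subseteq> I" if "1 \<le> m" for m
      using cut_set_low[of _ "2 * l" I] that by force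
    moreover have "1 \<le> m" if "m \<in> I" for m using that I by auto
    ultimately show ?thesis unfolding run_starts_def by blast
  qed
  moreover have "(\<Sum>p\<in>doubled_blocks. ballot n (p - 1)) = (\<Sum>m\<in>run_starts. ballot n (card ({1..<m} - I)))"
    by (rule sum_doubled_blocks) (use I cut_set_low[of _ "2 * l" I] in auto)
  ultimately show ?thesis using card_mirror_closed_ballot unfolding all cJ by simp
qed

text \<open>The diagram automorphism of type D. On positions it interchanges \<open>l\<close> and \<open>l + 1\<close>, that is,
  the weights \<open>\<epsilon>\<^sub>l\<close> and \<open>- \<epsilon>\<^sub>l\<close>.\<close>

definition fork_swap :: "nat \<Rightarrow> (nat \<Rightarrow> int) \<Rightarrow> nat \<Rightarrow> int" where
  "fork_swap l c = (\<lambda>i. c (adj_swap (l - 1) i))"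

lemma fork_swap_swap [simp]: "fork_swap l (fork_swap l c) = c"
  by (simp add: fork_swap_def)

lemma fork_swap_root_vec:
  assumes "4 \<le> l" "valid_pair TypeD l x y"
  shows "fork_swap l (root_vec TypeD l x y) = root_vec TypeD l (adj_swap l x) (adj_swap l y)"
    and "valid_pair TypeD l (adj_swap l x) (adj_swap l y)"
proof -
  have s: "adj_swap (l - 1) i = (if i + 1 = l then l else if i = l then l - 1 else i)" for i
    using assms(1) by (auto simp: adj_swap_def)
  have d: "depth TypeD l (adj_swap l z) i = depth TypeD l z (adj_swap (l - 1) i)" for z i
  proof -
    consider "i = l" | "l = Suc i" | "i \<noteq> l" "i + 1 \<noteq> l" by fastforce
    then show ?thesis
    proof cases
      case 1
      obtain k where k: "l = Suc k" "3 \<le> k" using assms(1) that[of "l - 1"] by auto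
      then have "adj_swap (l - 1) i = k" using s[of i] 1 by simp
      then show ?thesis using k 1 by (simp add: depth_def passed_adj_swap)
    next
      case 2
      then have "adj_swap (l - 1) i = l" using s[of i] by simp
      then show ?thesis using 2 assms(1) by (simp add: depth_def passed_adj_swap)
    next
      case 3
      then have "i \<in> {1..l} \<Longrightarrow> 2 * l - i \<noteq> l" by auto
      moreover have "adj_swap (l - 1) i = i" using s[of i] 3 by simp
      ultimately show ?thesis using 3 assms(1) by (simp add: depth_def passed_adj_swap)
    qed
  qed
  show "fork_swap l (root_vec TypeD l x y) = root_vec TypeD l (adj_swap l x) (adj_swap l y)"
    by (simp add: fork_swap_def root_vec_def d)
  have v: "1 \<le> x" "x < y" "y \<le> 2 * l" "x + y \<noteq> 2 * l + 1" using assms(2) by (auto simp: valid_pair_def)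
  have "adj_swap l x < adj_swap l y" by (rule adj_swap_less) (use v in auto)
  moreover have "adj_swap l x + adj_swap l y \<noteq> 2 * l + 1" using v by (auto simp: adj_swap_def)
  ultimately show "valid_pair TypeD l (adj_swap l x) (adj_swap l y)"
    using v adj_swap_lower[of x l] adj_swap_upper[of y "2 * l" l] assms(1) by (auto simp: valid_pair_def)
qed

lemma fork_swap_positive:
  assumes "4 \<le> l" shows "fork_swap l c \<in> classical_positive TypeD l \<longleftrightarrow> c \<in> classical_positive TypeD l"
proof -
  have *: "fork_swap l c \<in> classical_positive TypeD l" if "c \<in> classical_positive TypeD l" for c
    using that fork_swap_root_vec[OF assms] unfolding classical_positive_def by blast
  show ?thesis using *[of c] *[of "fork_swap l c"] by auto
qed

lemma fork_swap_levi:
  assumes "4 \<le> l"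
  shows "fork_swap l c \<in> levi_part (classical_positive TypeD l) (adj_swap (l - 1) ` I)
    \<longleftrightarrow> c \<in> levi_part (classical_positive TypeD l) I"
proof -
  have 1: "(\<lambda>i. - fork_swap l c i) = fork_swap l (\<lambda>i. - c i)" by (simp add: fork_swap_def)
  have 2: "(\<forall>i. fork_swap l c i \<noteq> 0 \<longrightarrow> i \<in> adj_swap (l - 1) ` I) \<longleftrightarrow> (\<forall>i. c i \<noteq> 0 \<longrightarrow> i \<in> I)"
  proof
    assume L: "\<forall>i. fork_swap l c i \<noteq> 0 \<longrightarrow> i \<in> adj_swap (l - 1) ` I"
    show "\<forall>i. c i \<noteq> 0 \<longrightarrow> i \<in> I"
    proof (intro allI impI)
      fix i assume "c i \<noteq> 0"
      then have "fork_swap l c (adj_swap (l - 1) i) \<noteq> 0" by (simp add: fork_swap_def)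
      then obtain j where "j \<in> I" "adj_swap (l - 1) i = adj_swap (l - 1) j" using L by blast
      then show "i \<in> I" by (simp add: adj_swap_eq_iff)
    qed
  next
    assume L: "\<forall>i. c i \<noteq> 0 \<longrightarrow> i \<in> I"
    show "\<forall>i. fork_swap l c i \<noteq> 0 \<longrightarrow> i \<in> adj_swap (l - 1) ` I"
    proof (intro allI impI)
      fix i assume "fork_swap l c i \<noteq> 0"
      then have "adj_swap (l - 1) i \<in> I" using L by (simp add: fork_swap_def)
      then show "i \<in> adj_swap (l - 1) ` I" by (intro image_eqI[of _ _ "adj_swap (l - 1) i"]) simp_all
    qed
  qed
  show ?thesis unfolding levi_part_def mem_Collect_eq 1 2 fork_swap_positive[OF assms] ..
qed

lemma fork_swap_ideal_family:
  assumes l: "4 \<le> l" and \<Phi>: "\<Phi> \<in> ideal_family (classical_positive TypeD l) I"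
  shows "fork_swap l ` \<Phi> \<in> ideal_family (classical_positive TypeD l) (adj_swap (l - 1) ` I)"
proof -
  let ?P = "classical_positive TypeD l"
  have sub: "\<Phi> \<subseteq> ?P - levi_part ?P I" using \<Phi> by (simp add: ideal_family_def)
  have "fork_swap l ` \<Phi> \<subseteq> ?P - levi_part ?P (adj_swap (l - 1) ` I)"
    using sub fork_swap_positive[OF l] fork_swap_levi[OF l] by blast
  moreover have "(\<lambda>i. \<alpha> i + \<beta> i) \<in> fork_swap l ` \<Phi>"
    if \<alpha>: "\<alpha> \<in> fork_swap l ` \<Phi>" and \<beta>: "\<beta> \<in> ?P \<union> levi_part ?P (adj_swap (l - 1) ` I)"
      and s: "(\<lambda>i. \<alpha> i + \<beta> i) \<in> ?P" for \<alpha> \<beta>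
  proof -
    obtain \<alpha>' where \<alpha>': "\<alpha>' \<in> \<Phi>" "\<alpha> = fork_swap l \<alpha>'" using \<alpha> by blast
    let ?\<beta>' = "fork_swap l \<beta>"
    have e: "(\<lambda>i. \<alpha> i + \<beta> i) = fork_swap l (\<lambda>i. \<alpha>' i + ?\<beta>' i)"
      unfolding \<alpha>'(2) by (simp add: fork_swap_def)
    have "?\<beta>' \<in> ?P \<union> levi_part ?P I"
      using \<beta> fork_swap_positive[OF l, of \<beta>] fork_swap_levi[OF l, of ?\<beta>' I] by auto
    moreover have "(\<lambda>i. \<alpha>' i + ?\<beta>' i) \<in> ?P" using s unfolding e fork_swap_positive[OF l] .
    ultimately have "(\<lambda>i. \<alpha>' i + ?\<beta>' i) \<in> \<Phi>" by (rule ideal_familyD[OF \<Phi> \<alpha>'(1)])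
    then show ?thesis unfolding e by (rule imageI)
  qed
  ultimately show ?thesis unfolding ideal_family_def by blast
qed

lemma adj_swap_image_image [simp]: "adj_swap k ` adj_swap k ` I = I"
  by (simp add: image_image)

lemma card_ideal_family_fork_swap:
  assumes l: "4 \<le> l"
  shows "card (ideal_family (classical_positive TypeD l) (adj_swap (l - 1) ` I))
    = card (ideal_family (classical_positive TypeD l) I)"
proof -
  have inv: "fork_swap l ` fork_swap l ` \<Phi> = \<Phi>" for \<Phi> by (simp add: image_image)
  have "bij_betw ((`) (fork_swap l)) (ideal_family (classical_positive TypeD l) I)
      (ideal_family (classical_positive TypeD l) (adj_swap (l - 1) ` I))"
  proof (rule bij_betw_byWitness[where f' = "(`) (fork_swap l)"])
    show "(`) (fork_swap l) ` ideal_family (classical_positive TypeD l) (adj_swap (l - 1) ` I)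
        \<subseteq> ideal_family (classical_positive TypeD l) I"
      using fork_swap_ideal_family[OF l, of _ "adj_swap (l - 1) ` I"] by auto
  qed (use fork_swap_ideal_family[OF l] inv in auto)
  then show ?thesis by (rule bij_betw_same_card[symmetric])
qed

lemma finite_ideal_family: "finite (ideal_family (classical_positive X l) I)"
proof (rule finite_subset)
  show "ideal_family (classical_positive X l) I \<subseteq> Pow (classical_positive X l)"
    by (auto simp: ideal_family_def)
  have "classical_positive X l \<subseteq> (\<lambda>(x, y). root_vec X l x y) ` ({..weight_count X l} \<times> {..weight_count X l})"
    by (force simp: classical_positive_def valid_pair_def)
  then show "finite (Pow (classical_positive X l))" using finite_subset by (simp add: finite_subset)
qed

text \<open>With neither \<open>\<alpha>\<^sub>l\<^sub>-\<^sub>1\<close> nor \<open>\<alpha>\<^sub>l\<close> in \<open>I\<close>, the positions \<open>l\<close> and \<open>l + 1\<close>, which carry \<open>\<epsilon>\<^sub>l\<close> and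
  \<open>- \<epsilon>\<^sub>l\<close>, cannot be reached from each other. Call an ideal \<open>up\<close> if with every
  \<open>\<epsilon>\<^sub>x - \<epsilon>\<^sub>l\<close> it contains \<open>\<epsilon>\<^sub>x + \<epsilon>\<^sub>l\<close>, and \<open>down\<close> if the converse holds. Every ideal is \<open>up\<close> or \<open>down\<close>, and the
  diagram automorphism exchanges the two kinds. The \<open>up\<close> ideals are those closed for the full set of
  cuts, and the ideals of both kinds those closed when \<open>l\<close> is not a cut.\<close>

theorem card_ideal_family_D_open:
  assumes rank: "admissible_rank TypeD l" and I: "I \<subseteq> {1..l}" and nf: "l - 1 \<notin> I" "l \<notin> I"
  defines "d \<equiv> l - card I"
  shows "int (card (ideal_family (classical_positive TypeD l) I)) =
    2 * int ((2 * d - 1) choose (d - 1)) - int ((2 * d - 2) choose (d - 1))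
    + (\<Sum>m | m \<in> I \<and> m - 1 \<notin> I. 2 * ballot (2 * d - 1) (card ({1..<m} - I))
        - ballot (2 * d - 2) (card ({1..<m} - I)))"
    and "2 \<le> d"
proof -
  have l: "4 \<le> l" using rank by simp
  let ?P = "classical_positive TypeD l"
  let ?J = "cut_set (2 * l) I"
  let ?Jm = "?J - {l}"
  let ?F = "ideal_family ?P I"
  have fin: "finite I" using I finite_subset by blast
  have "{l - 1, l} \<subseteq> {1..l} - I" using nf l by auto
  then have "card {l - 1, l} \<le> card ({1..l} - I)" by (intro card_mono) auto
  then show d2: "2 \<le> d" using I fin l by (simp add: d_def card_Diff_subset)
  define up where "up \<Phi> \<longleftrightarrow> (\<forall>x. 1 \<le> x \<longrightarrow> x < l \<longrightarrow> root_vec TypeD l x l \<in> \<Phi> \<longrightarrow> root_vec TypeD l x (l + 1) \<in> \<Phi>)"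
    for \<Phi> :: "(nat \<Rightarrow> int) set"
  define down where "down \<Phi> \<longleftrightarrow> (\<forall>x. 1 \<le> x \<longrightarrow> x < l \<longrightarrow> root_vec TypeD l x (l + 1) \<in> \<Phi> \<longrightarrow> root_vec TypeD l x l \<in> \<Phi>)"
    for \<Phi> :: "(nat \<Rightarrow> int) set"
  interpret s: block_structure TypeD l I ?J by (rule block_structure_CD) (use rank nf in auto)
  interpret m: block_structure TypeD l I ?Jm by (rule block_structure_CD) (use rank nf in auto)
  have "1 \<le> l - 1" "2 * (l - 1) \<le> 2 * l" "1 \<le> l" using l by auto
  then have J: "l - 1 \<in> ?J" "l \<in> ?J"
    using nf cut_set_low[of "l - 1" "2 * l" I] cut_set_low[of l "2 * l" I] by blast+
  have "l - 1 \<noteq> l" using l by simp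
  then have J0: "l - 1 \<in> ?Jm" "l \<notin> ?Jm" using J by blast+
  have vl: "valid_pair TypeD l x l" "valid_pair TypeD l x (l + 1)" if "1 \<le> x" "x < l" for x
    using that by (auto simp: valid_pair_def)
  have s_iff: "s.mirror_closed \<Phi> \<longleftrightarrow> up \<Phi>" if \<Phi>: "\<Phi> \<in> ?F" for \<Phi>
  proof
    assume mc: "s.mirror_closed \<Phi>"
    show "up \<Phi>"
      unfolding up_def
    proof (intro allI impI)
      fix x assume x: "1 \<le> x" "x < l" "root_vec TypeD l x l \<in> \<Phi>"
      have "s.bl x < s.bl l" using s.bl_lt[OF J(1), of x l] x by simp
      moreover have "s.bl l \<le> s.bl (l + 1)" by (rule s.bl_mono) simp
      ultimately show "root_vec TypeD l x (l + 1) \<in> \<Phi>"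
        using s.mirror_closedD[OF mc _ vl(1)[OF x(1,2)]] x by simp
    qed
  next
    assume u: "up \<Phi>"
    show "s.mirror_closed \<Phi>"
      unfolding s.mirror_closed_def
    proof (intro impI allI)
      fix x y assume v: "valid_pair TypeD l x y" "x + y \<le> s.M" "s.bl x < s.bl y" "s.bl y \<le> s.bl (s.M + 1 - y)"
        "root_vec TypeD l x y \<in> \<Phi>"
      have x: "1 \<le> x" "x < l" using v(1,2) by (auto simp: valid_pair_def)
      have "y \<le> l"
      proof (rule ccontr)
        assume "\<not> y \<le> l"
        then have "s.bl (s.M + 1 - y) < s.bl y" using s.bl_lt[OF J(2), of "s.M + 1 - y" y] by simp
        then show False using v(4) by simp
      qed
      show "root_vec TypeD l x (s.M + 1 - y) \<in> \<Phi>"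
      proof (cases "y = l")
        case True
        then show ?thesis using u x v(5) by (simp add: up_def)
      next
        case False
        have "s.bl y \<le> s.bl l" "s.bl l \<le> s.bl (s.M + 1 - y)" using \<open>y \<le> l\<close> False by (auto intro!: s.bl_mono)
        then show ?thesis
          using s.mirror_closed_via[OF \<Phi> v(1,5,3), of l] \<open>y \<le> l\<close> False x by simp
      qed
    qed
  qed
  have m_iff: "m.mirror_closed \<Phi> \<longleftrightarrow> up \<Phi> \<and> down \<Phi>" if \<Phi>: "\<Phi> \<in> ?F" for \<Phi>
  proof
    have bl: "m.bl (l + 1) = m.bl l"
      using m.bl_eq[of l "l + 1"] J0(2) by (simp add: atLeastLessThanSuc)
    assume mc: "m.mirror_closed \<Phi>"
    have lt: "m.bl x < m.bl l" if "x < l" for x using m.bl_lt[OF J0(1), of x l] that by simp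
    have "up \<Phi>"
      unfolding up_def
    proof (intro allI impI)
      fix x assume x: "1 \<le> x" "x < l" "root_vec TypeD l x l \<in> \<Phi>"
      then show "root_vec TypeD l x (l + 1) \<in> \<Phi>"
        using m.mirror_closedD[OF mc _ vl(1)[OF x(1,2)]] lt[OF x(2)] bl by simp
    qed
    moreover have "down \<Phi>"
      unfolding down_def
    proof (intro allI impI)
      fix x assume x: "1 \<le> x" "x < l" "root_vec TypeD l x (l + 1) \<in> \<Phi>"
      have "m.M + 1 - (l + 1) = l" by simp
      then show "root_vec TypeD l x l \<in> \<Phi>"
        using m.mirror_closedD[OF mc _ vl(2)[OF x(1,2)]] lt[OF x(2)] bl x by simp
    qed
    ultimately show "up \<Phi> \<and> down \<Phi>" ..
  next
    assume u: "up \<Phi> \<and> down \<Phi>"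
    show "m.mirror_closed \<Phi>"
      unfolding m.mirror_closed_def
    proof (intro impI allI)
      fix x y assume v: "valid_pair TypeD l x y" "x + y \<le> m.M" "m.bl x < m.bl y" "m.bl y \<le> m.bl (m.M + 1 - y)"
        "root_vec TypeD l x y \<in> \<Phi>"
      have x: "1 \<le> x" "x < l" using v(1,2) by (auto simp: valid_pair_def)
      have "y \<le> l + 1"
      proof (rule ccontr)
        assume "\<not> y \<le> l + 1"
        then have "m.bl (m.M + 1 - y) < m.bl y" using m.bl_lt[OF J0(1), of "m.M + 1 - y" y] by simp
        then show False using v(4) by simp
      qed
      then consider "y = l" | "y = l + 1" | "y < l" by linarith
      then show "root_vec TypeD l x (m.M + 1 - y) \<in> \<Phi>"
      proof cases
        case 1
        then show ?thesis using u x v(5) by (simp add: up_def)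
      next
        case 2
        then show ?thesis using u x v(5) by (simp add: down_def)
      next
        case 3
        have "m.bl y \<le> m.bl l" "m.bl l \<le> m.bl (m.M + 1 - y)" using 3 by (auto intro!: m.bl_mono)
        then show ?thesis
          using m.mirror_closed_via[OF \<Phi> v(1,5,3), of l] 3 x by simp
      qed
    qed
  qed
  \<comment> \<open>if \<open>up\<close> fails at \<open>x\<close> and \<open>down\<close> at \<open>z\<close>, moving left from the larger to the smaller contradicts one failure\<close>
  have either: "up \<Phi> \<or> down \<Phi>" if \<Phi>: "\<Phi> \<in> ?F" for \<Phi>
  proof (rule ccontr)
    assume "\<not> ?thesis"
    then obtain x z where x: "1 \<le> x" "x < l" "root_vec TypeD l x l \<in> \<Phi>" "root_vec TypeD l x (l + 1) \<notin> \<Phi>"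
      and z: "1 \<le> z" "z < l" "root_vec TypeD l z (l + 1) \<in> \<Phi>" "root_vec TypeD l z l \<notin> \<Phi>"
      by (auto simp: up_def down_def)
    have c: "s.compatible x z" "s.compatible z x" using x z by (auto simp: s.compatible_def)
    show False
    proof (cases "z \<le> x")
      case True
      then have "root_vec TypeD l z l \<in> \<Phi>"
        by (intro s.move_left[OF \<Phi> vl(1)[OF x(1,2)] x(3) vl(1)[OF z(1,2)] c(1)] s.bl_mono)
      then show False using z(4) by simp
    next
      case False
      then have "root_vec TypeD l x (l + 1) \<in> \<Phi>"
        by (intro s.move_left[OF \<Phi> vl(2)[OF z(1,2)] z(3) vl(2)[OF x(1,2)] c(2)] s.bl_mono) simp
      then show False using x(4) by simp
    qed
  qed
  let ?U = "{\<Phi> \<in> ?F. up \<Phi>}" and ?D = "{\<Phi> \<in> ?F. down \<Phi>}"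
  have "card ?U = card ?D"
  proof -
    have I_fix: "adj_swap (l - 1) ` I = I"
    proof -
      have "adj_swap (l - 1) i = i" if "i \<in> I" for i using that nf l by (auto simp: adj_swap_def)
      then show ?thesis by simp
    qed
    have swap: "fork_swap l (root_vec TypeD l x l) = root_vec TypeD l x (l + 1)"
      "fork_swap l (root_vec TypeD l x (l + 1)) = root_vec TypeD l x l" if "1 \<le> x" "x < l" for x
      using fork_swap_root_vec(1)[OF l vl(1)[OF that]] fork_swap_root_vec(1)[OF l vl(2)[OF that]] that
      by (auto simp: adj_swap_def)
    have mem: "c \<in> fork_swap l ` \<Phi> \<longleftrightarrow> fork_swap l c \<in> \<Phi>" for c and \<Phi> :: "(nat \<Rightarrow> int) set"
    proof
      assume "fork_swap l c \<in> \<Phi>"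
      then have "fork_swap l (fork_swap l c) \<in> fork_swap l ` \<Phi>" by (rule imageI)
      then show "c \<in> fork_swap l ` \<Phi>" by simp
    qed auto
    have ud: "down (fork_swap l ` \<Phi>) \<longleftrightarrow> up \<Phi>" "up (fork_swap l ` \<Phi>) \<longleftrightarrow> down \<Phi>" for \<Phi>
      unfolding up_def down_def mem using swap by auto
    have inv: "fork_swap l ` fork_swap l ` \<Phi> = \<Phi>" for \<Phi> by (simp add: image_image)
    have F: "fork_swap l ` \<Phi> \<in> ?F" if "\<Phi> \<in> ?F" for \<Phi>
      using fork_swap_ideal_family[OF l that] I_fix by simp
    have "bij_betw ((`) (fork_swap l)) ?U ?D"
      by (rule bij_betw_byWitness[where f' = "(`) (fork_swap l)"]) (use F ud inv in auto)
    then show ?thesis by (rule bij_betw_same_card)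
  qed
  moreover have "card ?F + card (?U \<inter> ?D) = card ?U + card ?D"
  proof -
    have "?F = ?U \<union> ?D" using either by blast
    moreover have "finite ?U" "finite ?D" using finite_ideal_family[of TypeD l I] by auto
    ultimately show ?thesis using card_Un_Int[of ?U ?D] by simp
  qed
  ultimately have "int (card ?F) = 2 * int (card ?U) - int (card (?U \<inter> ?D))" by simp
  moreover have "?U = {\<Phi> \<in> ?F. s.mirror_closed \<Phi>}" using s_iff by blast
  moreover have "?U \<inter> ?D = {\<Phi> \<in> ?F. m.mirror_closed \<Phi>}" using m_iff by blast
  ultimately have N: "int (card ?F) = 2 * int (card {\<Phi> \<in> ?F. s.mirror_closed \<Phi>})
      - int (card {\<Phi> \<in> ?F. m.mirror_closed \<Phi>})" by simp
  have cJ: "card ?J = 2 * d - 1"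
    using card_cut_set_even(1)[OF _ I] l nf by (simp add: d_def)
  have cJ0: "card ?Jm = 2 * d - 2" using cJ J(2) by (simp add: card_Diff_singleton)
  have starts: "s.run_starts = {m. m \<in> I \<and> m - 1 \<notin> I}" "m.run_starts = {m. m \<in> I \<and> m - 1 \<notin> I}"
  proof -
    have "1 \<le> m \<and> m < l - 1" if "m \<in> I" for m
    proof -
      have "m \<noteq> l" "m \<noteq> l - 1" "1 \<le> m" "m \<le> l" using that nf I by auto
      then show ?thesis by linarith
    qed
    then have "1 \<le> m \<and> m < l \<and> m \<le> l - 1" if "m \<in> I" for m using that by fastforce
    then show "s.run_starts = {m. m \<in> I \<and> m - 1 \<notin> I}" "m.run_starts = {m. m \<in> I \<and> m - 1 \<notin> I}"
      unfolding s.run_starts_def m.run_starts_def using J(1) J0(1) by (auto intro!: bexI[of _ "l - 1"])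
  qed
  have S: "(\<Sum>p\<in>s.doubled_blocks. ballot (2 * d - 1) (p - 1))
      = (\<Sum>m | m \<in> I \<and> m - 1 \<notin> I. ballot (2 * d - 1) (card ({1..<m} - I)))"
    unfolding starts(1)[symmetric]
    by (rule s.sum_doubled_blocks) (use I cut_set_low[of _ "2 * l" I] in auto)
  have S0: "(\<Sum>p\<in>m.doubled_blocks. ballot (2 * d - 2) (p - 1))
      = (\<Sum>m | m \<in> I \<and> m - 1 \<notin> I. ballot (2 * d - 2) (card ({1..<m} - I)))"
    unfolding starts(2)[symmetric]
    by (rule m.sum_doubled_blocks) (use I cut_set_low[of _ "2 * l" I] in auto)
  have div: "(2 * d - 1) div 2 = d - 1" "(2 * d - 2) div 2 = d - 1" using d2 by auto
  show "int (card ?F) = 2 * int ((2 * d - 1) choose (d - 1)) - int ((2 * d - 2) choose (d - 1))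
    + (\<Sum>m | m \<in> I \<and> m - 1 \<notin> I. 2 * ballot (2 * d - 1) (card ({1..<m} - I))
        - ballot (2 * d - 2) (card ({1..<m} - I)))"
    using N s.card_mirror_closed_ballot m.card_mirror_closed_ballot
    unfolding cJ cJ0 S S0 div by (simp add: sum_subtractf sum_distrib_left)
qed

section \<open>Connected components and the closed formulas\<close>

text \<open>The condition for \<open>m\<close> to be the least element of its connected component in \<open>I\<close>: no smaller
  element is joined to it. That this suffices rests on the shape of the diagrams.\<close>

definition component_start :: "classical_type \<Rightarrow> nat \<Rightarrow> nat set \<Rightarrow> nat \<Rightarrow> bool" where
  "component_start X l I m \<longleftrightarrow> m \<in> I \<and> (\<forall>i\<in>I. i < m \<longrightarrow> cartan_matrix X l i m = 0)"

lemma cartan_matrix_zero_sym: "cartan_matrix X l i j = 0 \<longleftrightarrow> cartan_matrix X l j i = 0"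
  by (cases X) auto

text \<open>The property \<open>separated\<close> says that no edge within \<open>I\<close> leads across the start of a component, so that the
  components are consecutive parts of \<open>I\<close>.\<close>

locale enumerated_components =
  fixes X :: classical_type and l :: nat and I :: "nat set" and s :: nat and K :: "nat \<Rightarrow> nat set"
  assumes I_sub: "I \<subseteq> {1..l}"
    and enum: "enumerates_components X l I s K"
    and separated: "component_start X l I m \<Longrightarrow> i \<in> I \<Longrightarrow> j \<in> I \<Longrightarrow> i < m \<Longrightarrow> m \<le> j \<Longrightarrow>
      cartan_matrix X l i j = 0"
begin

definition joined :: "(nat \<times> nat) set" where
  "joined = {(i, j). i \<in> I \<and> j \<in> I \<and> i \<noteq> j \<and> cartan_matrix X l i j \<noteq> 0}"

definition linked :: "(nat \<times> nat) set" where
  "linked = {(i, j). i \<in> I \<and> j \<in> I \<and> (i, j) \<in> joined\<^sup>*}"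

lemma finite_I: "finite I" using I_sub finite_subset by blast

lemma components_quotient: "dynkin_components X l I = I // linked"
  by (simp add: dynkin_components_def linked_def joined_def)

lemma equiv_linked: "equiv I linked"
proof (rule equivI)
  show "linked \<subseteq> I \<times> I" by (auto simp: linked_def)
  show "refl_on I linked" by (auto simp: linked_def refl_on_def)
  have "sym (joined\<^sup>*)"
    by (rule sym_rtrancl) (use cartan_matrix_zero_sym in \<open>auto simp: joined_def sym_def\<close>)
  then show "sym linked" by (auto simp: linked_def sym_def)
  show "trans linked" by (auto simp: linked_def trans_def)
qed

text \<open>A path within \<open>I\<close> never crosses the start of a component.\<close>

lemma linked_below:
  assumes m: "component_start X l I m" and ij: "(i, j) \<in> linked"
  shows "i < m \<longleftrightarrow> j < m"
proof -
  have step: "u < m \<longleftrightarrow> v < m" if "(u, v) \<in> joined" for u v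
  proof -
    have "\<not> (u < m \<and> m \<le> v)" "\<not> (v < m \<and> m \<le> u)"
      using that separated[OF m, of u v] separated[OF m, of v u] cartan_matrix_zero_sym[of X l u v]
      by (auto simp: joined_def)
    then show ?thesis by linarith
  qed
  have "(i, j) \<in> joined\<^sup>*" using ij by (simp add: linked_def)
  then show ?thesis by (induction rule: rtrancl_induct) (use step in auto)
qed

lemma component_nonempty:
  assumes "C \<in> I // linked"
  shows "finite C" "C \<noteq> {}" "C \<subseteq> I" "Min C \<in> C"
proof -
  show "C \<subseteq> I" using assms Union_quotient[OF equiv_linked] by blast
  then show "finite C" using finite_I finite_subset by blast
  moreover show "C \<noteq> {}" using assms in_quotient_imp_non_empty[OF equiv_linked] by blast
  ultimately show "Min C \<in> C" by (rule Min_in)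
qed

lemma component_start_Min:
  assumes C: "C \<in> I // linked" shows "component_start X l I (Min C)"
  unfolding component_start_def
proof (intro conjI ballI impI)
  note C' = component_nonempty[OF C]
  show m: "Min C \<in> I" using C' by blast
  fix i assume i: "i \<in> I" "i < Min C"
  show "cartan_matrix X l i (Min C) = 0"
  proof (rule ccontr)
    assume "\<not> ?thesis"
    then have "(i, Min C) \<in> joined" using i m by (simp add: joined_def)
    then have "(i, Min C) \<in> linked" using i m by (auto simp: linked_def)
    then have "(Min C, i) \<in> linked" using equiv_linked by (meson equivE symE)
    then have "i \<in> C" using in_quotient_imp_closed[OF equiv_linked C C'(4)] by blast
    then have "Min C \<le> i" using C' by (intro Min_le)
    then show False using i by simp
  qed
qed

lemma Min_component_of_start:
  assumes m: "component_start X l I m"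
  shows "linked `` {m} \<in> I // linked" "Min (linked `` {m}) = m"
proof -
  have mI: "m \<in> I" using m by (simp add: component_start_def)
  show C: "linked `` {m} \<in> I // linked" using mI by (rule quotientI)
  show "Min (linked `` {m}) = m"
  proof (rule Min_eqI)
    show "finite (linked `` {m})" using component_nonempty(1)[OF C] .
    show "m \<in> linked `` {m}" using mI by (auto simp: linked_def)
    fix j assume "j \<in> linked `` {m}"
    then have "(m, j) \<in> linked" by simp
    then show "m \<le> j" using linked_below[OF m] by (metis less_irrefl not_less)
  qed
qed

lemma K_component: "j \<in> {1..s} \<Longrightarrow> K j \<in> I // linked"
  using enum components_quotient by (auto simp: enumerates_components_def dest: bij_betwE)

lemma Min_K_less: "i \<in> {1..s} \<Longrightarrow> j \<in> {1..s} \<Longrightarrow> i < j \<Longrightarrow> Min (K i) < Min (K j)"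
  using enum unfolding enumerates_components_def by blast

lemma Min_K_less_iff: "i \<in> {1..s} \<Longrightarrow> j \<in> {1..s} \<Longrightarrow> Min (K i) < Min (K j) \<longleftrightarrow> i < j"
  using Min_K_less by (metis less_asym linorder_neqE_nat)

lemma bij_Min_K: "bij_betw (\<lambda>j. Min (K j)) {1..s} {m. component_start X l I m}"
  unfolding bij_betw_def
proof (intro conjI antisym subsetI)
  show "inj_on (\<lambda>j. Min (K j)) {1..s}"
    by (rule inj_onI) (metis Min_K_less less_irrefl linorder_neqE_nat)
next
  fix m assume "m \<in> (\<lambda>j. Min (K j)) ` {1..s}"
  then show "m \<in> {m. component_start X l I m}" using component_start_Min K_component by auto
next
  fix m assume "m \<in> {m. component_start X l I m}"
  then have m: "linked `` {m} \<in> I // linked" "Min (linked `` {m}) = m"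
    using Min_component_of_start by auto
  have "K ` {1..s} = I // linked"
    using enum components_quotient by (auto simp: enumerates_components_def bij_betw_def)
  then obtain j where "j \<in> {1..s}" "K j = linked `` {m}" using m(1) by (metis imageE)
  then show "m \<in> (\<lambda>j. Min (K j)) ` {1..s}" using m(2) by (metis imageI)
qed

text \<open>The earlier components fill up exactly the part of \<open>I\<close> below the start of the \<open>j\<close>-th one.\<close>

lemma sum_card_K:
  assumes j: "j \<in> {1..s}"
  shows "(\<Sum>k\<in>{1..<j}. card (K k)) = card {i \<in> I. i < Min (K j)}"
proof -
  let ?m = "Min (K j)"
  have m: "component_start X l I ?m" by (rule component_start_Min[OF K_component[OF j]])
  have K_img: "K ` {1..s} = I // linked" and K_inj: "inj_on K {1..s}"
    using enum components_quotient by (auto simp: enumerates_components_def bij_betw_def)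
  have "{i \<in> I. i < ?m} = (\<Union>k\<in>{1..<j}. K k)"
  proof (intro antisym subsetI)
    fix i assume "i \<in> {i \<in> I. i < ?m}"
    then have i: "i \<in> I" "i < ?m" by auto
    then have "i \<in> \<Union> (I // linked)" using Union_quotient[OF equiv_linked] by simp
    then obtain k where k: "k \<in> {1..s}" "i \<in> K k" unfolding K_img[symmetric] by blast
    have "Min (K k) \<le> i" using k component_nonempty[OF K_component[OF k(1)]] by (intro Min_le)
    then have "k < j" using Min_K_less_iff[OF k(1) j] i by simp
    then show "i \<in> (\<Union>k\<in>{1..<j}. K k)" using k by auto
  next
    fix i assume "i \<in> (\<Union>k\<in>{1..<j}. K k)"
    then obtain k where k: "1 \<le> k" "k < j" "i \<in> K k" by auto
    then have ks: "k \<in> {1..s}" using j by auto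
    note C = component_nonempty[OF K_component[OF ks]]
    have "(Min (K k), i) \<in> linked"
      by (rule in_quotient_imp_in_rel[OF equiv_linked K_component[OF ks]]) (use C k in auto)
    moreover have "Min (K k) < ?m" using Min_K_less[OF ks j k(2)] .
    ultimately have "i < ?m" using linked_below[OF m] by blast
    then show "i \<in> {i \<in> I. i < ?m}" using C k by auto
  qed
  moreover have "card (\<Union>k\<in>{1..<j}. K k) = (\<Sum>k\<in>{1..<j}. card (K k))"
  proof (rule card_UN_disjoint)
    show "\<forall>k\<in>{1..<j}. finite (K k)" using component_nonempty(1) K_component j by auto
    show "\<forall>i\<in>{1..<j}. \<forall>k\<in>{1..<j}. i \<noteq> k \<longrightarrow> K i \<inter> K k = {}"
    proof (intro ballI impI)
      fix i k assume ik: "i \<in> {1..<j}" "k \<in> {1..<j}" "i \<noteq> k"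
      then have mem: "i \<in> {1..s}" "k \<in> {1..s}" using j by auto
      have "K i \<noteq> K k" using inj_onD[OF K_inj _ mem] ik(3) by blast
      moreover have "K i \<in> I // linked" "K k \<in> I // linked" using K_component mem by blast+
      ultimately show "K i \<inter> K k = {}" using quotient_disj[OF equiv_linked] by blast
    qed
  qed simp
  ultimately show ?thesis by simp
qed

text \<open>Subtracting the sizes of the earlier components from the start \<open>m\<close> leaves the number of
  indices outside \<open>I\<close> up to \<open>m\<close>, increased by one.\<close>

lemma comp_offset_eq:
  assumes j: "j \<in> {1..s}"
  shows "comp_offset X l s K j = int (card ({1..<Min (K j)} - I)) + 1
    - (if X = TypeD \<and> j = s \<and> K s = {l} then 1 else 0)"
proof -
  let ?m = "Min (K j)"
  have "?m \<in> I" using component_nonempty[OF K_component[OF j]] by blast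
  then have m1: "1 \<le> ?m" using I_sub by auto
  have "card (({1..<?m} - I) \<union> {i \<in> I. i < ?m}) = card ({1..<?m} - I) + card {i \<in> I. i < ?m}"
    by (rule card_Un_disjoint) (use finite_I in auto)
  moreover have "({1..<?m} - I) \<union> {i \<in> I. i < ?m} = {1..<?m}" using I_sub by force
  ultimately have "card {1..<?m} = card ({1..<?m} - I) + card {i \<in> I. i < ?m}" by simp
  then have "int ?m - 1 = int (card ({1..<?m} - I)) + int (card {i \<in> I. i < ?m})" using m1 by simp
  then show ?thesis
    unfolding comp_offset_def using sum_card_K[OF j] by (simp add: of_nat_sum[symmetric])
qed

text \<open>If a set \<open>T\<close> of starts is closed under passing to smaller starts and misses \<open>c\<close> of them, it consists
  of the starts of the first \<open>s - c\<close> components.\<close>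

lemma sum_initial_components:
  fixes g :: "nat \<Rightarrow> real"
  assumes T: "T \<subseteq> {m. component_start X l I m}"
    and down: "\<And>m m'. m' \<in> T \<Longrightarrow> component_start X l I m \<Longrightarrow> m < m' \<Longrightarrow> m \<in> T"
    and c: "card ({m. component_start X l I m} - T) = c"
  shows "(\<Sum>j\<in>{1..s - c}. g (Min (K j))) = (\<Sum>m\<in>T. g m)"
proof -
  let ?h = "\<lambda>j. Min (K j)"
  let ?A = "{j \<in> {1..s}. ?h j \<in> T}"
  have img: "?h ` {1..s} = {m. component_start X l I m}" and inj: "inj_on ?h {1..s}"
    using bij_Min_K unfolding bij_betw_def by blast+
  have TA: "T = ?h ` ?A"
  proof (intro antisym subsetI)
    fix m assume m: "m \<in> T"
    then have "m \<in> ?h ` {1..s}" using T img by blast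
    then show "m \<in> ?h ` ?A" using m by blast
  qed blast
  have injA: "inj_on ?h ?A" using inj by (rule inj_on_subset) auto
  have fin: "finite {m. component_start X l I m}" unfolding img[symmetric] by simp
  have cs: "card {m. component_start X l I m} = s"
    unfolding img[symmetric] using card_image[OF inj] by simp
  have "card T \<le> s" using card_mono[OF fin T] cs by simp
  moreover have "s - card T = c" using card_Diff_subset[OF finite_subset[OF T fin] T] c cs by simp
  ultimately have cT: "card T = s - c" by simp
  have "card T = card (?h ` ?A)" using TA by (rule arg_cong)
  then have cA: "card ?A = s - c" using card_image[OF injA] cT by simp
  have "?A = {1..s - c}"
  proof -
    have downA: "i \<in> ?A" if "j \<in> ?A" "1 \<le> i" "i \<le> j" for i j
    proof (cases "i = j")
      case False
      then have i: "i \<in> {1..s}" "j \<in> {1..s}" "i < j" using that by auto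
      then have "?h i \<in> T"
      proof -
        have "?h j \<in> T" using that(1) by simp
        then show ?thesis
          using down component_start_Min[OF K_component[OF i(1)]] Min_K_less[OF i] by blast
      qed
      then show ?thesis using i by simp
    qed (use that in simp)
    have finA: "finite ?A" by simp
    show ?thesis
    proof (cases "?A = {}")
      case True
      then have "s - c = 0" using cA by (simp only: card.empty)
      then show ?thesis using True by simp
    next
      case False
      have "?A = {1..Max ?A}"
      proof (intro antisym subsetI)
        fix j assume "j \<in> ?A"
        then show "j \<in> {1..Max ?A}" using Max_ge[OF finA] by auto
      next
        fix i assume "i \<in> {1..Max ?A}"
        then show "i \<in> ?A" using downA[OF Max_in[OF finA False], of i] by simp
      qed
      then have "card ?A = card {1..Max ?A}" by (rule arg_cong)
      then have "Max ?A = s - c" using cA by simp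
      then show ?thesis using \<open>?A = {1..Max ?A}\<close> by simp
    qed
  qed
  then have "(\<Sum>j\<in>{1..s - c}. g (?h j)) = (\<Sum>j\<in>?A. g (?h j))" by simp
  also have "\<dots> = (\<Sum>m\<in>?h ` ?A. g m)" by (simp only: sum.reindex[OF injA] o_def)
  also have "?h ` ?A = T" using TA by (rule sym)
  finally show ?thesis .
qed

end

text \<open>Both sides are \<open>n! (n - 2 v + 1) / (v! (n - v + 1)!)\<close>.\<close>

lemma T'_ballot:
  assumes "v \<le> n" shows "T' (int n - int v - 1) (int v) = real_of_int (ballot n v)"
proof (cases v)
  case 0
  have "T' (int n - 1) 0 = fact n * (real n + 1) / fact (Suc n)"
    by (simp add: T'_def nat_add_distrib add.commute)
  also have "\<dots> = 1"
  proof -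
    have "fact (Suc n) = real (Suc n) * fact n" "real n + 1 = real (Suc n)" by simp_all
    then show ?thesis by (simp del: of_nat_Suc fact_Suc)
  qed
  finally show ?thesis using 0 by (simp add: ballot_def)
next
  case (Suc w)
  define u where "u = n - v"
  have n: "n = u + Suc w" using assms Suc by (simp add: u_def)
  have "T' (int n - int v - 1) (int v) = fact n * (real u - real w) / (fact (Suc w) * fact (Suc u))"
  proof -
    have 1: "nat (int n - int v - 1 + int v + 1) = n" by simp
    have 2: "nat (int n - int v - 1 + 2) = Suc u" using n Suc by simp
    have 3: "real_of_int (int n - int v - 1 - int v + 2) = real u - real w" using n Suc by simp
    have 4: "nat (int v) = Suc w" "int v \<noteq> - 1" using Suc by simp_all
    show ?thesis unfolding T'_def 1 2 3 4(1) using 4(2) by simp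
  qed
  also have "\<dots> = real (n choose Suc w) - real (n choose w)"
  proof -
    have b1: "real (n choose Suc w) = fact n / (fact (Suc w) * fact u)"
      using binomial_fact[of "Suc w" n, where 'a = real] n by simp
    have b2: "real (n choose w) = fact n / (fact w * fact (Suc u))"
      using binomial_fact[of w n, where 'a = real] n by simp
    have f: "fact (Suc w) = real (Suc w) * fact w" "fact (Suc u) = real (Suc u) * fact u"
      by (simp_all del: of_nat_Suc)
    have gen: "F * (U - W) / ((W * a) * (U * b)) = F / ((W * a) * b) - F / (a * (U * b))"
      if "U \<noteq> 0" "W \<noteq> 0" "a \<noteq> 0" "b \<noteq> 0" for F U W a b :: real
      using that by (simp add: field_simps)
    have uw: "real u - real w = real (Suc u) - real (Suc w)" by simp
    show ?thesis unfolding b1 b2 f uw by (rule gen) simp_all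
  qed
  finally show ?thesis using Suc by (simp add: ballot_def)
qed

lemma catalan_central: "(real m + 1) * catalan m = real ((2 * m) choose m)"
  by (simp add: catalan_def)

lemma central_binomial_half: "1 \<le> d \<Longrightarrow> 2 * real ((2 * d - 1) choose (d - 1)) = real ((2 * d) choose d)"
proof -
  assume "1 \<le> d"
  then obtain e where e: "d = Suc e" by (cases d) auto
  have "(2 * d) choose d = (2 * d - 1 choose e) + (2 * d - 1 choose d)" using e by simp
  moreover have "(2 * d - 1 choose d) = (2 * d - 1 choose e)"
    using binomial_symmetric[of d "2 * d - 1"] e by simp
  ultimately show ?thesis using e by simp
qed

lemma ballot_catalan: "real_of_int (ballot (2 * m) m) = catalan m"
proof (cases m)
  case 0
  then show ?thesis by (simp add: ballot_def catalan_def)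
next
  case (Suc k)
  have "Suc m * ((2 * m) choose Suc m) = m * ((2 * m) choose m)"
    using binomial_absorb_comp[of "2 * m" m] binomial_absorption[of m "2 * m"] by auto
  moreover have "(2 * m) choose Suc m = (2 * m) choose k"
    using binomial_symmetric[of "Suc m" "2 * m"] Suc by simp
  ultimately have "(real m + 1) * real ((2 * m) choose k) = real m * real ((2 * m) choose m)"
    by (metis of_nat_Suc of_nat_mult add.commute)
  then show ?thesis using Suc by (simp add: ballot_def catalan_def field_simps)
qed

lemma component_start_B:
  assumes "I \<subseteq> {1..l}"
  shows "component_start TypeB l I m \<longleftrightarrow> m \<in> I \<and> m - 1 \<notin> I"
proof
  assume m: "component_start TypeB l I m"
  then have mI: "m \<in> I" by (simp add: component_start_def)
  have "m - 1 \<notin> I"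
  proof
    assume i: "m - 1 \<in> I"
    then have m2: "m = Suc (m - 1)" using mI assms by auto
    then have "cartan_matrix TypeB l (m - 1) m = 0" using m i by (auto simp: component_start_def)
    then show False using m2 by (auto split: if_splits)
  qed
  then show "m \<in> I \<and> m - 1 \<notin> I" using mI by simp
next
  assume m: "m \<in> I \<and> m - 1 \<notin> I"
  have "cartan_matrix TypeB l i m = 0" if "i \<in> I" "i < m" for i
  proof -
    have "Suc i \<noteq> m" using that m by auto
    then show ?thesis using that(2) by auto
  qed
  then show "component_start TypeB l I m" using m by (simp add: component_start_def)
qed

text \<open>The last two nodes are both joined to \<open>l - 2\<close> and not to each other.\<close>

lemma component_start_D:
  assumes I: "I \<subseteq> {1..l}" and l: "4 \<le> l"
  shows "component_start TypeD l I m \<longleftrightarrow> m \<in> I \<and> (if m = l then l - 2 \<notin> I else m - 1 \<notin> I)"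
proof
  assume m: "component_start TypeD l I m"
  then have mI: "m \<in> I" and z: "\<And>i. i \<in> I \<Longrightarrow> i < m \<Longrightarrow> cartan_matrix TypeD l i m = 0"
    by (auto simp: component_start_def)
  have m1: "1 \<le> m" "m \<le> l" using mI I by auto
  have "cartan_matrix TypeD l (l - 2) l \<noteq> 0" using l by simp
  moreover have "cartan_matrix TypeD l (m - 1) m \<noteq> 0" if "m \<noteq> l" using that m1 by simp
  moreover have "l - 2 < l" "m - 1 < m" using l m1 by simp_all
  ultimately show "m \<in> I \<and> (if m = l then l - 2 \<notin> I else m - 1 \<notin> I)"
    using mI z[of "l - 2"] z[of "m - 1"] by auto
next
  assume m: "m \<in> I \<and> (if m = l then l - 2 \<notin> I else m - 1 \<notin> I)"
  have "cartan_matrix TypeD l i m = 0" if i: "i \<in> I" "i < m" for i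
  proof (cases "m = l")
    case True
    then have "i + 2 \<noteq> l" using i m by auto
    then show ?thesis using True i by auto
  next
    case False
    then have "Suc i \<noteq> m" "m < l" using i m I by auto
    then show ?thesis using i by auto
  qed
  then show "component_start TypeD l I m" using m by (simp add: component_start_def)
qed

lemma enumerated_components_B:
  assumes I: "I \<subseteq> {1..l}" and "enumerates_components TypeB l I s K"
  shows "enumerated_components TypeB l I s K"
proof
  fix m i j assume m: "component_start TypeB l I m" and ij: "i \<in> I" "j \<in> I" "i < m" "m \<le> j"
  have "m - 1 \<noteq> i" using m ij component_start_B[OF I] by auto
  then show "cartan_matrix TypeB l i j = 0" using ij by auto
qed (use assms in auto)

lemma enumerated_components_D:
  assumes I: "I \<subseteq> {1..l}" and l: "4 \<le> l" and "enumerates_components TypeD l I s K"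
  shows "enumerated_components TypeD l I s K"
proof
  fix m i j assume m: "component_start TypeD l I m" and ij: "i \<in> I" "j \<in> I" "i < m" "m \<le> j"
  have m': "if m = l then l - 2 \<notin> I else m - 1 \<notin> I" using m unfolding component_start_D[OF I l] by blast
  have jl: "j \<le> l" using ij I by auto
  have "\<not> (j = Suc i \<and> j < l)"
  proof
    assume "j = Suc i \<and> j < l"
    then have "m - 1 = i" "m \<noteq> l" using ij by auto
    then show False using m' ij(1) by simp
  qed
  moreover have "\<not> (j = l \<and> i + 2 = l)"
  proof
    assume "j = l \<and> i + 2 = l"
    then have "m = l \<and> i = l - 2 \<or> m \<noteq> l \<and> m - 1 = i" using ij by auto
    then show False using m' ij(1) by auto
  qed
  ultimately show "cartan_matrix TypeD l i j = 0" using ij jl by auto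
qed (use assms in auto)

lemma card_complement_below:
  assumes "I \<subseteq> {1..l}" "m \<le> l"
  shows "card ({1..<m} - I) \<le> l - card I"
proof -
  have "card ({1..<m} - I) \<le> card ({1..l} - I)" using assms by (intro card_mono) auto
  also have "\<dots> = l - card I" using assms by (simp add: card_Diff_subset finite_subset)
  finally show ?thesis .
qed

text \<open>At most one maximal run of \<open>I\<close> reaches \<open>l\<close>.\<close>

lemma card_final_run:
  fixes I :: "nat set"
  assumes I: "I \<subseteq> {1..l}"
  shows "card {m \<in> I. m - 1 \<notin> I \<and> {m..l} \<subseteq> I} = of_bool (l \<in> I)"
proof (cases "l \<in> I")
  case False
  have "\<not> {m..l} \<subseteq> I" if "m \<in> I" for m
  proof -
    have "m \<in> {1..l}" using that I by blast
    then have "l \<in> {m..l}" by simp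
    then show ?thesis using False by blast
  qed
  then have e: "{m \<in> I. m - 1 \<notin> I \<and> {m..l} \<subseteq> I} = {}" by blast
  show ?thesis unfolding e using False by simp
next
  case True
  \<comment> \<open>the start of the run of \<open>I\<close> that ends at \<open>l\<close>\<close>
  define m where "m = (LEAST m. {m..l} \<subseteq> I)"
  have "{l..l} \<subseteq> I" using True by simp
  then have m: "{m..l} \<subseteq> I" "m \<le> l" unfolding m_def by (rule LeastI, rule Least_le)
  have mI: "m \<in> I" using m by auto
  then have m1: "1 \<le> m" using I by auto
  have "m - 1 \<notin> I"
  proof
    assume "m - 1 \<in> I"
    then have "{m - 1..l} \<subseteq> I"
    proof (intro subsetI)
      fix u assume "u \<in> {m - 1..l}"
      then have "u = m - 1 \<or> u \<in> {m..l}" by auto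
      then show "u \<in> I" using \<open>m - 1 \<in> I\<close> m(1) by blast
    qed
    then have "m \<le> m - 1" unfolding m_def by (rule Least_le)
    then show False using m1 by simp
  qed
  have "{m \<in> I. m - 1 \<notin> I \<and> {m..l} \<subseteq> I} = {m}"
  proof (intro antisym subsetI)
    fix u assume u: "u \<in> {m \<in> I. m - 1 \<notin> I \<and> {m..l} \<subseteq> I}"
    then have "m \<le> u" unfolding m_def by (intro Least_le) simp
    moreover have "\<not> m < u"
    proof
      assume "m < u"
      then have "u - 1 \<in> {m..l}" using u I by auto
      then show False using u m(1) by blast
    qed
    ultimately show "u \<in> {m}" by simp
  qed (use mI m \<open>m - 1 \<notin> I\<close> in auto)
  then show ?thesis using True by simp
qed

text \<open>The common part of the closed formulas: the sum over the first \<open>s - c\<close> components becomes a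
  sum over the set \<open>T\<close> of their starts.\<close>

lemma sum_T'_components:
  assumes "enumerated_components X l I s K"
    and T: "T \<subseteq> {m. component_start X l I m}"
    and down: "\<And>m m'. m' \<in> T \<Longrightarrow> component_start X l I m \<Longrightarrow> m < m' \<Longrightarrow> m \<in> T"
    and c: "card ({m. component_start X l I m} - T) = c"
    and v: "\<And>j. j \<in> {1..s - c} \<Longrightarrow> comp_offset X l s K j = int (v (Min (K j))) + 1"
    and F: "\<And>m. m \<in> T \<Longrightarrow> F (int (v m) + 1) = g (v m)"
  shows "(\<Sum>j = 1..s - c. F (comp_offset X l s K j)) = (\<Sum>m\<in>T. g (v m) :: real)"
proof -
  interpret enumerated_components X l I s K by fact
  have "(\<Sum>j = 1..s - c. F (comp_offset X l s K j)) = (\<Sum>j = 1..s - c. F (int (v (Min (K j))) + 1))"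
    using v by (intro sum.cong) simp_all
  also have "\<dots> = (\<Sum>m\<in>T. F (int (v m) + 1))"
    by (rule sum_initial_components[OF T down c])
  also have "\<dots> = (\<Sum>m\<in>T. g (v m))" using F by (intro sum.cong) simp_all
  finally show ?thesis .
qed

lemma formula_B:
  assumes rank: "admissible_rank TypeB l" and I: "I \<subseteq> {1..l}" and enum: "enumerates_components TypeB l I s K"
  defines "d \<equiv> l - card I"
  shows "real (card (ideal_family (classical_positive TypeB l) I)) = (real d + 1) * catalan d
    + (\<Sum>j = 1..(if l \<in> I then s - 1 else s).
        T' (2 * int d - comp_offset TypeB l s K j) (comp_offset TypeB l s K j - 1))"
proof -
  interpret enumerated_components TypeB l I s K by (rule enumerated_components_B[OF I enum])
  note start = component_start_B[OF I]
  define T where "T = {m. m \<in> I \<and> m - 1 \<notin> I \<and> \<not> {m..l} \<subseteq> I}"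
  define c where "c = (if l \<in> I then 1 else 0 :: nat)"
  let ?v = "\<lambda>m. card ({1..<m} - I)"
  have T_sub: "T \<subseteq> {m. component_start TypeB l I m}" by (auto simp: T_def start)
  have rest: "{m. component_start TypeB l I m} - T = {m \<in> I. m - 1 \<notin> I \<and> {m..l} \<subseteq> I}"
    by (auto simp: T_def start)
  have "(\<Sum>j = 1..s - c. T' (2 * int d - comp_offset TypeB l s K j) (comp_offset TypeB l s K j - 1))
      = (\<Sum>m\<in>T. real_of_int (ballot (2 * d) (?v m)))"
  proof (rule sum_T'_components[OF enumerated_components_axioms T_sub,
        where F = "\<lambda>L. T' (2 * int d - L) (L - 1)" and v = ?v and g = "\<lambda>v. real_of_int (ballot (2 * d) v)"])
    show "card ({m. component_start TypeB l I m} - T) = c"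
      unfolding rest c_def using card_final_run[OF I] by simp
    show "m \<in> T" if m': "m' \<in> T" and m: "component_start TypeB l I m" and lt: "m < m'" for m m'
    proof -
      have "m' - 1 \<in> {m..l}" "m' - 1 \<notin> I" using m' lt I by (auto simp: T_def)
      then show ?thesis using m by (auto simp: T_def start)
    qed
    show "comp_offset TypeB l s K j = int (?v (Min (K j))) + 1" if "j \<in> {1..s - c}" for j
    proof -
      have "j \<in> {1..s}" using that by auto
      then show ?thesis using comp_offset_eq[of j] by simp
    qed
    fix m assume "m \<in> T"
    then have "m \<le> l" using I by (auto simp: T_def)
    then have "?v m \<le> 2 * d" using card_complement_below[OF I, of m] by (simp add: d_def)
    from T'_ballot[OF this]
    show "T' (2 * int d - (int (?v m) + 1)) (int (?v m) + 1 - 1) = real_of_int (ballot (2 * d) (?v m))"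
      by (simp add: algebra_simps)
  qed
  moreover have "(if l \<in> I then s - 1 else s) = s - c" by (simp add: c_def)
  moreover have "real (card (ideal_family (classical_positive TypeB l) I))
      = real ((2 * d) choose d) + (\<Sum>m\<in>T. real_of_int (ballot (2 * d) (?v m)))"
  proof -
    have "real_of_int (int (card (ideal_family (classical_positive TypeB l) I)))
        = real_of_int (int ((2 * d) choose d) + (\<Sum>m\<in>T. ballot (2 * d) (?v m)))"
      unfolding card_ideal_family_B[OF rank I] T_def d_def ..
    then show ?thesis by simp
  qed
  ultimately show ?thesis using catalan_central[of d] by simp
qed

lemma formula_C:
  assumes rank: "admissible_rank TypeC l" and I: "I \<subseteq> {1..l}"
  defines "d \<equiv> l - card I"
  shows "real (card (ideal_family (classical_positive TypeC l) I))
    = (if l \<in> I then (real d + 2) / 2 * catalan (d + 1) else (real d + 1) * catalan d)"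
proof -
  have N: "card (ideal_family (classical_positive TypeC l) I)
      = (if l \<in> I then (2 * d + 1) choose d else (2 * d) choose d)"
    using card_ideal_family_C[OF rank I] unfolding d_def of_nat_eq_iff .
  have "2 * real ((2 * d + 1) choose d) = real ((2 * (d + 1)) choose (d + 1))"
    using central_binomial_half[of "d + 1"] by simp
  then have "(real d + 2) / 2 * catalan (d + 1) = real ((2 * d + 1) choose d)"
    using catalan_central[of "d + 1"] by (simp add: algebra_simps)
  then show ?thesis unfolding N using catalan_central[of d] by simp
qed

text \<open>The components containing \<open>l - 1\<close> or \<open>l\<close> do not contribute. There are two of them if \<open>l - 2\<close> is not in
  \<open>I\<close>, and one otherwise.\<close>

lemma formula_D_both:
  assumes rank: "admissible_rank TypeD l" and I: "I \<subseteq> {1..l}" and enum: "enumerates_components TypeD l I s K"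
    and fork: "{l - 1, l} \<subseteq> I"
  defines "d \<equiv> l - card I"
  shows "real (card (ideal_family (classical_positive TypeD l) I)) = (real d + 1) * catalan d
    + (\<Sum>j = 1..(if l - 2 \<in> I then s - 1 else s - 2).
        T' (2 * int d - comp_offset TypeD l s K j) (comp_offset TypeD l s K j - 1))"
proof -
  have l: "4 \<le> l" using rank by simp
  interpret enumerated_components TypeD l I s K by (rule enumerated_components_D[OF I l enum])
  note start = component_start_D[OF I l]
  define T where "T = {m. m \<in> I \<and> m - 1 \<notin> I \<and> m < l \<and> \<not> {m..l} \<subseteq> I}"
  define c where "c = (if l - 2 \<in> I then 1 else 2 :: nat)"
  let ?v = "\<lambda>m. card ({1..<m} - I)"
  have top: "{l - 1..l} \<subseteq> I"
  proof
    fix u assume "u \<in> {l - 1..l}"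
    then have "u = l - 1 \<or> u = l" by auto
    then show "u \<in> I" using fork by auto
  qed
  have T_sub: "T \<subseteq> {m. component_start TypeD l I m}" by (auto simp: T_def start)
  have "card ({m. component_start TypeD l I m} - T) = c"
  proof (cases "l - 2 \<in> I")
    case True
    have "{m. component_start TypeD l I m} - T = {m \<in> I. m - 1 \<notin> I \<and> {m..l} \<subseteq> I}"
    proof (intro antisym subsetI)
      fix m assume m: "m \<in> {m. component_start TypeD l I m} - T"
      then have "m \<noteq> l" "m \<in> I" using True by (auto simp: start)
      moreover have "m \<le> l" using \<open>m \<in> I\<close> I by auto
      ultimately show "m \<in> {m \<in> I. m - 1 \<notin> I \<and> {m..l} \<subseteq> I}" using m by (auto simp: start T_def)
    next
      fix m assume m: "m \<in> {m \<in> I. m - 1 \<notin> I \<and> {m..l} \<subseteq> I}"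
      then have "m \<noteq> l" using fork by auto
      then show "m \<in> {m. component_start TypeD l I m} - T" using m by (auto simp: start T_def)
    qed
    then show ?thesis using card_final_run[OF I] True fork by (simp add: c_def)
  next
    case False
    have e: "l - 1 - 1 = l - 2" by simp
    have "{m. component_start TypeD l I m} - T = {l - 1, l}"
    proof (intro antisym subsetI)
      fix m assume m: "m \<in> {m. component_start TypeD l I m} - T"
      show "m \<in> {l - 1, l}"
      proof (rule ccontr)
        assume "m \<notin> {l - 1, l}"
        then have ne: "m \<noteq> l" "m \<noteq> l - 1" by auto
        have mI: "m \<in> I" "m - 1 \<notin> I" using m ne by (auto simp: start)
        have "m < l" using mI(1) I ne(1) by (auto simp: le_less)
        then have "{m..l} \<subseteq> I" using m mI by (auto simp: T_def start)
        moreover have "l - 2 \<in> {m..l}" using \<open>m < l\<close> ne l by auto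
        ultimately show False using False by blast
      qed
    next
      fix m assume "m \<in> {l - 1, l}"
      then consider "m = l" | "m = l - 1" by blast
      then show "m \<in> {m. component_start TypeD l I m} - T"
      proof cases
        case 1
        then show ?thesis using fork False by (simp add: start T_def)
      next
        case 2
        have "component_start TypeD l I (l - 1)" unfolding start e using fork False l by simp
        then show ?thesis using 2 top by (simp add: T_def)
      qed
    qed
    moreover have "l - 1 \<noteq> l" using l by simp
    ultimately show ?thesis using False by (simp add: c_def)
  qed
  moreover have "m \<in> T" if m': "m' \<in> T" and m: "component_start TypeD l I m" and lt: "m < m'" for m m'
  proof -
    have "m' - 1 \<in> {m..l}" "m' - 1 \<notin> I" "m < l" using m' lt I by (auto simp: T_def)
    then show ?thesis using m by (auto simp: T_def start)
  qed
  moreover have "comp_offset TypeD l s K j = int (?v (Min (K j))) + 1" if "j \<in> {1..s - c}" for j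
  proof -
    have "j \<in> {1..s}" "j \<noteq> s" using that by (auto simp: c_def split: if_splits)
    then show ?thesis using comp_offset_eq[of j] by simp
  qed
  moreover have "T' (2 * int d - (int (?v m) + 1)) (int (?v m) + 1 - 1) = real_of_int (ballot (2 * d) (?v m))"
    if "m \<in> T" for m
  proof -
    have "?v m \<le> 2 * d" using card_complement_below[OF I, of m] that by (simp add: T_def d_def)
    from T'_ballot[OF this] show ?thesis by (simp add: algebra_simps)
  qed
  ultimately have "(\<Sum>j = 1..s - c. T' (2 * int d - comp_offset TypeD l s K j) (comp_offset TypeD l s K j - 1))
      = (\<Sum>m\<in>T. real_of_int (ballot (2 * d) (?v m)))"
    by (intro sum_T'_components[OF enumerated_components_axioms T_sub,
          where F = "\<lambda>L. T' (2 * int d - L) (L - 1)" and v = ?v and g = "\<lambda>v. real_of_int (ballot (2 * d) v)"])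
      blast+
  moreover have "(if l - 2 \<in> I then s - 1 else s - 2) = s - c" by (simp add: c_def)
  moreover have "real (card (ideal_family (classical_positive TypeD l) I))
      = real ((2 * d) choose d) + (\<Sum>m\<in>T. real_of_int (ballot (2 * d) (?v m)))"
  proof -
    have "real_of_int (int (card (ideal_family (classical_positive TypeD l) I)))
        = real_of_int (int ((2 * d) choose d) + (\<Sum>m\<in>T. ballot (2 * d) (?v m)))"
      using card_ideal_family_D_fork[OF rank I] fork unfolding T_def d_def by simp
    then show ?thesis by simp
  qed
  ultimately show ?thesis using catalan_central[of d] by simp
qed

text \<open>Pascal's recursion turns the contribution \<open>2 b(2 d - 1, v) - b(2 d - 2, v)\<close> of a component into
  \<open>b(2 d - 1, v) + b(2 d - 2, v - 1)\<close>, where \<open>b\<close> is the ballot number. The last term is absent for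
  \<open>v = 0\<close>, in accordance with \<open>T' p (-1) = 0\<close>.\<close>

lemma formula_D_open:
  assumes rank: "admissible_rank TypeD l" and I: "I \<subseteq> {1..l}" and enum: "enumerates_components TypeD l I s K"
    and nf: "l - 1 \<notin> I" "l \<notin> I"
  defines "d \<equiv> l - card I"
  shows "real (card (ideal_family (classical_positive TypeD l) I)) = (3 * real d - 2) * catalan (d - 1)
    + (\<Sum>j = 1..s. T' (2 * int d - comp_offset TypeD l s K j - 1) (comp_offset TypeD l s K j - 2)
        + T' (2 * int d - comp_offset TypeD l s K j - 1) (comp_offset TypeD l s K j - 1))"
proof -
  have l: "4 \<le> l" using rank by simp
  interpret enumerated_components TypeD l I s K by (rule enumerated_components_D[OF I l enum])
  note start = component_start_D[OF I l]
  have d2: "2 \<le> d" using card_ideal_family_D_open(2)[OF rank I nf] by (simp add: d_def)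
  then obtain e where e: "d = Suc (Suc e)" by (metis add_2_eq_Suc le_Suc_ex)
  define T where "T = {m. m \<in> I \<and> m - 1 \<notin> I}"
  let ?v = "\<lambda>m. card ({1..<m} - I)"
  let ?b = "\<lambda>v. 2 * ballot (2 * d - 1) v - ballot (2 * d - 2) v"
  have T_eq: "T = {m. component_start TypeD l I m}" using nf by (auto simp: T_def start)
  have "(\<Sum>j = 1..s - 0. T' (2 * int d - comp_offset TypeD l s K j - 1) (comp_offset TypeD l s K j - 2)
        + T' (2 * int d - comp_offset TypeD l s K j - 1) (comp_offset TypeD l s K j - 1))
      = (\<Sum>m\<in>T. real_of_int (?b (?v m)))"
  proof (rule sum_T'_components[OF enumerated_components_axioms,
        where F = "\<lambda>L. T' (2 * int d - L - 1) (L - 2) + T' (2 * int d - L - 1) (L - 1)" and v = ?v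
          and g = "\<lambda>v. real_of_int (?b v)"])
    show "comp_offset TypeD l s K j = int (?v (Min (K j))) + 1" if "j \<in> {1..s - 0}" for j
    proof -
      have j: "j \<in> {1..s}" using that by simp
      have "K j \<noteq> {l}" using component_nonempty(3)[OF K_component[OF j]] nf by auto
      then have "\<not> (j = s \<and> K s = {l})" by auto
      then show ?thesis using comp_offset_eq[OF j] by simp
    qed
    fix m assume m: "m \<in> T"
    then have "m \<le> l" using I by (auto simp: T_def)
    then have v: "?v m \<le> d" using card_complement_below[OF I, of m] by (simp add: d_def)
    have 1: "T' (2 * int d - (int (?v m) + 1) - 1) (int (?v m) + 1 - 1) = real_of_int (ballot (2 * d - 1) (?v m))"
    proof -
      have "?v m \<le> 2 * d - 1" using v d2 by simp
      from T'_ballot[OF this] show ?thesis using d2 by (simp add: of_nat_diff algebra_simps)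
    qed
    have 2: "T' (2 * int d - (int (?v m) + 1) - 1) (int (?v m) + 1 - 2)
        = real_of_int (if ?v m = 0 then 0 else ballot (2 * d - 2) (?v m - 1))"
    proof (cases "?v m")
      case 0
      then show ?thesis by (simp add: T'_def)
    next
      case (Suc w)
      have "w \<le> 2 * d - 2" using v Suc d2 by simp
      from T'_ballot[OF this] show ?thesis using d2 Suc by (simp add: of_nat_diff algebra_simps)
    qed
    have "2 * d - 1 = Suc (2 * d - 2)" using d2 by simp
    then have "?b (?v m) = ballot (2 * d - 1) (?v m) + (if ?v m = 0 then 0 else ballot (2 * d - 2) (?v m - 1))"
      using ballot_Suc[of "2 * d - 2" "?v m"] by simp
    then show "T' (2 * int d - (int (?v m) + 1) - 1) (int (?v m) + 1 - 2)
        + T' (2 * int d - (int (?v m) + 1) - 1) (int (?v m) + 1 - 1) = real_of_int (?b (?v m))"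
      unfolding 1 2 by simp
  qed (use T_eq in auto)
  moreover have "real (card (ideal_family (classical_positive TypeD l) I))
      = 2 * real ((2 * d - 1) choose (d - 1)) - real ((2 * d - 2) choose (d - 1)) + (\<Sum>m\<in>T. real_of_int (?b (?v m)))"
  proof -
    have "real_of_int (int (card (ideal_family (classical_positive TypeD l) I)))
        = real_of_int (2 * int ((2 * d - 1) choose (d - 1)) - int ((2 * d - 2) choose (d - 1)) + (\<Sum>m\<in>T. ?b (?v m)))"
      using card_ideal_family_D_open(1)[OF rank I nf] unfolding T_def d_def by simp
    then show ?thesis by simp
  qed
  moreover have "2 * real ((2 * d - 1) choose (d - 1)) - real ((2 * d - 2) choose (d - 1))
      = (3 * real d - 2) * catalan (d - 1)"
  proof -
    obtain q where q: "d = Suc q" using d2 by (cases d) auto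
    have c: "real d * catalan q = real ((2 * q) choose q)" using catalan_central[of q] q by (simp add: add.commute)
    have "Suc q * ((2 * q + 1) choose q) = (2 * q + 1) * ((2 * q) choose q)"
      using binomial_absorb_comp[of "2 * q + 1" q] by (simp add: Suc_diff_le)
    then have "real (Suc q) * real ((2 * q + 1) choose q) = real (2 * q + 1) * real ((2 * q) choose q)"
      by (simp only: of_nat_mult[symmetric])
    then have "real d * real ((2 * q + 1) choose q) = real (2 * q + 1) * (real d * catalan q)"
      unfolding c unfolding q .
    also have "\<dots> = real d * (real (2 * q + 1) * catalan q)" by (rule mult.left_commute)
    finally have "real d * real ((2 * q + 1) choose q) = real d * (real (2 * q + 1) * catalan q)" .
    then have "real ((2 * q + 1) choose q) = real (2 * q + 1) * catalan q" using q by simp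
    then show ?thesis using c q by (simp add: algebra_simps)
  qed
  ultimately show ?thesis by simp
qed

text \<open>The diagram automorphism replaces a node \<open>l\<close> in \<open>I\<close> by \<open>l - 1\<close>; the resulting set is \<open>I'\<close>, and \<open>\<phi>\<close> is the
  renumbering. If \<open>{l}\<close> is a component, the index \<open>l - 1\<close> outside \<open>I\<close> precedes \<open>l\<close>, but nothing
  outside \<open>I'\<close> corresponds to it below \<open>l - 1\<close>; this is the correction by one in \<open>comp_offset\<close>.\<close>

lemma formula_D_one:
  assumes rank: "admissible_rank TypeD l" and I: "I \<subseteq> {1..l}" and enum: "enumerates_components TypeD l I s K"
    and one: "l - 1 \<in> I \<and> l \<notin> I \<or> l - 1 \<notin> I \<and> l \<in> I"
  defines "d \<equiv> l - card I"
  shows "real (card (ideal_family (classical_positive TypeD l) I)) = (real d + 1) / 2 * catalan d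
    + (\<Sum>j = 1..s. T' (2 * int d - comp_offset TypeD l s K j - 1) (comp_offset TypeD l s K j - 1))"
proof -
  have l: "4 \<le> l" using rank by simp
  interpret enumerated_components TypeD l I s K by (rule enumerated_components_D[OF I l enum])
  note start = component_start_D[OF I l]
  let ?St = "{m. component_start TypeD l I m}"
  define \<phi> where "\<phi> m = (if m = l then l - 1 else m)" for m
  define I' where "I' = \<phi> ` I"
  let ?v = "\<lambda>m. card ({1..<\<phi> m} - I')"
  have \<phi>_inj: "inj_on \<phi> I" using one l by (auto simp: inj_on_def \<phi>_def)
  have I'_sub: "I' \<subseteq> {1..l}" using I l by (auto simp: I'_def \<phi>_def)
  have cI': "card I' = card I" unfolding I'_def by (rule card_image[OF \<phi>_inj])
  have l1I': "l - 1 \<in> I'" and lI': "l \<notin> I'" using one l by (auto simp: I'_def \<phi>_def)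
  have below: "k \<in> I' \<longleftrightarrow> k \<in> I" if "k < l - 1" for k using that by (auto simp: I'_def \<phi>_def)
  have d1: "1 \<le> d" using card_cut_set_even(2)[OF _ I'_sub lI'] l cI' by (simp add: d_def)
  have same: "card (ideal_family (classical_positive TypeD l) I) = card (ideal_family (classical_positive TypeD l) I')"
  proof (cases "l \<in> I")
    case True
    then have "l - 1 \<notin> I" using one by blast
    then have "adj_swap (l - 1) i = \<phi> i" if "i \<in> I" for i using that l by (auto simp: adj_swap_def \<phi>_def)
    then have "I' = adj_swap (l - 1) ` I" unfolding I'_def by (intro image_cong) auto
    then show ?thesis using card_ideal_family_fork_swap[OF l, of I] by simp
  next
    case False
    then have "\<phi> i = i" if "i \<in> I" for i using that by (auto simp: \<phi>_def)
    then have "I' = I" unfolding I'_def by simp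
    then show ?thesis by simp
  qed
  let ?T' = "{m. m \<in> I' \<and> m - 1 \<notin> I' \<and> m < l \<and> \<not> {m..l} \<subseteq> I'}"
  have T'_eq: "?T' = \<phi> ` ?St"
  proof (intro antisym subsetI)
    fix m assume m: "m \<in> ?T'"
    then obtain i where i: "i \<in> I" "m = \<phi> i" by (auto simp: I'_def)
    have m1: "m - 1 \<notin> I'" using m by simp
    have il: "i \<le> l" "1 \<le> i" using i I by auto
    have "component_start TypeD l I i"
    proof (cases "i = l")
      case True
      have "l - 2 \<notin> I'" using m1 i(2) True by (simp add: \<phi>_def numeral_2_eq_2)
      then have "l - 2 \<notin> I" using below[of "l - 2"] l by simp
      then show ?thesis using True i by (simp add: start)
    next
      case False
      then have "i - 1 \<notin> I'" using m1 i(2) by (simp add: \<phi>_def)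
      then have "i - 1 \<notin> I" using below[of "i - 1"] il False by simp
      then show ?thesis using False i by (simp add: start)
    qed
    then show "m \<in> \<phi> ` ?St" using i(2) by blast
  next
    fix m assume "m \<in> \<phi> ` ?St"
    then obtain i where i: "component_start TypeD l I i" "m = \<phi> i" by blast
    then have iI: "i \<in> I" by (simp add: start)
    then have mI: "m \<in> I'" using i(2) by (simp add: I'_def)
    have il: "i \<le> l" "1 \<le> i" using iI I by auto
    have ml: "m < l" using i(2) il l by (auto simp: \<phi>_def)
    have "m - 1 \<notin> I'"
    proof (cases "i = l")
      case True
      then have "l - 2 \<notin> I" using i(1) by (simp add: start)
      then have "l - 2 \<notin> I'" using below[of "l - 2"] l by simp
      then show ?thesis using i(2) True by (simp add: \<phi>_def numeral_2_eq_2)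
    next
      case False
      then have "i - 1 \<notin> I" "m = i" using i by (auto simp: start \<phi>_def)
      then show ?thesis using below[of "i - 1"] il False by simp
    qed
    moreover have "l \<in> {m..l}" using ml by simp
    then have "\<not> {m..l} \<subseteq> I'" using lI' by blast
    ultimately show "m \<in> ?T'" using mI ml by simp
  qed
  have St_inj: "inj_on \<phi> ?St" using \<phi>_inj by (rule inj_on_subset) (auto simp: start)
  have "(\<Sum>j = 1..s - 0. T' (2 * int d - comp_offset TypeD l s K j - 1) (comp_offset TypeD l s K j - 1))
      = (\<Sum>m\<in>?St. real_of_int (ballot (2 * d - 1) (?v m)))"
  proof (rule sum_T'_components[OF enumerated_components_axioms,
        where F = "\<lambda>L. T' (2 * int d - L - 1) (L - 1)" and v = ?v
          and g = "\<lambda>v. real_of_int (ballot (2 * d - 1) v)"])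
    show "comp_offset TypeD l s K j = int (?v (Min (K j))) + 1" if "j \<in> {1..s - 0}" for j
    proof -
      have j: "j \<in> {1..s}" using that by simp
      have st: "component_start TypeD l I (Min (K j))" by (rule component_start_Min[OF K_component[OF j]])
      note C = component_nonempty[OF K_component[OF j]]
      have le_l: "Min (K k) \<le> l" if "k \<in> {1..s}" for k
      proof -
        have "Min (K k) \<in> I" by (rule subsetD[OF component_nonempty(3,4)[OF K_component[OF that]]])
        then have "Min (K k) \<in> {1..l}" using I by (rule rev_subsetD)
        then show ?thesis by simp
      qed
      note Ml = le_l[OF j]
      show ?thesis
      proof (cases "Min (K j) = l")
        case True
        have "K j \<subseteq> {l}"
        proof
          fix i assume i: "i \<in> K j"
          then have "l \<le> i" using Min_le[OF C(1) i] True by simp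
          moreover have "i \<le> l" using i C I by auto
          ultimately show "i \<in> {l}" by simp
        qed
        then have Kj: "K j = {l}" using C by blast
        have "j = s"
        proof (rule ccontr)
          assume "j \<noteq> s"
          then have s: "s \<in> {1..s}" "j < s" using j by auto
          have "l < Min (K s)" using Min_K_less[OF j s] True by simp
          moreover have "Min (K s) \<le> l" by (rule le_l[OF s(1)])
          ultimately show False by simp
        qed
        have lI: "l \<in> I" "l - 1 \<notin> I" using st True one by (auto simp: start)
        have "{1..<l} - I = insert (l - 1) ({1..<l - 1} - I')"
        proof (intro antisym subsetI)
          fix k assume k: "k \<in> {1..<l} - I"
          show "k \<in> insert (l - 1) ({1..<l - 1} - I')"
          proof (cases "k = l - 1")
            case False
            then have "k < l - 1" using k by auto
            then show ?thesis using below[of k] k by simp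
          qed simp
        next
          fix k assume "k \<in> insert (l - 1) ({1..<l - 1} - I')"
          then show "k \<in> {1..<l} - I"
          proof
            assume k: "k \<in> {1..<l - 1} - I'"
            then have "k < l - 1" "k < l" by auto
            then show ?thesis using below[of k] k by simp
          qed (use lI l in simp)
        qed
        then have "card ({1..<l} - I) = Suc (card ({1..<l - 1} - I'))" by simp
        then show ?thesis using comp_offset_eq[OF j] True Kj \<open>j = s\<close> by (simp add: \<phi>_def)
      next
        case False
        have "\<not> (j = s \<and> K s = {l})"
        proof
          assume "j = s \<and> K s = {l}"
          then have "Min (K j) = Min {l}" by simp
          then show False using False by simp
        qed
        moreover have "{1..<Min (K j)} - I' = {1..<Min (K j)} - I"
        proof -
          have "k \<in> I' \<longleftrightarrow> k \<in> I" if "k < Min (K j)" for k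
            by (rule below) (use that Ml False in linarith)
          then show ?thesis by auto
        qed
        ultimately show ?thesis using comp_offset_eq[OF j] False by (simp add: \<phi>_def)
      qed
    qed
    fix m assume "m \<in> ?St"
    then have "\<phi> m \<le> l" using I by (auto simp: start \<phi>_def)
    then have "?v m \<le> d" using card_complement_below[OF I'_sub, of "\<phi> m"] cI' by (simp add: d_def)
    then have "?v m \<le> 2 * d - 1" using d1 by simp
    from T'_ballot[OF this]
    show "T' (2 * int d - (int (?v m) + 1) - 1) (int (?v m) + 1 - 1) = real_of_int (ballot (2 * d - 1) (?v m))"
      using d1 by (simp add: of_nat_diff algebra_simps)
  qed auto
  moreover have "real (card (ideal_family (classical_positive TypeD l) I))
      = real ((2 * d - 1) choose (d - 1)) + (\<Sum>m\<in>?St. real_of_int (ballot (2 * d - 1) (?v m)))"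
  proof -
    have div: "(2 * d - 1) div 2 = d - 1" using d1 by simp
    have "real_of_int (int (card (ideal_family (classical_positive TypeD l) I')))
        = real_of_int (int ((2 * d - 1) choose (d - 1)) + (\<Sum>m\<in>?T'. ballot (2 * d - 1) (card ({1..<m} - I'))))"
      using card_ideal_family_D_fork[OF rank I'_sub l1I'] lI' div unfolding cI' d_def by simp
    also have "(\<Sum>m\<in>?T'. ballot (2 * d - 1) (card ({1..<m} - I'))) = (\<Sum>m\<in>?St. ballot (2 * d - 1) (?v m))"
      unfolding T'_eq by (simp add: sum.reindex[OF St_inj])
    finally show ?thesis unfolding same by simp
  qed
  moreover have "(real d + 1) / 2 * catalan d = real ((2 * d - 1) choose (d - 1))"
    using catalan_central[of d] central_binomial_half[OF d1] by (simp add: algebra_simps)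
  ultimately show ?thesis by simp
qed

theorem theorem5p12:
  fixes scale :: "complex \<Rightarrow> 'g::ab_group_add \<Rightarrow> 'g"
    and brk :: "'g \<Rightarrow> 'g \<Rightarrow> 'g"
    and H :: "'g set"
    and X :: classical_type
    and l r s N :: nat
    and a :: "nat \<Rightarrow> 'g \<Rightarrow> complex"
    and I :: "nat set"
    and K :: "nat \<Rightarrow> nat set"
    and L :: "nat \<Rightarrow> int"
    and d :: int
  assumes "simple_lie_algebra scale brk"
    and "lie_algebra.cartan_subalgebra scale brk H"
    and "lie_algebra.simple_roots_of_type scale brk H X l a"
    and "I \<subseteq> {1..l}"
    and "r = card I"
    and "d = int l - int r"
    and "enumerates_components X l I s K"
    and "\<And>j. L j = comp_offset X l s K j"
    and "N = card (lie_algebra.ideal_root_sets scale brk H l a I)"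
  shows "(X = TypeA \<longrightarrow> real N = catalan (l - r + 1)) \<and>
    (X = TypeB \<longrightarrow>
      real N = (d + 1) * catalan (l - r)
        + (\<Sum>j = 1..(if l \<in> I then s - 1 else s). T' (2 * d - L j) (L j - 1))) \<and>
    (X = TypeC \<longrightarrow>
      (l \<notin> I \<longrightarrow> real N = (d + 1) * catalan (l - r)) \<and>
      (l \<in> I \<longrightarrow> real N = (d + 2) / 2 * catalan (l - r + 1))) \<and>
    (X = TypeD \<longrightarrow>
      (card ({l - 1, l} \<inter> I) = 1 \<longrightarrow>
        real N = (d + 1) / 2 * catalan (l - r)
          + (\<Sum>j = 1..s. T' (2 * d - L j - 1) (L j - 1))) \<and>
      ({l - 1, l} \<subseteq> I \<longrightarrow>
        real N = (d + 1) * catalan (l - r)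
          + (\<Sum>j = 1..(if l - 2 \<in> I then s - 1 else s - 2). T' (2 * d - L j) (L j - 1))) \<and>
      ({l - 1, l} \<inter> I = {} \<longrightarrow>
        real N = (3 * d - 2) * catalan (l - r - 1)
          + (\<Sum>j = 1..s. T' (2 * d - L j - 1) (L j - 2) + T' (2 * d - L j - 1) (L j - 1))))"
proof -
  interpret simple_lie_algebra scale brk by fact
  have rank: "admissible_rank X l" using assms(3) by (simp add: simple_roots_of_type_def)
  have N: "N = card (ideal_family (classical_positive X l) I)"
    using card_ideal_root_sets_classical[OF assms(1-4)] assms(9) by simp
  have "card I \<le> card {1..l}" using assms(4) by (intro card_mono) auto
  then have r: "r \<le> l" using assms(5) by simp
  then have d: "d = int (l - r)" using assms(6) by simp
  then have real_d: "real_of_int d = real (l - r)" by simp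
  have L: "L = comp_offset X l s K" using assms(8) by blast
  note enum = assms(7) and I = assms(4)
  have A: "real N = catalan (l - r + 1)" if X: "X = TypeA"
  proof -
    have "int N = ballot (2 * (l - r + 1)) (l - r + 1)"
      using card_ideal_family_A[OF rank[unfolded X] I] unfolding N X assms(5) .
    then have "real N = real_of_int (ballot (2 * (l - r + 1)) (l - r + 1))" by (metis of_int_of_nat_eq)
    then show ?thesis by (simp only: ballot_catalan)
  qed
  have B: "real N = (d + 1) * catalan (l - r)
        + (\<Sum>j = 1..(if l \<in> I then s - 1 else s). T' (2 * d - L j) (L j - 1))" if X: "X = TypeB"
    using formula_B[OF rank[unfolded X] I enum[unfolded X]]
    unfolding N X L d assms(5) by simp
  have C: "real N = (if l \<in> I then (d + 2) / 2 * catalan (l - r + 1) else (d + 1) * catalan (l - r))"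
    if X: "X = TypeC"
    using formula_C[OF rank[unfolded X] I] unfolding N X d assms(5) by simp
  have D1: "real N = (d + 1) / 2 * catalan (l - r) + (\<Sum>j = 1..s. T' (2 * d - L j - 1) (L j - 1))"
    if X: "X = TypeD" and one: "card ({l - 1, l} \<inter> I) = 1"
  proof -
    have "l - 1 \<noteq> l" using rank X by simp
    then have "l - 1 \<in> I \<and> l \<notin> I \<or> l - 1 \<notin> I \<and> l \<in> I"
      using one by (cases "l - 1 \<in> I"; cases "l \<in> I") (auto simp: Int_insert_left)
    from formula_D_one[OF rank[unfolded X] I enum[unfolded X] this]
    show ?thesis unfolding N X L d assms(5) by simp
  qed
  have D2: "real N = (d + 1) * catalan (l - r)
          + (\<Sum>j = 1..(if l - 2 \<in> I then s - 1 else s - 2). T' (2 * d - L j) (L j - 1))"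
    if X: "X = TypeD" and both: "{l - 1, l} \<subseteq> I"
    using formula_D_both[OF rank[unfolded X] I enum[unfolded X] both] unfolding N X L d assms(5) by simp
  have D0: "real N = (3 * d - 2) * catalan (l - r - 1)
          + (\<Sum>j = 1..s. T' (2 * d - L j - 1) (L j - 2) + T' (2 * d - L j - 1) (L j - 1))"
    if X: "X = TypeD" and none: "{l - 1, l} \<inter> I = {}"
  proof -
    have "l - 1 \<notin> I" "l \<notin> I" using none by auto
    from formula_D_open[OF rank[unfolded X] I enum[unfolded X] this]
    show ?thesis unfolding N X L d assms(5) by simp
  qed
  show ?thesis
    using A B C D0 D1 D2 by (intro conjI impI) simp_all
qed

end
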